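(* Let $0<\alpha<1$, $\theta>-\alpha$, and let $$\gamma_\alpha(t)=C_{\alpha,\theta}\,t^{1-\theta}f_\alpha(t)f_\alpha(t),\qquad t>0,$$ where $C_{\alpha,\theta}$ is the normalizing constant making $\gamma_\alpha$ a probability density. Then for $n=2,3,\ldots$ and $k=1,\ldots,n$, the quantity $V_{n,k}=\int_0^\infty\mathbb{G}^{(n,k)}_\alpha(t)\gamma_\alpha(t)dt$ satisfies $$V_{n,k}=C_{\alpha,\theta}\frac{\alpha^{k-1}\Gamma(\theta/\alpha+k)}{\Gamma(\theta+n-1)}\int_0^1(1-x)^{n+\theta-2}\,\Delta_{\theta+k\alpha}(x|F_{X_\alpha})\,dx .$$ (i) In particular, when $\theta=0$, $$V_{n,k}=\frac{\alpha^{k-1}\Gamma(k)}{\Gamma(n-1)}\sum_{j=0}^{k}\binom kj\sin\!\left(\frac\pi2(k-j)\right)\varphi^{(n,k)}_j,\qquad \varphi^{(n,k)}_j=\frac{2\pi(1+\cos(\alpha\pi))}{\sin(\pi\alpha)}\int_0^1(1-x)^{n-2}\vartheta^{(n,k)}_j(x)\,dx,$$ and $\vartheta^{(n,k)}_j(x)>0$ for $0<x<1$. (ii) When $\theta=0$ and $n>1$, $$V_{n,1}=\frac{2(1+\cos(\alpha\pi))}{\Gamma(n-1)}\int_0^1\frac{(1-x)^{n-2}x^\alpha}{x^{2\alpha}+2x^\alpha\cos(\alpha\pi)+1}\,dx .$$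
   Context: $f_\alpha$ is the density on $(0,\infty)$ of the positive $\alpha$-stable random variable with Laplace transform $e^{-\lambda^\alpha}$, and $\mathbb{G}_{\alpha}^{(n,k)}(t)=\frac{\alpha^{k}t^{-k\alpha}}{\Gamma(n-k\alpha)f_{\alpha}(t)}\int_{0}^{1}f_{\alpha}(tu)(1-u)^{n-k\alpha-1}du$. (The EPPF of the Poisson–Kingman partition $\mathrm{PK}(\rho_\alpha,\gamma_\alpha)$ is $V_{n,k}\prod_{j=1}^k\Gamma(n_j-\alpha)/\Gamma(1-\alpha)$.) $X_\alpha=S_\alpha/S_\alpha'$ is the ratio of two independent copies of that stable variable; its cdf is, for $y>0$, $$F_{X_\alpha}(y)=1-\frac1{\pi\alpha}\cot^{-1}\!\left(\cot(\pi\alpha)+\frac{y^\alpha}{\sin(\pi\alpha)}\right),\qquad \cot^{-1}\text{ taking values in }(0,\pi).$$ For $\theta'>0$ and $x>0$, $$\Delta_{\theta'}(x|F_{X_\alpha})=\frac1\pi\frac{\sin(\pi\theta'F_{X_\alpha}(x))}{[x^{2\alpha}+2x^\alpha\cos(\alpha\pi)+1]^{\theta'/(2\alpha)}},$$ and, for $0\le j\le k$, $$\vartheta^{(n,k)}_j(x)=\frac{[\sin(\pi\alpha)]^{k-j}}{\pi}\,\frac{(x^\alpha\cos(\alpha\pi)+1)^jx^{\alpha(k-j)}}{[x^{2\alpha}+2x^\alpha\cos(\alpha\pi)+1]^k}.$$ *)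

theory Defs
  imports "HOL-Probability.Probability"
begin

definition positive_stable_law :: "real \<Rightarrow> real measure \<Rightarrow> bool" where
  "positive_stable_law \<alpha> \<mu> \<longleftrightarrow>
     prob_space \<mu> \<and> sets \<mu> = sets borel \<and> (AE t in \<mu>. 0 < t) \<and>
     (\<forall>s\<ge>0. (\<integral>t. exp (- s * t) \<partial>\<mu>) = exp (- (s powr \<alpha>)))"

text \<open>
  A Lebesgue density is determined only almost everywhere, and any version is admitted here.
  The integrals built from it below do not depend on the choice: the density also occurs as a
  factor wherever it is divided by.
\<close>

definition stable_density :: "real \<Rightarrow> (real \<Rightarrow> real) \<Rightarrow> bool" where
  "stable_density \<alpha> f \<longleftrightarrow>
     f \<in> borel_measurable borel \<and> (\<forall>t. 0 \<le> f t) \<and> (\<forall>t\<le>0. f t = 0) \<and>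
     positive_stable_law \<alpha> (density lborel (\<lambda>t. ennreal (f t)))"

definition G_stable :: "real \<Rightarrow> (real \<Rightarrow> real) \<Rightarrow> nat \<Rightarrow> nat \<Rightarrow> real \<Rightarrow> real" where
  "G_stable \<alpha> f n k t =
     \<alpha> ^ k * t powr (- (real k * \<alpha>)) / (Gamma (real n - real k * \<alpha>) * f t) *
     (LINT u:{0<..<1}|lborel. f (t * u) * (1 - u) powr (real n - real k * \<alpha> - 1))"

definition V_PK :: "real \<Rightarrow> (real \<Rightarrow> real) \<Rightarrow> (real \<Rightarrow> real) \<Rightarrow> nat \<Rightarrow> nat \<Rightarrow> real" where
  "V_PK \<alpha> f \<gamma> n k = (LINT t:{0<..}|lborel. G_stable \<alpha> f n k t * \<gamma> t)"

definition norm_const :: "(real \<Rightarrow> real) \<Rightarrow> real \<Rightarrow> real" where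
  "norm_const f \<theta> = 1 / (LINT t:{0<..}|lborel. t powr (1 - \<theta>) * f t * f t)"

definition mixing_density :: "(real \<Rightarrow> real) \<Rightarrow> real \<Rightarrow> real \<Rightarrow> real" where
  "mixing_density f \<theta> t = (if 0 < t then norm_const f \<theta> * t powr (1 - \<theta>) * f t * f t else 0)"

text \<open>
  The distribution function of the ratio of two independent random variables with density \<open>f\<close>:
  the joint law of an independent pair is the product measure.
\<close>

definition ratio_cdf :: "(real \<Rightarrow> real) \<Rightarrow> real \<Rightarrow> real" where
  "ratio_cdf f =
     (let \<mu> = density lborel (\<lambda>t. ennreal (f t))
      in cdf (distr (\<mu> \<Otimes>\<^sub>M \<mu>) borel (\<lambda>(s, s'). s / s')))"

definition Delta :: "real \<Rightarrow> real \<Rightarrow> (real \<Rightarrow> real) \<Rightarrow> real \<Rightarrow> real" where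
  "Delta \<alpha> \<theta>' F x =
     1 / pi * (sin (pi * \<theta>' * F x) /
       (x powr (2 * \<alpha>) + 2 * x powr \<alpha> * cos (\<alpha> * pi) + 1) powr (\<theta>' / (2 * \<alpha>)))"

text \<open>
  The kernels \<open>\<vartheta>\<close>, indexed in the source by \<open>n\<close>, \<open>k\<close> and \<open>j \<le> k\<close>,
  do not depend on \<open>n\<close>. The subtraction \<open>k - j\<close> is meant only for \<open>j \<le> k\<close>.
\<close>

definition vartheta_kernel :: "real \<Rightarrow> nat \<Rightarrow> nat \<Rightarrow> real \<Rightarrow> real" where
  "vartheta_kernel \<alpha> k j x =
     sin (pi * \<alpha>) ^ (k - j) / pi *
     ((x powr \<alpha> * cos (\<alpha> * pi) + 1) ^ j * x powr (\<alpha> * real (k - j)) /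
      (x powr (2 * \<alpha>) + 2 * x powr \<alpha> * cos (\<alpha> * pi) + 1) ^ k)"

definition varphi_coeff :: "real \<Rightarrow> nat \<Rightarrow> nat \<Rightarrow> nat \<Rightarrow> real" where
  "varphi_coeff \<alpha> n k j =
     2 * pi * (1 + cos (\<alpha> * pi)) / sin (pi * \<alpha>) *
     (LINT x:{0<..<1}|lborel. (1 - x) ^ (n - 2) * vartheta_kernel \<alpha> k j x)"

end

theory Submission
  imports Defs "HOL-Complex_Analysis.Complex_Analysis" "HOL-Real_Asymp.Real_Asymp"
begin

text \<open>
  Write \<open>c = cos (\<pi> \<alpha>)\<close> and \<open>s = sin (\<pi> \<alpha>)\<close>. Up to the factor
  \<open>norm_const f \<theta> * \<alpha> ^ k / Gamma b\<close>, with \<open>b = n - k \<alpha>\<close> and \<open>d = \<theta> + k \<alpha>\<close>,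
  the weight is an integral \<open>\<integral> w t * f t dt\<close> over \<open>t > 0\<close>, where
  \<open>w t = t powr (1 - d) * (\<integral> f (t * u) * (1 - u) powr (b - 1) du)\<close>. The density \<open>f\<close> is known only through
  its Laplace transform, and a Laplace transform says nothing directly about the product \<open>w * f\<close>.
  One of the two copies of \<open>f\<close> is therefore made explicit: folding the Bromwich integral
  of \<open>exp (- z powr \<alpha>)\<close> onto the negative half line gives
  \<open>f t = \<integral> exp (- t * y) * \<kappa> y dy\<close> with
  \<open>\<kappa> y = exp (- y powr \<alpha> * c) * sin (y powr \<alpha> * s) / \<pi>\<close>. Hence, by Fubini, \<open>\<integral> w t * f t dt\<close> equals
  \<open>\<integral> W y * \<kappa> y dy\<close>, where \<open>W\<close> is the Laplace transform of \<open>w\<close> (lemma \<open>pairing\<close>), and \<open>W\<close> is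
  computable, because it depends on the other copy of \<open>f\<close> only through \<open>exp (- z powr \<alpha>)\<close>.

  Three choices of \<open>w\<close> give everything. For the weight itself, the identity
  \<open>t powr (- \<nu>) * exp (- t) = (\<integral> (1 - x) powr (\<nu> - 1) * x powr (- \<nu> - 1) * exp (- t / x) dx) / Gamma \<nu>\<close>
  over \<open>0 < x < 1\<close>, with \<open>\<nu> = b + d - 1 = n + \<theta> - 1\<close>, presents \<open>W y\<close> as a mixture over \<open>x\<close> of
  \<open>x powr (- d) * y powr (d - 1) * exp (- (y / x) powr \<alpha>)\<close>. Integrating this against \<open>\<kappa>\<close> is, after
  \<open>q = y powr \<alpha>\<close>, the imaginary part of a Gamma integral with complex rate
  \<open>x powr (- \<alpha>) + c - \<i> * s\<close>, which is the kernel \<open>\<Delta>\<close> up to constants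
  (lemmas \<open>beta_average_laplace_shifted\<close>, \<open>Delta_ratio_cdf\<close>, \<open>beta_average_pairing\<close>).
  The choice \<open>w t = P (S \<le> x * t)\<close> gives the distribution function of the ratio as the angle
  \<open>arctan (s / (x powr (- \<alpha>) + c)) / (\<pi> * \<alpha>)\<close>, and \<open>w t = t * f t\<close> gives \<open>\<integral> t * (f t)\<^sup>2 dt\<close>,
  the normalisation at \<open>\<theta> = 0\<close>. With \<open>\<theta> = 0\<close> the kernel \<open>\<Delta>\<close> of order \<open>k * \<alpha>\<close> is the
  imaginary part of the \<open>k\<close>-th power of \<open>1 + x powr \<alpha> * exp (\<i> * \<pi> * \<alpha>)\<close>, divided by \<open>\<pi>\<close> and the
  \<open>k\<close>-th power of its squared modulus; the binomial theorem then yields (i), and \<open>k = 1\<close> yields (ii).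

  The inversion formula is obtained by exhibiting a function with the Laplace transform
  \<open>exp (- z powr \<alpha>)\<close> and appealing to uniqueness. All contour deformations are carried out in the
  logarithmic coordinate \<open>z = exp w\<close>: rays from the origin become horizontal lines, the branch cut of
  \<open>z powr \<alpha> = exp (\<alpha> * w)\<close> disappears, and one lemma on shifting horizontal lines
  (\<open>strip_shift_decay\<close>) replaces Cauchy's theorem on sectors.
\<close>

section \<open>Substitutions, Fubini and shifts of horizontal lines\<close>

text \<open>
  The substitution \<open>y = exp x\<close>, stated once as an identity of measures so that it transports
  nonnegative integrals, integrability and Bochner integrals alike.
\<close>

lemma distr_exp_lborel:
  "distr (density lborel (\<lambda>x. ennreal (exp x))) borel exp
     = density lborel (indicator {0<..} :: real \<Rightarrow> ennreal)" (is "?L = ?R")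
proof (rule measure_eqI)
  show "sets ?L = sets ?R" by simp
next
  fix A :: "real set" assume "A \<in> sets ?L"
  then have A[measurable]: "A \<in> sets borel" by simp
  define I where "I n = {exp (- real n)..exp (real n)}" for n
  have I[measurable]: "I n \<in> sets borel" for n by (simp add: I_def)
  have ex: "\<exists>n. y \<in> I n" if "y > 0" for y
  proof -
    obtain n :: nat where "\<bar>ln y\<bar> \<le> real n" using real_arch_simple by blast
    then have "exp (- real n) \<le> exp (ln y)" "exp (ln y) \<le> exp (real n)"
      unfolding exp_le_cancel_iff by linarith+
    then show ?thesis using that by (auto simp: I_def)
  qed
  have pos: "y > 0" if "y \<in> I n" for y n
    using that less_le_trans[OF exp_gt_zero[of "- real n"], of y] unfolding I_def by auto
  have inc: "incseq (\<lambda>n. A \<inter> I n)"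
  proof (rule incseq_SucI)
    fix n
    have "I n \<subseteq> I (Suc n)"
      unfolding I_def atLeastatMost_subset_iff by simp
    then show "A \<inter> I n \<le> A \<inter> I (Suc n)" by blast
  qed
  have em: "emeasure ?L B = (\<integral>\<^sup>+x. indicator B (exp x) * ennreal (exp x) \<partial>lborel)"
    if [measurable]: "B \<in> sets borel" for B
  proof -
    have "exp -` B \<inter> space borel \<in> sets (borel :: real measure)"
      by (rule measurable_sets[OF borel_measurable_exp]) simp
    then show ?thesis
      by (subst emeasure_distr, simp, simp, subst emeasure_density)
         (auto intro!: nn_integral_cong simp: indicator_def)
  qed
  have seg: "emeasure ?L (A \<inter> I n) = emeasure ?R (A \<inter> I n)" for n
  proof -
    have "emeasure ?L (A \<inter> I n) = (\<integral>\<^sup>+x. indicator A (exp x) * ennreal (exp x) * indicator {- real n..real n} x \<partial>lborel)"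
      by (subst em) (auto intro!: nn_integral_cong simp: indicator_def I_def)
    also have "\<dots> = (\<integral>\<^sup>+y. indicator A y * indicator (I n) y \<partial>lborel)"
      using nn_integral_substitution[of exp "- real n" "real n" "indicator A" exp]
      by (simp add: set_borel_measurable_def DERIV_exp continuous_on_exp continuous_on_id
          ennreal_indicator ennreal_mult I_def)
    also have "\<dots> = emeasure ?R (A \<inter> I n)"
      by (subst emeasure_density) (auto intro!: nn_integral_cong simp: indicator_def dest: pos)
    finally show ?thesis .
  qed
  have U: "A \<inter> {0<..} = (\<Union>n. A \<inter> I n)" using ex pos by auto
  have null: "emeasure ?L A = emeasure ?L (\<Union>n. A \<inter> I n)"
    unfolding U[symmetric]
    by (subst (1 2) em) (auto intro!: nn_integral_cong simp: indicator_def)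
  have nullR: "emeasure ?R A = emeasure ?R (\<Union>n. A \<inter> I n)"
    unfolding U[symmetric]
    by (subst (1 2) emeasure_density) (auto intro!: nn_integral_cong simp: indicator_def)
  have "emeasure ?L (\<Union>n. A \<inter> I n) = (SUP n. emeasure ?L (A \<inter> I n))"
    by (rule SUP_emeasure_incseq[symmetric]) (use inc in auto)
  also have "\<dots> = (SUP n. emeasure ?R (A \<inter> I n))"
    by (simp add: seg)
  also have "\<dots> = emeasure ?R (\<Union>n. A \<inter> I n)"
    by (rule SUP_emeasure_incseq) (use inc in auto)
  finally show "emeasure ?L A = emeasure ?R A"
    using null nullR by simp
qed

lemma nn_integral_exp_subst:
  fixes \<phi> :: "real \<Rightarrow> ennreal"
  assumes [measurable]: "\<phi> \<in> borel_measurable borel"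
  shows "(\<integral>\<^sup>+y. indicator {0<..} y * \<phi> y \<partial>lborel) = (\<integral>\<^sup>+x. ennreal (exp x) * \<phi> (exp x) \<partial>lborel)"
proof -
  have "(\<integral>\<^sup>+y. indicator {0<..} y * \<phi> y \<partial>lborel) = (\<integral>\<^sup>+y. \<phi> y \<partial>density lborel (indicator {0<..} :: real \<Rightarrow> ennreal))"
    by (subst nn_integral_density) auto
  also have "\<dots> = (\<integral>\<^sup>+x. ennreal (exp x) * \<phi> (exp x) \<partial>lborel)"
    unfolding distr_exp_lborel[symmetric]
    by (subst nn_integral_distr, simp, simp, subst nn_integral_density) auto
  finally show ?thesis .
qed

lemma set_integral_exp_subst:
  fixes \<phi> :: "real \<Rightarrow> 'a::{banach, second_countable_topology}"
  assumes [measurable]: "\<phi> \<in> borel_measurable borel"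
  shows "set_integrable lborel {0<..} \<phi> \<longleftrightarrow> integrable lborel (\<lambda>x. exp x *\<^sub>R \<phi> (exp x))" (is ?I)
    and "(LINT y:{0<..}|lborel. \<phi> y) = (LINT x|lborel. exp x *\<^sub>R \<phi> (exp x))" (is ?L)
proof -
  have d: "density lborel (\<lambda>y. ennreal (indicat_real {0<..} y)) = distr (density lborel (\<lambda>x. ennreal (exp x))) borel exp"
    unfolding distr_exp_lborel by (simp add: ennreal_indicator)
  have "set_integrable lborel {0<..} \<phi> \<longleftrightarrow> integrable (density lborel (\<lambda>y. ennreal (indicat_real {0<..} y))) \<phi>"
    unfolding set_integrable_def by (subst integrable_density) auto
  also have "\<dots> \<longleftrightarrow> integrable lborel (\<lambda>x. exp x *\<^sub>R \<phi> (exp x))"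
    unfolding d by (subst integrable_distr_eq, simp, simp, subst integrable_density) auto
  finally show ?I .
  have "(LINT y:{0<..}|lborel. \<phi> y) = (LINT y|density lborel (\<lambda>y. ennreal (indicat_real {0<..} y)). \<phi> y)"
    unfolding set_lebesgue_integral_def by (subst integral_density) auto
  also have "\<dots> = (LINT x|lborel. exp x *\<^sub>R \<phi> (exp x))"
    unfolding d by (subst integral_distr, simp, simp, subst integral_density) auto
  finally show ?L .
qed

lemma fubini_lborel:
  fixes f :: "real \<Rightarrow> real \<Rightarrow> 'a::{banach, second_countable_topology}"
  assumes [measurable]: "(\<lambda>(x, y). f x y) \<in> borel_measurable (lborel \<Otimes>\<^sub>M lborel)"
    and fin: "(\<integral>\<^sup>+x. \<integral>\<^sup>+y. ennreal (norm (f x y)) \<partial>lborel \<partial>lborel) < \<infinity>"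
  shows "(LINT x|lborel. LINT y|lborel. f x y) = (LINT y|lborel. LINT x|lborel. f x y)"
    and "integrable lborel (\<lambda>x. LINT y|lborel. f x y)"
    and "integrable lborel (\<lambda>y. LINT x|lborel. f x y)"
proof -
  have i: "integrable (lborel \<Otimes>\<^sub>M lborel) (\<lambda>(x, y). f x y)"
  proof (rule integrableI_bounded)
    have "(\<integral>\<^sup>+p. ennreal (norm (case p of (x, y) \<Rightarrow> f x y)) \<partial>(lborel \<Otimes>\<^sub>M lborel))
        = (\<integral>\<^sup>+x. \<integral>\<^sup>+y. ennreal (norm (f x y)) \<partial>lborel \<partial>lborel)"
      by (subst lborel.nn_integral_fst[symmetric]) auto
    with fin show "(\<integral>\<^sup>+p. ennreal (norm (case p of (x, y) \<Rightarrow> f x y)) \<partial>(lborel \<Otimes>\<^sub>M lborel)) < \<infinity>"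
      by simp
  qed simp
  show "(LINT x|lborel. LINT y|lborel. f x y) = (LINT y|lborel. LINT x|lborel. f x y)"
    using lborel_pair.Fubini_integral[OF i] by simp
  show "integrable lborel (\<lambda>x. LINT y|lborel. f x y)" by (rule lborel_pair.integrable_fst[OF i])
  show "integrable lborel (\<lambda>y. LINT x|lborel. f x y)" by (rule lborel_pair.integrable_snd[OF i])
qed

text \<open>
  A primitive of \<open>G\<close> turns the integral over a segment of each line into a difference of its values
  at the end points. The primitive varies along the short vertical sides by at most \<open>B x * (b - a)\<close>,
  so the two line integrals agree in the limit.
\<close>

lemma strip_shift:
  fixes G :: "complex \<Rightarrow> complex" and a b :: real
  assumes ab: "a \<le> b" and S: "open S" "convex S" "G holomorphic_on S"
    and strip: "\<And>x \<eta>. a \<le> \<eta> \<Longrightarrow> \<eta> \<le> b \<Longrightarrow> Complex x \<eta> \<in> S"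
    and bound: "\<And>x \<eta>. N \<le> \<bar>x\<bar> \<Longrightarrow> a \<le> \<eta> \<Longrightarrow> \<eta> \<le> b \<Longrightarrow> norm (G (Complex x \<eta>)) \<le> B x"
    and lim: "(B \<longlongrightarrow> 0) at_top" "(B \<longlongrightarrow> 0) at_bot"
    and int: "integrable lborel (\<lambda>x. G (Complex x a))" "integrable lborel (\<lambda>x. G (Complex x b))"
  shows "(LINT x|lborel. G (Complex x a)) = (LINT x|lborel. G (Complex x b))"
proof -
  have "\<exists>P. \<forall>z\<in>S. (P has_field_derivative G z) (at z within S)"
  proof (rule holomorphic_convex_primitive'[OF S(2,1,3)])
    fix g assume "\<And>x. x \<in> S \<Longrightarrow> (g has_field_derivative G x) (at x within S)"
    then show ?thesis by (intro exI[of _ g] ballI)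
  qed
  then obtain P where P: "\<forall>z\<in>S. (P has_field_derivative G z) (at z within S)" ..
  have P': "(P has_field_derivative G z) (at z)" if "z \<in> S" for z
    using bspec[OF P that] unfolding at_within_open[OF that S(1)] .
  have cont: "continuous_on S G" using S(3) holomorphic_on_imp_continuous_on by blast
  have ftc: "(LINT x|lborel. indicator {- real n..real n} x *\<^sub>R G (Complex x \<eta>))
       = P (Complex (real n) \<eta>) - P (Complex (- real n) \<eta>)" if "a \<le> \<eta>" "\<eta> \<le> b" for n \<eta>
  proof (rule integral_FTC_atLeastAtMost)
    show "((\<lambda>x. P (Complex x \<eta>)) has_vector_derivative G (Complex x \<eta>)) (at x within {- real n..real n})" for x
    proof -
      have "((\<lambda>x. of_real x + \<i> * of_real \<eta> :: complex) has_vector_derivative 1) (at x within {- real n..real n})"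
        by (auto intro!: derivative_eq_intros)
      then show ?thesis
        using field_vector_diff_chain_within[of "\<lambda>x. of_real x + \<i> * of_real \<eta>" 1 x "{- real n..real n}" P "G (Complex x \<eta>)"]
          has_field_derivative_at_within[OF P'[OF strip[OF that, of x]]]
        unfolding o_def Complex_eq by simp
    qed
    show "continuous_on {- real n..real n} (\<lambda>x. G (Complex x \<eta>))"
      by (intro continuous_on_compose2[OF cont]) (auto simp: strip that complex_eq intro!: continuous_intros)
  qed simp
  have lim_n: "(\<lambda>n. LINT x|lborel. indicator {- real n..real n} x *\<^sub>R G (Complex x \<eta>))
      \<longlonglongrightarrow> (LINT x|lborel. G (Complex x \<eta>))" if "integrable lborel (\<lambda>x. G (Complex x \<eta>))" for \<eta>
  proof (rule integral_dominated_convergence[where w="\<lambda>x. norm (G (Complex x \<eta>))"])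
    have "(\<lambda>n. indicator {- real n..real n} x *\<^sub>R G (Complex x \<eta>)) \<longlonglongrightarrow> G (Complex x \<eta>)" for x
    proof (rule tendsto_eventually)
      have "\<forall>\<^sub>F n in sequentially. \<bar>x\<bar> \<le> real n"
        using filterlim_real_sequentially unfolding filterlim_at_top by blast
      then show "\<forall>\<^sub>F n in sequentially. indicator {- real n..real n} x *\<^sub>R G (Complex x \<eta>) = G (Complex x \<eta>)"
        by eventually_elim (auto simp: indicator_def)
    qed
    then show "AE x in lborel. (\<lambda>n. indicator {- real n..real n} x *\<^sub>R G (Complex x \<eta>)) \<longlonglongrightarrow> G (Complex x \<eta>)" by simp
  qed (use that in \<open>auto simp: indicator_def\<close>)
  have side: "norm (P (Complex x b) - P (Complex x a)) \<le> B x * (b - a)" if N: "N \<le> \<bar>x\<bar>" for x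
  proof -
    have seg: "closed_segment (Complex x a) (Complex x b) \<subseteq> {Complex x \<eta> |\<eta>. a \<le> \<eta> \<and> \<eta> \<le> b}"
    proof
      fix z assume "z \<in> closed_segment (Complex x a) (Complex x b)"
      then obtain u where u: "0 \<le> u" "u \<le> 1" "z = (1 - u) *\<^sub>R Complex x a + u *\<^sub>R Complex x b"
        by (auto simp: closed_segment_def)
      have "z = Complex x (a + u * (b - a))"
        unfolding u(3) by (simp add: complex_eq_iff algebra_simps)
      moreover have "0 \<le> u * (b - a)" "u * (b - a) \<le> 1 * (b - a)"
        using u(1) ab by simp (rule mult_right_mono, use u ab in auto)
      ultimately show "z \<in> {Complex x \<eta> |\<eta>. a \<le> \<eta> \<and> \<eta> \<le> b}" by force
    qed
    have "norm (P (Complex x b) - P (Complex x a)) \<le> B x * norm (Complex x b - Complex x a)"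
    proof (rule field_differentiable_bound[where S="closed_segment (Complex x a) (Complex x b)"])
      fix z assume z: "z \<in> closed_segment (Complex x a) (Complex x b)"
      then obtain \<eta> where e: "z = Complex x \<eta>" "a \<le> \<eta>" "\<eta> \<le> b" using seg by blast
      show "(P has_field_derivative G z) (at z within closed_segment (Complex x a) (Complex x b))"
        using P'[of z] e strip by (auto intro: has_field_derivative_at_within)
      show "norm (G z) \<le> B x" using bound[OF N] e by auto
    qed auto
    also have "norm (Complex x b - Complex x a) = b - a"
      using ab by (simp add: cmod_def)
    finally show ?thesis .
  qed
  have evN: "\<forall>\<^sub>F n in sequentially. N \<le> \<bar>real n\<bar>" "\<forall>\<^sub>F n in sequentially. N \<le> \<bar>- real n\<bar>"
    using filterlim_real_sequentially unfolding filterlim_at_top by simp_all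
  have "(\<lambda>n. (P (Complex (real n) b) - P (Complex (real n) a)) - (P (Complex (- real n) b) - P (Complex (- real n) a))) \<longlonglongrightarrow> 0 - 0"
  proof (intro tendsto_diff)
    have 1: "(\<lambda>n. B (real n) * (b - a)) \<longlonglongrightarrow> 0 * (b - a)" 
      by (intro tendsto_intros filterlim_compose[OF lim(1) filterlim_real_sequentially])
    show "(\<lambda>n. P (Complex (real n) b) - P (Complex (real n) a)) \<longlonglongrightarrow> 0"
      by (rule Lim_null_comparison[where g="\<lambda>n. B (real n) * (b - a)"]) (use 1 evN(1) side in \<open>auto elim: eventually_mono\<close>)
    have 2: "(\<lambda>n. B (- real n) * (b - a)) \<longlonglongrightarrow> 0 * (b - a)" 
      by (intro tendsto_intros filterlim_compose[OF lim(2)] filterlim_compose[OF filterlim_uminus_at_bot_at_top filterlim_real_sequentially])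
    show "(\<lambda>n. P (Complex (- real n) b) - P (Complex (- real n) a)) \<longlonglongrightarrow> 0"
      by (rule Lim_null_comparison[where g="\<lambda>n. B (- real n) * (b - a)"]) (use 2 evN(2) side in \<open>auto elim!: eventually_mono\<close>)
  qed
  moreover have "(\<lambda>n. (P (Complex (real n) b) - P (Complex (real n) a)) - (P (Complex (- real n) b) - P (Complex (- real n) a)))
     \<longlonglongrightarrow> (LINT x|lborel. G (Complex x b)) - (LINT x|lborel. G (Complex x a))"
    using tendsto_diff[OF lim_n[OF int(2)] lim_n[OF int(1)]] ab ftc[of a] ftc[of b]
    by (simp add: algebra_simps)
  ultimately show ?thesis using LIMSEQ_unique by fastforce
qed

lemma integrable_exp_decay:
  fixes F :: "real \<Rightarrow> complex" and \<epsilon> N :: real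
  assumes cont: "continuous_on UNIV F" and bound: "\<And>x. N \<le> \<bar>x\<bar> \<Longrightarrow> norm (F x) \<le> B x" and "\<epsilon> > 0"
    and lim: "((\<lambda>x. exp (\<epsilon> * x) * B x) \<longlongrightarrow> 0) at_top" "((\<lambda>x. exp (- \<epsilon> * x) * B x) \<longlongrightarrow> 0) at_bot"
  shows "integrable lborel F"
proof -
  have "\<forall>\<^sub>F x in at_top. exp (\<epsilon> * x) * B x < 1" "\<forall>\<^sub>F x in at_bot. exp (- \<epsilon> * x) * B x < 1"
    using order_tendstoD(2)[OF lim(1), of 1] order_tendstoD(2)[OF lim(2), of 1] by auto
  then obtain M1 M2 where M1: "\<And>x. x \<ge> M1 \<Longrightarrow> exp (\<epsilon> * x) * B x < 1" and M2: "\<And>x. x \<le> M2 \<Longrightarrow> exp (- \<epsilon> * x) * B x < 1"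
    unfolding eventually_at_top_linorder eventually_at_bot_linorder by auto
  define M where "M = max (max \<bar>M1\<bar> \<bar>M2\<bar>) \<bar>N\<bar>"
  have "bounded (F ` {-M..M})"
    by (intro compact_imp_bounded compact_continuous_image continuous_on_subset[OF cont]) auto
  then obtain K where K: "\<And>x. x \<in> {-M..M} \<Longrightarrow> norm (F x) \<le> K" "K > 0"
    unfolding bounded_pos by blast
  define C where "C = max 1 (K * exp (\<epsilon> * M))"
  have le: "norm (F x) \<le> C * exp (- (\<epsilon> * \<bar>x\<bar>))" for x
  proof (cases "\<bar>x\<bar> \<le> M")
    case True
    then have "norm (F x) \<le> K" using K(1)[of x] True by (auto simp: abs_le_iff)
    also have "K = K * exp (\<epsilon> * M) * exp (- (\<epsilon> * M))" by (simp add: flip: exp_add)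
    also have "\<dots> \<le> C * exp (- (\<epsilon> * \<bar>x\<bar>))"
      using True \<open>\<epsilon> > 0\<close> K(2) by (intro mult_mono) (auto simp: C_def)
    finally show ?thesis .
  next
    case False
    then have "norm (F x) \<le> B x" by (intro bound) (auto simp: M_def)
    also have "B x \<le> exp (- (\<epsilon> * \<bar>x\<bar>))"
    proof (cases "x \<ge> 0")
      case True
      then have "exp (\<epsilon> * x) * B x < 1" using False by (intro M1) (auto simp: M_def)
      then show ?thesis using True by (simp add: exp_minus field_simps)
    next
      case neg: False
      then have "exp (- \<epsilon> * x) * B x < 1" using False by (intro M2) (auto simp: M_def)
      then show ?thesis using neg by (simp add: exp_minus field_simps)
    qed
    also have "\<dots> \<le> C * exp (- (\<epsilon> * \<bar>x\<bar>))" by (simp add: C_def)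
    finally show ?thesis .
  qed
  have h: "integrable lborel (\<lambda>x. indicator {0<..} x * exp (- (x * \<epsilon>)))"
    using integrable_I0i_exp_mscale[OF \<open>\<epsilon> > 0\<close>] by (simp add: set_integrable_def)
  have h': "integrable lborel (\<lambda>x. indicator {0<..} (- x) * exp (- (- x * \<epsilon>)))"
    using lborel_integrable_real_affine[OF h, of "-1" 0] by simp
  have "integrable lborel (\<lambda>x. C * (indicator {0<..} x * exp (- (x * \<epsilon>)) + indicator {0<..} (- x) * exp (- (- x * \<epsilon>))))"
    by (intro integrable_mult_right Bochner_Integration.integrable_add h h')
  then show ?thesis
  proof (rule Bochner_Integration.integrable_bound)
    show "F \<in> borel_measurable lborel" using borel_measurable_continuous_onI[OF cont] by simp
    show "AE x in lborel. norm (F x) \<le> norm (C * (indicator {0<..} x * exp (- (x * \<epsilon>)) + indicator {0<..} (- x) * exp (- (- x * \<epsilon>))))"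
      using AE_lborel_singleton[of 0]
    proof eventually_elim
      case (elim x)
      then show ?case using le[of x] by (cases "x > 0") (auto simp: mult_ac C_def)
    qed
  qed
qed

text \<open>
  Exponential decay of a single majorant gives both the vanishing of the vertical sides and the
  integrability along every line of the strip. The majorant may fail for \<open>\<bar>x\<bar> < N\<close>, where
  continuity suffices; it may thus blow up at the abscissa of a removable singularity.
\<close>

lemma strip_shift_decay:
  fixes G :: "complex \<Rightarrow> complex" and a b \<epsilon> N :: real
  assumes ab: "a \<le> b" and S: "open S" "convex S" "G holomorphic_on S"
    and strip: "\<And>x \<eta>. a \<le> \<eta> \<Longrightarrow> \<eta> \<le> b \<Longrightarrow> Complex x \<eta> \<in> S"
    and bound: "\<And>x \<eta>. N \<le> \<bar>x\<bar> \<Longrightarrow> a \<le> \<eta> \<Longrightarrow> \<eta> \<le> b \<Longrightarrow> norm (G (Complex x \<eta>)) \<le> B x"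
    and e: "\<epsilon> > 0"
    and lim: "((\<lambda>x. exp (\<epsilon> * x) * B x) \<longlongrightarrow> 0) at_top" "((\<lambda>x. exp (- \<epsilon> * x) * B x) \<longlongrightarrow> 0) at_bot"
  shows "(LINT x|lborel. G (Complex x a)) = (LINT x|lborel. G (Complex x b))"
    and "\<And>\<eta>. a \<le> \<eta> \<Longrightarrow> \<eta> \<le> b \<Longrightarrow> integrable lborel (\<lambda>x. G (Complex x \<eta>))"
proof -
  have cont: "continuous_on UNIV (\<lambda>x. G (Complex x \<eta>))" if "a \<le> \<eta>" "\<eta> \<le> b" for \<eta>
    using strip[OF that] unfolding Complex_eq
    by (intro continuous_on_compose2[OF holomorphic_on_imp_continuous_on[OF S(3)]] continuous_intros) auto
  show int: "integrable lborel (\<lambda>x. G (Complex x \<eta>))" if "a \<le> \<eta>" "\<eta> \<le> b" for \<eta>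
    by (rule integrable_exp_decay[OF cont[OF that] bound[OF _ that] e lim])
  have 1: "((\<lambda>x. exp (- \<epsilon> * x) * (exp (\<epsilon> * x) * B x)) \<longlongrightarrow> 0 * 0) at_top"
    by (rule tendsto_mult[OF _ lim(1)]) (use e in real_asymp)
  have 2: "((\<lambda>x. exp (\<epsilon> * x) * (exp (- \<epsilon> * x) * B x)) \<longlongrightarrow> 0 * 0) at_bot"
    by (rule tendsto_mult[OF _ lim(2)]) (use e in real_asymp)
  have "(B \<longlongrightarrow> 0) at_top" "(B \<longlongrightarrow> 0) at_bot"
    using 1 2 by (simp_all add: mult.assoc[symmetric] flip: exp_add)
  then show "(LINT x|lborel. G (Complex x a)) = (LINT x|lborel. G (Complex x b))"
    using ab by (intro strip_shift[where S=S and B=B and N=N] S strip bound int) auto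
qed

section \<open>Gamma integrals\<close>

text \<open>
  Euler's integral in the logarithmic coordinate \<open>t = exp x\<close>.
\<close>

lemma gamma_log_integral:
  fixes p :: real
  assumes "p > 0"
  shows "has_bochner_integral lborel (\<lambda>x. exp (p * x - exp x)) (Gamma p)"
proof (rule has_bochner_integral_nn_integral)
  have "(\<integral>\<^sup>+x. ennreal (exp (p * x - exp x)) \<partial>lborel)
      = (\<integral>\<^sup>+x. ennreal (exp x) * ennreal (exp x powr (p - 1) / exp (exp x)) \<partial>lborel)"
    by (intro nn_integral_cong, subst ennreal_mult[symmetric])
       (auto simp: powr_def algebra_simps simp flip: exp_add exp_diff)
  also have "\<dots> = (\<integral>\<^sup>+t. indicator {0<..} t * ennreal (t powr (p - 1) / exp t) \<partial>lborel)"
    by (subst nn_integral_exp_subst) auto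
  also have "\<dots> = (\<integral>\<^sup>+t. ennreal (indicator {0..} t * t powr (p - 1) / exp t) \<partial>lborel)"
    by (intro nn_integral_cong) (auto simp: indicator_def)
  also have "\<dots> = ennreal (Gamma p)"
    using Gamma_conv_nn_integral_real[OF assms] by simp
  finally show "(\<integral>\<^sup>+x. ennreal (exp (p * x - exp x)) \<partial>lborel) = ennreal (Gamma p)" .
qed (use assms in \<open>auto intro: Gamma_real_pos less_imp_le\<close>)

lemma gamma_log_integrable:
  fixes p c :: real
  assumes "p > 0" "c > 0"
  shows "integrable lborel (\<lambda>x. exp (p * x - c * exp x))"
proof -
  have "integrable lborel (\<lambda>x. exp (p * (ln c + 1 * x) - exp (ln c + 1 * x)))"
    using gamma_log_integral[OF assms(1)]
    by (intro lborel_integrable_real_affine) (auto simp: has_bochner_integral_iff)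
  then have "integrable lborel (\<lambda>x. exp (- p * ln c) * exp (p * (ln c + 1 * x) - exp (ln c + 1 * x)))"
    by (rule integrable_mult_right)
  moreover have eq: "exp (- p * ln c) * exp (p * (ln c + 1 * x) - exp (ln c + 1 * x)) = exp (p * x - c * exp x)" for x
  proof -
    have "exp (ln c + 1 * x) = c * exp x" using assms by (simp add: exp_add)
    then show ?thesis by (simp add: algebra_simps flip: exp_add)
  qed
  ultimately show ?thesis by (simp only: eq)
qed

text \<open>
  Euler's integral along the ray of angle \<open>\<psi>\<close>, obtained by shifting the real line. The condition
  \<open>\<bar>\<psi>\<bar> < \<pi> / 2\<close> keeps the real part of \<open>exp w\<close> positive on the whole strip.
\<close>

lemma gamma_line_integral:
  fixes p \<psi> :: real
  assumes p: "p > 0" and \<psi>: "\<bar>\<psi>\<bar> < pi / 2"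
  shows "(LINT x|lborel. exp (of_real p * Complex x \<psi> - exp (Complex x \<psi>))) = of_real (Gamma p)"
    and "integrable lborel (\<lambda>x. exp (of_real p * Complex x \<psi> - exp (Complex x \<psi>)))"
proof -
  let ?G = "\<lambda>w::complex. exp (of_real p * w - exp w)"
  let ?B = "\<lambda>x. exp (p * x - cos \<psi> * exp x)"
  have c: "cos \<psi> > 0" using \<psi> by (intro cos_gt_zero_pi) auto
  have nG: "norm (?G (Complex x \<eta>)) = exp (p * x - cos \<eta> * exp x)" for x \<eta>
    by (simp add: Re_exp)
  have bound: "norm (?G (Complex x \<eta>)) \<le> ?B x" if "\<bar>\<eta>\<bar> \<le> \<bar>\<psi>\<bar>" for x \<eta>
  proof -
    have "cos \<bar>\<psi>\<bar> \<le> cos \<bar>\<eta>\<bar>" using that \<psi> by (intro cos_monotone_0_pi_le) auto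
    then show ?thesis unfolding nG by simp
  qed
  have meas: "(\<lambda>x. ?G (Complex x \<eta>)) \<in> borel_measurable borel" for \<eta>
    unfolding Complex_eq by (intro borel_measurable_continuous_onI continuous_intros)
  have int: "integrable lborel (\<lambda>x. ?G (Complex x \<eta>))" if "\<bar>\<eta>\<bar> \<le> \<bar>\<psi>\<bar>" for \<eta>
    by (rule Bochner_Integration.integrable_bound[OF gamma_log_integrable[OF p c]])
       (use bound[OF that] meas in auto)
  show "integrable lborel (\<lambda>x. ?G (Complex x \<psi>))" by (rule int) simp
  have lim: "(?B \<longlongrightarrow> 0) at_top" "(?B \<longlongrightarrow> 0) at_bot"
    by (use p c in real_asymp)+
  have eq: "(LINT x|lborel. ?G (Complex x (min 0 \<psi>))) = (LINT x|lborel. ?G (Complex x (max 0 \<psi>)))"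
  proof (rule strip_shift[where S=UNIV and B="?B" and N=0])
    show "?G holomorphic_on UNIV" by (intro holomorphic_intros)
    show "norm (?G (Complex x \<eta>)) \<le> ?B x" if "0 \<le> \<bar>x\<bar>" "min 0 \<psi> \<le> \<eta>" "\<eta> \<le> max 0 \<psi>" for x \<eta>
      by (rule bound) (use that in auto)
  qed (auto intro!: int lim)
  have "(LINT x|lborel. ?G (Complex x 0)) = (LINT x|lborel. of_real (exp (p * x - exp x)))"
    by (intro Bochner_Integration.integral_cong)
       (simp_all add: Complex_eq flip: exp_of_real)
  also have "\<dots> = of_real (Gamma p)"
    using gamma_log_integral[OF p] by (simp add: has_bochner_integral_iff)
  finally show "(LINT x|lborel. ?G (Complex x \<psi>)) = of_real (Gamma p)"
    using eq by (cases "\<psi> \<ge> 0") (auto simp: min_def max_def)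
qed

text \<open>
  The substitution \<open>exp w = y powr \<alpha> * z\<close> moves the integral to the horizontal line at height
  \<open>Arg z\<close>.
\<close>

lemma gamma_power_integral:
  fixes \<alpha> d :: real and z :: complex
  assumes \<alpha>: "\<alpha> > 0" and d: "d > 0" and z: "Re z > 0"
  shows "set_integrable lborel {0<..} (\<lambda>y. of_real (y powr (d - 1)) * exp (- of_real (y powr \<alpha>) * z))"
    and "(LINT y:{0<..}|lborel. of_real (y powr (d - 1)) * exp (- of_real (y powr \<alpha>) * z))
      = of_real (Gamma (d / \<alpha>) / \<alpha>) * exp (- of_real (d / \<alpha>) * Ln z)"
proof -
  let ?p = "d / \<alpha>" and ?\<psi> = "Im (Ln z)"
  have p: "?p > 0" using \<alpha> d by simp
  have z0: "z \<noteq> 0" using z by auto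
  have \<psi>: "\<bar>?\<psi>\<bar> < pi / 2" using Re_Ln_pos_lt[OF z0] z by simp
  have eq: "exp x *\<^sub>R (of_real (exp x powr (d - 1)) * exp (- of_real (exp x powr \<alpha>) * z))
      = exp (- of_real ?p * Ln z) * exp (of_real ?p * Complex (Re (Ln z) + \<alpha> * x) ?\<psi> - exp (Complex (Re (Ln z) + \<alpha> * x) ?\<psi>))" for x
  proof -
    have C: "Complex (Re (Ln z) + \<alpha> * x) ?\<psi> = Ln z + of_real (\<alpha> * x)"
      by (simp add: complex_eq_iff)
    have "exp (Ln z + of_real (\<alpha> * x)) = z * of_real (exp x powr \<alpha>)"
      using z0 by (simp add: exp_add powr_def flip: exp_of_real)
    moreover have "exp x *\<^sub>R (of_real (exp x powr (d - 1))) = exp (of_real (d * x) :: complex)"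
      by (simp add: powr_def scaleR_conv_of_real exp_of_real algebra_simps flip: of_real_mult exp_add)
    ultimately have "exp x *\<^sub>R (of_real (exp x powr (d - 1)) * exp (- of_real (exp x powr \<alpha>) * z))
        = exp (of_real (d * x)) * exp (- exp (Ln z + of_real (\<alpha> * x)))"
      by (simp add: scaleR_conv_of_real mult_ac)
    then show ?thesis
      using \<alpha> unfolding C by (simp add: algebra_simps flip: exp_add)
  qed
  have meas: "(\<lambda>y. of_real (y powr (d - 1)) * exp (- of_real (y powr \<alpha>) * z)) \<in> borel_measurable borel"
    by measurable
  note line = gamma_line_integral[OF p \<psi>]
  show "set_integrable lborel {0<..} (\<lambda>y. of_real (y powr (d - 1)) * exp (- of_real (y powr \<alpha>) * z))"
    unfolding set_integral_exp_subst(1)[OF meas] eq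
    by (rule integrable_mult_right, rule lborel_integrable_real_affine[OF line(2)]) (use \<alpha> in simp)
  show "(LINT y:{0<..}|lborel. of_real (y powr (d - 1)) * exp (- of_real (y powr \<alpha>) * z))
      = of_real (Gamma (d / \<alpha>) / \<alpha>) * exp (- of_real (d / \<alpha>) * Ln z)"
    unfolding set_integral_exp_subst(2)[OF meas] eq
    using lborel_integral_real_affine[of \<alpha> "\<lambda>x. exp (of_real ?p * Complex x ?\<psi> - exp (Complex x ?\<psi>))" "Re (Ln z)"] \<alpha>
    unfolding line(1) by (simp add: scaleR_conv_of_real field_simps)
qed

text \<open>
  The imaginary part of \<open>gamma_power_integral\<close> at \<open>z = A - \<i> * B\<close>, whose argument is
  \<open>- arctan (B / A)\<close>.
\<close>

lemma powr_gamma_sin_integral: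
  fixes \<alpha> d A B :: real
  assumes \<alpha>: "\<alpha> > 0" and d: "d > 0" and A: "A > 0"
  shows "set_integrable lborel {0<..} (\<lambda>y. y powr (d - 1) * (exp (- (y powr \<alpha> * A)) * sin (y powr \<alpha> * B)))"
    and "(LINT y:{0<..}|lborel. y powr (d - 1) * (exp (- (y powr \<alpha> * A)) * sin (y powr \<alpha> * B)))
      = Gamma (d / \<alpha>) / \<alpha> * (A\<^sup>2 + B\<^sup>2) powr (- d / (2 * \<alpha>)) * sin (d / \<alpha> * arctan (B / A))"
proof -
  let ?T = "\<lambda>y. y powr (d - 1) * (exp (- (y powr \<alpha> * A)) * sin (y powr \<alpha> * B))"
  let ?z = "Complex A (- B)"
  let ?F = "\<lambda>y. of_real (y powr (d - 1)) * exp (- of_real (y powr \<alpha>) * ?z)"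
  have z: "Re ?z > 0" using A by simp
  have z0: "?z \<noteq> 0" using A by (auto simp: complex_eq_iff)
  note g = gamma_power_integral[OF \<alpha> d z]
  have Im: "Im (indicat_real {0<..} y *\<^sub>R ?F y) = indicat_real {0<..} y *\<^sub>R (?T y)" for y
    by (simp add: Re_exp Im_exp)
  show "set_integrable lborel {0<..} (\<lambda>y. ?T y)"
    using integrable_Im[OF g(1)[unfolded set_integrable_def]] unfolding Im set_integrable_def .
  have L: "Ln ?z = Complex (ln (norm ?z)) (- arctan (B / A))"
  proof -
    have "Im (Ln ?z) = arctan (Im ?z / Re ?z)" 
      using A z0 arg_conv_arctan[of ?z] by (simp add: Arg_eq_Im_Ln)
    then show ?thesis using z0 by (simp add: complex_eq_iff arctan_minus)
  qed
  have n: "norm ?z powr p = (A\<^sup>2 + B\<^sup>2) powr (p / 2)" for p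
    by (simp add: cmod_def powr_powr flip: powr_half_sqrt)
  have "(LINT y:{0<..}|lborel. ?T y)
      = Im (LINT y:{0<..}|lborel. ?F y)"
    unfolding set_lebesgue_integral_def Im[symmetric]
    by (rule integral_Im[OF g(1)[unfolded set_integrable_def]])
  also have "\<dots> = Gamma (d / \<alpha>) / \<alpha> * (norm ?z powr (- d / \<alpha>) * sin (d / \<alpha> * arctan (B / A)))"
    unfolding g(2) L using z0
    by (simp add: Im_exp complex_of_real_mult_Complex powr_def del: norm_complex_def)
  also have "norm ?z powr (- d / \<alpha>) = (A\<^sup>2 + B\<^sup>2) powr (- d / (2 * \<alpha>))"
    unfolding n by (simp add: mult.commute)
  finally show "(LINT y:{0<..}|lborel. ?T y)
      = Gamma (d / \<alpha>) / \<alpha> * (A\<^sup>2 + B\<^sup>2) powr (- d / (2 * \<alpha>)) * sin (d / \<alpha> * arctan (B / A))"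
    by simp
qed

lemma powr_gamma_nn_integral:
  fixes \<alpha> d A :: real
  assumes \<alpha>: "\<alpha> > 0" and d: "d > 0" and A: "A > 0"
  shows "set_integrable lborel {0<..} (\<lambda>y. y powr (d - 1) * exp (- (y powr \<alpha> * A)))"
    and "(\<integral>\<^sup>+y. indicator {0<..} y * ennreal (y powr (d - 1) * exp (- (y powr \<alpha> * A))) \<partial>lborel)
      = ennreal (Gamma (d / \<alpha>) / \<alpha> * A powr (- d / \<alpha>))"
proof -
  let ?T = "\<lambda>y. y powr (d - 1) * exp (- (y powr \<alpha> * A))"
  let ?F = "\<lambda>y. of_real (y powr (d - 1)) * exp (- of_real (y powr \<alpha>) * complex_of_real A)"
  have z: "Re (complex_of_real A) > 0" using A by simp
  note g = gamma_power_integral[OF \<alpha> d z]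
  have Re: "Re (indicat_real {0<..} y *\<^sub>R ?F y) = indicat_real {0<..} y *\<^sub>R (?T y)" for y
    by (simp add: Re_exp)
  show i: "set_integrable lborel {0<..} (\<lambda>y. ?T y)"
    using integrable_Re[OF g(1)[unfolded set_integrable_def]] unfolding Re set_integrable_def .
  have "(\<integral>\<^sup>+y. indicator {0<..} y * ennreal (?T y) \<partial>lborel)
      = (\<integral>\<^sup>+y. ennreal (indicat_real {0<..} y *\<^sub>R (?T y)) \<partial>lborel)"
    by (intro nn_integral_cong) (auto simp: indicator_def)
  also have "\<dots> = ennreal (LINT y|lborel. Re (indicat_real {0<..} y *\<^sub>R ?F y))"
    unfolding Re using i unfolding set_integrable_def by (rule nn_integral_eq_integral) auto
  also have "(LINT y|lborel. Re (indicat_real {0<..} y *\<^sub>R ?F y)) = Re (LINT y:{0<..}|lborel. ?F y)"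
    unfolding set_lebesgue_integral_def by (rule integral_Re[OF g(1)[unfolded set_integrable_def]])
  also have "\<dots> = Gamma (d / \<alpha>) / \<alpha> * A powr (- d / \<alpha>)"
    unfolding g(2) using A by (simp add: Ln_of_real Re_exp powr_def)
  finally show "(\<integral>\<^sup>+y. indicator {0<..} y * ennreal (?T y) \<partial>lborel)
      = ennreal (Gamma (d / \<alpha>) / \<alpha> * A powr (- d / \<alpha>))" .
qed

text \<open>
  The simple pole of \<open>Gamma\<close> at 0 meets the simple zero of the sine.
\<close>

lemma Gamma_sin_tendsto:
  fixes \<phi> :: real
  shows "((\<lambda>p. Gamma p * sin (p * \<phi>)) \<longlongrightarrow> \<phi>) (at_right 0)"
proof -
  have "((\<lambda>p. Gamma (p + 1)) \<longlongrightarrow> Gamma (0 + 1)) (at_right (0::real))"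
    by (intro tendsto_intros) (auto simp: nonpos_Ints_def)
  moreover have "((\<lambda>p. sin (p * \<phi>) / p) \<longlongrightarrow> \<phi>) (at_right 0)"
    by real_asymp
  ultimately have "((\<lambda>p. Gamma (p + 1) * (sin (p * \<phi>) / p)) \<longlongrightarrow> Gamma (0 + 1) * \<phi>) (at_right 0)"
    by (rule tendsto_mult)
  moreover have "\<forall>\<^sub>F p in at_right (0::real). Gamma (p + 1) * (sin (p * \<phi>) / p) = Gamma p * sin (p * \<phi>)"
    using eventually_at_right_less[of 0]
  proof eventually_elim
    case (elim p)
    then have "Gamma (p + 1) = p * Gamma p" by (intro Gamma_plus1) (auto elim: nonpos_Ints_cases)
    then show ?case using elim by simp
  qed
  ultimately have "((\<lambda>p. Gamma p * sin (p * \<phi>)) \<longlongrightarrow> Gamma (0 + 1) * \<phi>) (at_right 0)"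
    by (rule Lim_transform_eventually)
  then show ?thesis by simp
qed

text \<open>
  The limit \<open>d \<rightarrow> 0\<close> of \<open>powr_gamma_sin_integral\<close>. The sine supplies a factor
  \<open>y powr \<alpha>\<close>, which makes the integrands dominated near 0 uniformly in \<open>d\<close>.
\<close>

lemma powr_inverse_sin_integral:
  fixes \<alpha> A B :: real
  assumes \<alpha>: "\<alpha> > 0" and A: "A > 0"
  shows "set_integrable lborel {0<..} (\<lambda>y. y powr (-1) * (exp (- (y powr \<alpha> * A)) * sin (y powr \<alpha> * B)))"
    and "(LINT y:{0<..}|lborel. y powr (-1) * (exp (- (y powr \<alpha> * A)) * sin (y powr \<alpha> * B)))
      = arctan (B / A) / \<alpha>"
proof -
  define d where "d n = 1 / real (Suc n)" for n
  have d: "0 < d n" "d n \<le> 1" for n by (auto simp: d_def)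
  have d0: "d \<longlonglongrightarrow> 0" unfolding d_def by (rule LIMSEQ_Suc[OF lim_inverse_n'])
  let ?h = "\<lambda>y. exp (- (y powr \<alpha> * A)) * sin (y powr \<alpha> * B)"
  let ?F = "\<lambda>p y. indicat_real {0<..} y *\<^sub>R (y powr p * ?h y)"
  let ?w = "\<lambda>y. \<bar>B\<bar> * (indicat_real {0<..} y *\<^sub>R (y powr (\<alpha> - 1) * exp (- (y powr \<alpha> * A)))
      + indicat_real {0<..} y *\<^sub>R (y powr ((\<alpha> + 1) - 1) * exp (- (y powr \<alpha> * A))))"
  have w: "integrable lborel ?w"
    using powr_gamma_nn_integral(1)[OF \<alpha> \<alpha> A] powr_gamma_nn_integral(1)[OF \<alpha> _ A, of "\<alpha> + 1"] \<alpha>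
    unfolding set_integrable_def by (intro integrable_mult_right Bochner_Integration.integrable_add) auto
  have bound: "norm (?F p y) \<le> ?w y" if p: "-1 \<le> p" "p \<le> 0" for p y
  proof (cases "y > 0")
    case True
    have "y powr p \<le> y powr (-1) + 1"
    proof (cases "y \<le> 1")
      case 1: True
      then have "y powr p \<le> y powr (-1)" using p True by (intro powr_mono') auto
      then show ?thesis by simp
    next
      case False
      then have "y powr p \<le> y powr 0" using p by (intro powr_mono) auto
      then show ?thesis using True by (simp add: add_increasing)
    qed
    moreover have "\<bar>sin (y powr \<alpha> * B)\<bar> \<le> y powr \<alpha> * \<bar>B\<bar>"
      using abs_sin_x_le_abs_x[of "y powr \<alpha> * B"] by (simp add: abs_mult)
    ultimately have "y powr p * \<bar>sin (y powr \<alpha> * B)\<bar> \<le> (y powr (-1) + 1) * (y powr \<alpha> * \<bar>B\<bar>)"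
      by (intro mult_mono) auto
    then have "y powr p * \<bar>sin (y powr \<alpha> * B)\<bar> * exp (- (y powr \<alpha> * A)) \<le> (y powr (-1) + 1) * (y powr \<alpha> * \<bar>B\<bar>) * exp (- (y powr \<alpha> * A))"
      by (rule mult_right_mono) simp
    also have "\<dots> = \<bar>B\<bar> * ((y powr (-1) * y powr \<alpha>) * exp (- (y powr \<alpha> * A)) + y powr \<alpha> * exp (- (y powr \<alpha> * A)))"
      by (simp add: algebra_simps)
    also have "y powr (-1) * y powr \<alpha> = y powr (-1 + \<alpha>)" by (rule powr_add[symmetric])
    also have "-1 + \<alpha> = \<alpha> - 1" by simp
    finally show ?thesis using True by (simp add: abs_mult mult_ac)
  qed simp
  show "set_integrable lborel {0<..} (\<lambda>y. y powr (-1) * ?h y)"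
    unfolding set_integrable_def
    by (rule Bochner_Integration.integrable_bound[OF w]) (use order_trans[OF bound[of "-1"] abs_ge_self] in auto)
  have "(\<lambda>n. LINT y|lborel. ?F (d n - 1) y) \<longlonglongrightarrow> (LINT y|lborel. ?F (-1) y)"
  proof (rule integral_dominated_convergence[OF _ _ w])
    show "AE y in lborel. (\<lambda>n. ?F (d n - 1) y) \<longlonglongrightarrow> ?F (-1) y"
    proof (rule AE_I2)
      fix y :: real
      have "(\<lambda>n. y powr (d n - 1)) \<longlonglongrightarrow> y powr (0 - 1)" if "y > 0"
        using that by (intro tendsto_intros d0) auto
      then show "(\<lambda>n. ?F (d n - 1) y) \<longlonglongrightarrow> ?F (-1) y"
        using tendsto_mult_right[of "\<lambda>n. y powr (d n - 1)" "y powr (0 - 1)" sequentially "?h y"]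
        by (cases "y > 0") simp_all
    qed
    show "AE y in lborel. norm (?F (d n - 1) y) \<le> ?w y" for n
      using d[of n] by (intro AE_I2 bound) auto
  qed measurable
  moreover have "(\<lambda>n. LINT y|lborel. ?F (d n - 1) y) \<longlonglongrightarrow> arctan (B / A) / \<alpha>"
  proof -
    have f: "filterlim (\<lambda>n. d n / \<alpha>) (at_right 0) sequentially"
      unfolding filterlim_at using d \<alpha> tendsto_divide[OF d0 tendsto_const[of \<alpha>]] by (auto intro!: always_eventually simp: less_imp_neq[OF d(1), symmetric])
    have "(\<lambda>n. (Gamma (d n / \<alpha>) * sin (d n / \<alpha> * arctan (B / A))) / \<alpha> * (A\<^sup>2 + B\<^sup>2) powr (- d n / (2 * \<alpha>)))
        \<longlonglongrightarrow> arctan (B / A) / \<alpha> * (A\<^sup>2 + B\<^sup>2) powr (- 0 / (2 * \<alpha>))"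
      using A \<alpha> by (intro tendsto_intros filterlim_compose[OF Gamma_sin_tendsto f] d0) (auto simp: sum_power2_eq_zero_iff)
    moreover have "(LINT y|lborel. ?F (d n - 1) y) = (Gamma (d n / \<alpha>) * sin (d n / \<alpha> * arctan (B / A))) / \<alpha> * (A\<^sup>2 + B\<^sup>2) powr (- d n / (2 * \<alpha>))" for n
      using powr_gamma_sin_integral(2)[OF \<alpha> d(1)[of n] A, of B] unfolding set_lebesgue_integral_def by (simp add: mult_ac)
    ultimately show ?thesis using A by (simp add: sum_power2_eq_zero_iff)
  qed
  ultimately show "(LINT y:{0<..}|lborel. y powr (-1) * ?h y) = arctan (B / A) / \<alpha>"
    unfolding set_lebesgue_integral_def by (rule LIMSEQ_unique)
qed

text \<open>
  The substitution \<open>x = 1 / (1 + m)\<close> turns the left-hand side into a Gamma integral in \<open>m\<close>. Read from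
  right to left, the identity resolves \<open>a powr (- \<nu>) * exp (- a)\<close> into the exponentials
  \<open>exp (- a / x)\<close> with \<open>0 < x < 1\<close>.
\<close>

lemma laplace_powr_beta_integral:
  fixes a \<nu> :: real
  assumes a: "a > 0" and \<nu>: "\<nu> > 0"
  shows "(\<integral>\<^sup>+x. indicator {0<..<1} x * ennreal ((1 - x) powr (\<nu> - 1) * x powr (- \<nu> - 1) * exp (- (a / x))) \<partial>lborel)
     = ennreal (Gamma \<nu> * a powr (- \<nu>) * exp (- a))"
proof -
  let ?g = "\<lambda>m::real. 1 / (1 + m)" and ?g' = "\<lambda>m::real. - 1 / (1 + m)\<^sup>2"
  let ?F = "\<lambda>x. (1 - x) powr (\<nu> - 1) * x powr (- \<nu> - 1) * exp (- (a / x))"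
  let ?H = "\<lambda>m. m powr (\<nu> - 1) * exp (- (m powr 1 * a)) * exp (- a)"
  have im: "?g ` {0<..} = {0<..<1}"
  proof (intro equalityI subsetI)
    fix x :: real assume "x \<in> {0<..<1}"
    then show "x \<in> ?g ` {0<..}" by (intro image_eqI[of _ _ "1 / x - 1"]) (auto simp: field_simps)
  qed (auto simp: field_simps)
  have eq: "\<bar>?g' m\<bar> * ?F (?g m) = ?H m" if "m > 0" for m
  proof -
    have "1 - ?g m = m / (1 + m)" using that by (simp add: field_simps)
    then have 1: "(1 - ?g m) powr (\<nu> - 1) = m powr (\<nu> - 1) * (1 + m) powr (1 - \<nu>)"
      using that by (simp add: powr_divide powr_diff)
    have 2: "?g m powr (- \<nu> - 1) = (1 + m) powr (\<nu> + 1)"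
      using that by (simp add: powr_divide powr_diff powr_minus powr_add field_simps)
    have 3: "\<bar>?g' m\<bar> = (1 + m) powr (- 2)" using that by (simp add: powr_minus powr_numeral divide_inverse)
    have 4: "exp (- (a / ?g m)) = exp (- (m powr 1 * a)) * exp (- a)"
      using that by (simp add: algebra_simps flip: exp_add)
    have one: "(1 + m) powr (- 2) * ((1 + m) powr (1 - \<nu>) * (1 + m) powr (\<nu> + 1)) = 1"

    proof -
      have "(1 + m) powr (- 2) * ((1 + m) powr (1 - \<nu>) * (1 + m) powr (\<nu> + 1)) = (1 + m) powr (- 2 + ((1 - \<nu>) + (\<nu> + 1)))"
        by (simp only: powr_add)
      then show ?thesis using that by simp
    qed
    have "\<bar>?g' m\<bar> * ?F (?g m) = ((1 + m) powr (- 2) * ((1 + m) powr (1 - \<nu>) * (1 + m) powr (\<nu> + 1))) * ?H m"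
      unfolding 1 2 3 4 by (simp only: mult_ac)
    then show ?thesis unfolding one by simp
  qed
  have nnH: "(\<integral>\<^sup>+m. indicator {0<..} m * ennreal (?H m) \<partial>lborel) = ennreal (Gamma \<nu> * a powr (- \<nu>) * exp (- a))"
  proof -
    have "(\<integral>\<^sup>+m. indicator {0<..} m * ennreal (?H m) \<partial>lborel)
        = (\<integral>\<^sup>+m. (indicator {0<..} m * ennreal (m powr (\<nu> - 1) * exp (- (m powr 1 * a)))) * ennreal (exp (- a)) \<partial>lborel)"
      by (intro nn_integral_cong) (simp add: ennreal_mult mult_ac)
    also have "\<dots> = ennreal (Gamma (\<nu> / 1) / 1 * a powr (- \<nu> / 1)) * ennreal (exp (- a))"
      by (subst nn_integral_multc, measurable, subst powr_gamma_nn_integral(2)) (use a \<nu> in auto)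
    finally show ?thesis using \<nu> by (simp add: ennreal_mult' Gamma_real_pos less_imp_le)
  qed
  have "set_integrable lborel {0<..} ?H"
    using powr_gamma_nn_integral(1)[of 1 \<nu> a] a \<nu> by (intro set_integrable_mult_left) auto
  then have iH: "?H integrable_on {0<..}" by (rule set_borel_integral_eq_integral(1))
  then have aH: "?H absolutely_integrable_on {0<..}"
    by (subst absolutely_integrable_on_iff_nonneg) auto
  have "(\<lambda>m. \<bar>?g' m\<bar> * ?F (?g m)) absolutely_integrable_on {0<..} \<longleftrightarrow> ?H absolutely_integrable_on {0<..}"
    by (intro set_integrable_cong refl) (use eq in auto)
  moreover have "integral {0<..} (\<lambda>m. \<bar>?g' m\<bar> * ?F (?g m)) = integral {0<..} ?H"
    by (intro Henstock_Kurzweil_Integration.integral_cong) (use eq in auto)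
  moreover have "(\<lambda>m. \<bar>?g' m\<bar> * ?F (?g m)) absolutely_integrable_on {0<..} \<and> integral {0<..} (\<lambda>m. \<bar>?g' m\<bar> * ?F (?g m)) = integral {0<..} ?H
      \<longleftrightarrow> ?F absolutely_integrable_on (?g ` {0<..}) \<and> integral (?g ` {0<..}) ?F = integral {0<..} ?H"
  proof (rule has_absolute_integral_change_of_variables_1')
    show "(?g has_field_derivative ?g' m) (at m within {0<..})" if "m \<in> {0<..}" for m
      using that by (auto intro!: derivative_eq_intros simp: power2_eq_square)
    show "inj_on ?g {0<..}" by (auto simp: inj_on_def)
  qed auto
  ultimately have F: "?F absolutely_integrable_on (?g ` {0<..}) \<and> integral (?g ` {0<..}) ?F = integral {0<..} ?H"
    using aH by blast
  from F have "?F integrable_on {0<..<1}" and FH: "integral {0<..<1} ?F = integral {0<..} ?H"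
    unfolding im using set_lebesgue_integral_eq_integral(1)[of "{0<..<1}" ?F] by blast+
  from integrable_integral[OF this(1)] have "(?F has_integral integral {0<..} ?H) {0<..<1}"
    unfolding FH .
  then have "(\<integral>\<^sup>+x. ennreal (?F x) * indicator {0<..<1} x \<partial>lborel) = ennreal (integral {0<..} ?H)"
    by (intro nn_integral_has_integral_lebesgue') auto
  moreover have "(\<integral>\<^sup>+m. ennreal (?H m) * indicator {0<..} m \<partial>lborel) = ennreal (integral {0<..} ?H)"
    by (rule nn_integral_has_integral_lebesgue'[OF _ integrable_integral[OF iH]]) auto
  ultimately show ?thesis using nnH by (simp add: mult.commute)
qed

lemma powr_beta_finite:
  assumes "\<nu> > (0::real)"
  shows "(\<integral>\<^sup>+x. indicator {0<..<1} x * ennreal ((1 - x) powr (\<nu> - 1)) \<partial>lborel) < \<infinity>"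
proof -
  have "integrable lborel (\<lambda>t. indicator {0..1} t *\<^sub>R (t powr (1 - 1) * (1 - t) powr (\<nu> - 1)))"
    using integrable_Beta[OF zero_less_one assms] by (simp add: set_integrable_def)
  then have "(\<integral>\<^sup>+x. ennreal (norm (indicat_real {0..1} x *\<^sub>R (x powr (1 - 1) * (1 - x) powr (\<nu> - 1)))) \<partial>lborel) < \<infinity>"
    unfolding integrable_iff_bounded by blast
  moreover have "(\<integral>\<^sup>+x. indicator {0<..<1} x * ennreal ((1 - x) powr (\<nu> - 1)) \<partial>lborel) \<le> (\<integral>\<^sup>+x. ennreal (norm (indicat_real {0..1} x *\<^sub>R (x powr (1 - 1) * (1 - x) powr (\<nu> - 1)))) \<partial>lborel)"
    by (intro nn_integral_mono) (auto simp: indicator_def)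
  ultimately show ?thesis by (rule le_less_trans[rotated])
qed

section \<open>Uniqueness of the Laplace transform\<close>

text \<open>
  In the variable \<open>exp (- t)\<close> the hypothesis says that \<open>E\<close> annihilates all polynomials on \<open>[0, 1]\<close>.
  By Weierstrass it annihilates continuous functions, by dominated convergence the indicators of half lines,
  and half lines determine the measures with densities \<open>max 0 E\<close> and \<open>max 0 (- E)\<close>.
\<close>

lemma laplace_moments_zero_imp_zero:
  fixes E :: "real \<Rightarrow> real"
  assumes E: "integrable lborel E" and supp: "\<And>t. t \<le> 0 \<Longrightarrow> E t = 0"
    and mom: "\<And>n::nat. (LINT t|lborel. exp (- t) ^ n * E t) = 0"
  shows "AE t in lborel. E t = 0"
proof -
  have [measurable]: "E \<in> borel_measurable borel" using E by auto
  have intb: "integrable lborel (\<lambda>t. g t * E t)"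
    if [measurable]: "g \<in> borel_measurable borel" and b: "\<And>t. t > 0 \<Longrightarrow> \<bar>g t\<bar> \<le> B" for g :: "real \<Rightarrow> real" and B
  proof (rule Bochner_Integration.integrable_bound[of lborel "\<lambda>t. B * E t"])
    show "AE t in lborel. norm (g t * E t) \<le> norm (B * E t)"
    proof (rule AE_I2)
      fix t show "norm (g t * E t) \<le> norm (B * E t)"
      proof (cases "t > 0")
        case True
        then have "\<bar>g t\<bar> \<le> \<bar>B\<bar>" using b[of t] by linarith
        then show ?thesis by (simp add: abs_mult mult_right_mono)
      qed (simp add: supp)
    qed
  qed (use E in auto)
  have e01: "exp (- t) \<in> {0..1}" if "t > 0" for t :: real using that by simp
  have cont0: "(LINT t|lborel. \<phi> (exp (- t)) * E t) = 0" if \<phi>: "continuous_on UNIV \<phi>" for \<phi> :: "real \<Rightarrow> real"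
  proof -
    have m\<phi>[measurable]: "\<phi> \<in> borel_measurable borel" by (rule borel_measurable_continuous_onI[OF \<phi>])
    have "\<bar>LINT t|lborel. \<phi> (exp (- t)) * E t\<bar> \<le> 0 + \<epsilon>" if eps: "\<epsilon> > 0" for \<epsilon>
    proof -
      define K where "K = (LINT t|lborel. \<bar>E t\<bar>) + 1"
      have K: "K > 0" unfolding K_def by (smt (verit) Bochner_Integration.integral_nonneg)
      obtain g where g: "real_polynomial_function g" "\<And>x. x \<in> {0..1} \<Longrightarrow> \<bar>\<phi> x - g x\<bar> < \<epsilon> / K"
        using Stone_Weierstrass_real_polynomial_function[of "{0..1::real}" \<phi> "\<epsilon> / K"]
          continuous_on_subset[OF \<phi> subset_UNIV] divide_pos_pos[OF eps K] compact_Icc by metis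
      obtain a n where gs: "g = (\<lambda>x. \<Sum>i\<le>n. a i * x ^ i)"
        using g(1) real_polynomial_function_iff_sum by auto
      have [measurable]: "g \<in> borel_measurable borel" unfolding gs by measurable
      have ipow: "integrable lborel (\<lambda>t. exp (- t) ^ i * E t)" for i :: nat
        by (rule intb[where B=1]) (auto simp: power_le_one)
      have g0: "(LINT t|lborel. g (exp (- t)) * E t) = 0"
      proof -
        have "(LINT t|lborel. g (exp (- t)) * E t) = (LINT t|lborel. (\<Sum>i\<le>n. a i * (exp (- t) ^ i * E t)))"
          unfolding gs sum_distrib_right mult.assoc ..
        also have "\<dots> = (\<Sum>i\<le>n. a i * (LINT t|lborel. exp (- t) ^ i * E t))"
          by (subst Bochner_Integration.integral_sum) (auto intro!: integrable_mult_right ipow)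
        finally show ?thesis by (simp add: mom)
      qed
      have id: "integrable lborel (\<lambda>t. (\<phi> (exp (- t)) - g (exp (- t))) * E t)"
        by (rule intb[where B="\<epsilon> / K"]) (use g(2)[OF e01] less_imp_le in auto)
      have ig: "integrable lborel (\<lambda>t. g (exp (- t)) * E t)"
        unfolding gs sum_distrib_right mult.assoc
        by (intro Bochner_Integration.integrable_sum integrable_mult_right ipow)
      have "(LINT t|lborel. \<phi> (exp (- t)) * E t)
          = (LINT t|lborel. (\<phi> (exp (- t)) - g (exp (- t))) * E t + g (exp (- t)) * E t)"
        by (simp add: algebra_simps)
      also have "\<dots> = (LINT t|lborel. (\<phi> (exp (- t)) - g (exp (- t))) * E t)"
        using id ig g0 by simp
      also have "\<bar>\<dots>\<bar> \<le> (LINT t|lborel. \<bar>(\<phi> (exp (- t)) - g (exp (- t))) * E t\<bar>)"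
        by (rule integral_abs_bound)
      also have "\<dots> \<le> (LINT t|lborel. \<epsilon> / K * \<bar>E t\<bar>)"
      proof (rule integral_mono)
        fix t show "\<bar>(\<phi> (exp (- t)) - g (exp (- t))) * E t\<bar> \<le> \<epsilon> / K * \<bar>E t\<bar>"
        proof (cases "t > 0")
          case True
          then show ?thesis unfolding abs_mult
            using g(2)[OF e01[OF True]] by (intro mult_right_mono) auto
        qed (simp add: supp)
      qed (use id E in auto)
      also have "\<dots> = \<epsilon> / K * (K - 1)" by (simp add: K_def)
      also have "\<dots> \<le> \<epsilon>" using K eps by (simp add: field_simps)
      finally show ?thesis by simp
    qed
    then have "\<bar>LINT t|lborel. \<phi> (exp (- t)) * E t\<bar> \<le> 0" by (rule field_le_epsilon)
    then show ?thesis by simp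
  qed
  have half: "(LINT t|lborel. indicator {a<..} t * E t) = 0" for a
  proof -
    \<comment> \<open>Continuous ramps that converge to the indicator of \<open>x < exp (- a)\<close>, that is of \<open>a < t\<close> at \<open>x = exp (- t)\<close>.\<close>
    define \<phi> where "\<phi> m x = min 1 (max 0 (real m * (exp (- a) - x)))" for m x
    have "(\<lambda>m. LINT t|lborel. \<phi> m (exp (- t)) * E t) \<longlonglongrightarrow> (LINT t|lborel. indicator {a<..} t * E t)"
    proof (rule integral_dominated_convergence[where w="\<lambda>t. \<bar>E t\<bar>"])
      show "AE t in lborel. (\<lambda>m. \<phi> m (exp (- t)) * E t) \<longlonglongrightarrow> indicator {a<..} t * E t"
      proof (rule AE_I2, intro tendsto_mult tendsto_const)
        fix t show "(\<lambda>m. \<phi> m (exp (- t))) \<longlonglongrightarrow> indicator {a<..} t"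
        proof (cases "a < t")
          case True
          then have p: "exp (- a) - exp (- t) > 0" by simp
          obtain m0 :: nat where m0: "1 / (exp (- a) - exp (- t)) \<le> real m0" using real_arch_simple by blast
          have "\<phi> m (exp (- t)) = 1" if "m \<ge> m0" for m
          proof -
            have "1 / (exp (- a) - exp (- t)) \<le> real m" using m0 that by simp
            then have "1 \<le> real m * (exp (- a) - exp (- t))" using p by (simp add: field_simps)
            then show ?thesis by (simp add: \<phi>_def)
          qed
          then have "\<forall>\<^sub>F m in sequentially. \<phi> m (exp (- t)) = 1"
            by (auto simp: eventually_sequentially)
          then show ?thesis using True by (simp add: tendsto_eventually)
        next
          case False
          then have "real m * (exp (- a) - exp (- t)) \<le> 0" for m by (simp add: mult_nonneg_nonpos)
          then show ?thesis using False by (simp add: \<phi>_def max_absorb1)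
        qed
      qed
      have [measurable]: "\<phi> m \<in> borel_measurable borel" for m unfolding \<phi>_def by measurable
      show "(\<lambda>t. \<phi> m (exp (- t)) * E t) \<in> borel_measurable lborel" for m by measurable
      show "AE t in lborel. norm (\<phi> m (exp (- t)) * E t) \<le> \<bar>E t\<bar>" for m
        by (auto simp: \<phi>_def abs_mult intro!: mult_left_le_one_le)
    qed (use E in auto)
    moreover have "(LINT t|lborel. \<phi> m (exp (- t)) * E t) = 0" for m
      by (rule cont0) (auto simp: \<phi>_def intro!: continuous_intros)
    ultimately show ?thesis by (simp add: LIMSEQ_const_iff)
  qed
  define P where "P = (\<lambda>t. ennreal (max 0 (E t)))"
  define N where "N = (\<lambda>t. ennreal (max 0 (- E t)))"
  have [measurable]: "P \<in> borel_measurable borel" "N \<in> borel_measurable borel"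
    unfolding P_def N_def by measurable
  have iP: "integrable lborel (\<lambda>t. max 0 (E t))" "integrable lborel (\<lambda>t. max 0 (- E t))"
    using E by auto
  have iI: "integrable lborel (\<lambda>t. indicator {a<..} t * max 0 (E t))"
    "integrable lborel (\<lambda>t. indicator {a<..} t * max 0 (- E t))" for a
    by (rule integrable_mult_indicator[where 'b=real, simplified]; use iP in simp)+
  have eP: "emeasure (density lborel P) {a<..} = ennreal (LINT t|lborel. indicator {a<..} t * max 0 (E t))" for a
    by (subst nn_integral_eq_integral[OF iI(1), symmetric])
       (auto simp: emeasure_density P_def indicator_def intro!: nn_integral_cong)
  have eN: "emeasure (density lborel N) {a<..} = ennreal (LINT t|lborel. indicator {a<..} t * max 0 (- E t))" for a
    by (subst nn_integral_eq_integral[OF iI(2), symmetric])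
       (auto simp: emeasure_density N_def indicator_def intro!: nn_integral_cong)
  have "density lborel P = density lborel N"
  proof (rule measure_eqI_lessThan)
    fix a :: real
    have "(LINT t|lborel. indicator {a<..} t * max 0 (E t)) - (LINT t|lborel. indicator {a<..} t * max 0 (- E t))
      = (LINT t|lborel. indicator {a<..} t * E t)"
      by (subst Bochner_Integration.integral_diff[OF iI, symmetric])
         (auto intro!: Bochner_Integration.integral_cong simp: max_def indicator_def)
    then show "emeasure (density lborel P) {a<..} = emeasure (density lborel N) {a<..}"
      unfolding eP eN using half by simp
  qed (auto simp: eP)
  moreover have "integral\<^sup>N lborel P \<noteq> \<infinity>"
    unfolding P_def by (subst nn_integral_eq_integral[OF iP(1)]) auto
  ultimately have "AE t in lborel. P t = N t"
    by (subst finite_density_unique[symmetric]) auto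
  then show ?thesis
    by eventually_elim (auto simp: P_def N_def max_def split: if_splits)
qed

lemma laplace_transform_unique:
  fixes f g :: "real \<Rightarrow> real"
  assumes f: "set_integrable lborel {0<..} (\<lambda>t. exp (- t) * f t)"
    and g: "set_integrable lborel {0<..} (\<lambda>t. exp (- t) * g t)"
    and eq: "\<And>n::nat. n \<ge> 1 \<Longrightarrow> (LINT t:{0<..}|lborel. exp (- real n * t) * f t) = (LINT t:{0<..}|lborel. exp (- real n * t) * g t)"
  shows "AE t in lborel. t > 0 \<longrightarrow> f t = g t"
proof -
  let ?I = "\<lambda>h t. indicator {0<..} t *\<^sub>R (exp (- t) * h t)"
  define E where "E = (\<lambda>t. indicator {0<..} t *\<^sub>R (exp (- t) * f t) - indicator {0<..} t *\<^sub>R (exp (- t) * g t))"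
  have int: "integrable lborel (\<lambda>t. exp (- t) ^ n * (?I h t))"
    if h: "set_integrable lborel {0<..} (\<lambda>t. exp (- t) * h t)" for n :: nat and h :: "real \<Rightarrow> real"
  proof (rule Bochner_Integration.integrable_bound[OF h[unfolded set_integrable_def]])
    have [measurable]: "(\<lambda>t. ?I h t) \<in> borel_measurable lborel"
      using h unfolding set_integrable_def by (rule borel_measurable_integrable)
    show "(\<lambda>t. exp (- t) ^ n * (?I h t)) \<in> borel_measurable lborel"
      by measurable
    show "AE t in lborel. norm (exp (- t) ^ n * (?I h t)) \<le> norm (?I h t)"
    proof (rule AE_I2)
      fix t :: real
      show "norm (exp (- t) ^ n * (?I h t)) \<le> norm (?I h t)"
      proof (cases "t > 0")
        case True
        then have "exp (- t) ^ n \<le> 1" by (intro power_le_one) auto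
        then have "exp (- t) ^ n * \<bar>exp (- t) * h t\<bar> \<le> 1 * \<bar>exp (- t) * h t\<bar>" by (intro mult_right_mono) auto
        then show ?thesis using True by (simp add: abs_mult)
      qed simp
    qed
  qed
  have E0: "AE t in lborel. E t = 0"
  proof (rule laplace_moments_zero_imp_zero)
    show "integrable lborel E" unfolding E_def using f g unfolding set_integrable_def by (rule Bochner_Integration.integrable_diff)
    fix n :: nat
    have e: "exp (- t) ^ n * (?I h t) = indicator {0<..} t *\<^sub>R (exp (- real (Suc n) * t) * h t)" for t h
    proof -
      have "exp (- t) ^ n * exp (- t) = exp (- real (Suc n) * t)"
        by (simp add: exp_add algebra_simps flip: exp_of_nat_mult exp_add)
      then show ?thesis by (simp add: indicator_def)
    qed
    have "(LINT t|lborel. exp (- t) ^ n * E t) = (LINT t|lborel. exp (- t) ^ n * (indicator {0<..} t *\<^sub>R (exp (- t) * f t))) - (LINT t|lborel. exp (- t) ^ n * (indicator {0<..} t *\<^sub>R (exp (- t) * g t)))"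
      unfolding E_def right_diff_distrib by (rule Bochner_Integration.integral_diff[OF int[OF f] int[OF g]])
    also have "\<dots> = 0"
      using eq[of "Suc n"] unfolding set_lebesgue_integral_def e by simp
    finally show "(LINT t|lborel. exp (- t) ^ n * E t) = 0" .
  qed (simp add: E_def)
  then show ?thesis
    by eventually_elim (auto simp: E_def)
qed

section \<open>Inversion of the stable Laplace transform\<close>

text \<open>
  This is \<open>- Im (exp (- z powr \<alpha>)) / \<pi>\<close> at \<open>z = y * exp (\<i> * \<pi>)\<close>, on the upper side of the cut.
\<close>

definition stable_kernel :: "real \<Rightarrow> real \<Rightarrow> real" where
  "stable_kernel \<alpha> y = exp (- (y powr \<alpha> * cos (pi * \<alpha>))) * sin (y powr \<alpha> * sin (pi * \<alpha>)) / pi"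

text \<open>
  The Bromwich integrand \<open>exp (t * z - z powr \<alpha>) dz\<close> in the coordinate \<open>z = exp w\<close>; the summand \<open>w\<close>
  in the exponent comes from \<open>dz = exp w dw\<close>.
\<close>

definition stable_integrand :: "real \<Rightarrow> real \<Rightarrow> complex \<Rightarrow> complex" where
  "stable_integrand \<alpha> t w = exp (of_real t * exp w - exp (of_real \<alpha> * w) + w)"

text \<open>
  The Bromwich integral along the imaginary axis. The two half axes contribute complex conjugate
  values, so that the factor \<open>1 / (2 * \<pi> * \<i>)\<close> and both halves combine to \<open>Im / \<pi>\<close> of
  the upper half, which is the line at height \<open>\<pi> / 2\<close>.
\<close>

definition stable_inversion :: "real \<Rightarrow> real \<Rightarrow> real" where
  "stable_inversion \<alpha> t = Im (LINT x|lborel. stable_integrand \<alpha> t (Complex x (pi / 2))) / pi"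

lemma stable_kernel_measurable[measurable]: "stable_kernel \<alpha> \<in> borel_measurable borel"
  unfolding stable_kernel_def by measurable

lemma norm_stable_integrand:
  "norm (stable_integrand \<alpha> t (Complex x \<eta>))
    = exp (t * exp x * cos \<eta> - exp (\<alpha> * x) * cos (\<alpha> * \<eta>) + x)"
  by (simp add: stable_integrand_def Re_exp complex_of_real_mult_Complex)

lemma Im_stable_integrand_pi:
  "Im (stable_integrand \<alpha> t (Complex x pi))
    = exp x * (exp (- (t * exp x)) * (pi * stable_kernel \<alpha> (exp x)))"
proof -
  have "Im (stable_integrand \<alpha> t (Complex x pi))
      = exp (x - t * exp x - exp (\<alpha> * x) * cos (\<alpha> * pi)) * sin (pi - exp (\<alpha> * x) * sin (\<alpha> * pi))"
    by (simp add: stable_integrand_def Im_exp Re_exp complex_of_real_mult_Complex algebra_simps)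
  also have "sin (pi - exp (\<alpha> * x) * sin (\<alpha> * pi)) = sin (exp (\<alpha> * x) * sin (\<alpha> * pi))"
    by (simp add: sin_diff)
  also have "exp (x - t * exp x - exp (\<alpha> * x) * cos (\<alpha> * pi))
      = exp x * (exp (- (t * exp x)) * exp (- (exp (\<alpha> * x) * cos (\<alpha> * pi))))"
    by (simp flip: exp_add)
  finally show ?thesis
    by (simp add: stable_kernel_def powr_def mult_ac)
qed

lemma stable_cos_pos:
  fixes \<alpha> :: real
  assumes "0 < \<alpha>" "\<alpha> < 1" shows "cos (\<alpha> * (pi / 2)) > 0"
proof (rule cos_gt_zero_pi)
  have "\<alpha> * (pi / 2) < 1 * (pi / 2)" "0 < \<alpha> * (pi / 2)" using assms by (intro mult_strict_right_mono, auto)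
  then show "- (pi / 2) < \<alpha> * (pi / 2)" "\<alpha> * (pi / 2) < pi / 2" using pi_gt_zero by linarith+
qed

lemma stable_line_majorant_integrable:
  fixes \<alpha> c :: real
  assumes "0 < \<alpha>" "c > 0"
  shows "integrable lborel (\<lambda>x. exp (x - c * exp (\<alpha> * x)))"
proof -
  have "integrable lborel (\<lambda>x. exp (1 / \<alpha> * (0 + \<alpha> * x) - c * exp (0 + \<alpha> * x)))"
    by (rule lborel_integrable_real_affine[OF gamma_log_integrable]) (use assms in auto)
  then show ?thesis using assms by simp
qed

text \<open>
  The line is shifted from height \<open>\<pi> / 2\<close> to height \<open>\<pi>\<close>, where \<open>exp w\<close> is a negative
  real number and the integrand becomes \<open>exp (- t * y)\<close> times a function of \<open>y = exp x\<close>.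
\<close>

lemma stable_inversion_eq_laplace_kernel:
  assumes \<alpha>: "0 < \<alpha>" "\<alpha> < 1" and t: "t > 0"
  shows "stable_inversion \<alpha> t = (LINT y:{0<..}|lborel. exp (- (t * y)) * stable_kernel \<alpha> y)"
proof -
  \<comment> \<open>An angle with \<open>\<pi> / 2 < \<eta>1\<close> and \<open>\<alpha> * \<eta>1 < \<pi> / 2\<close>: up to \<open>\<eta>1\<close> the factor \<open>exp (- z powr \<alpha>)\<close> decays,
    and from \<open>\<eta>1\<close> on the factor \<open>exp (t * z)\<close> does.\<close>
  define \<eta>1 where "\<eta>1 = min pi (pi / 4 * (1 + 1 / \<alpha>))"
  have e1: "pi / 2 < \<eta>1" "\<eta>1 \<le> pi"
  proof -
    have "1 < 1 / \<alpha>" using \<alpha> by simp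
    then have "pi / 4 * 2 < pi / 4 * (1 + 1 / \<alpha>)" by (intro mult_strict_left_mono) auto
    then show "pi / 2 < \<eta>1" using pi_gt_zero unfolding \<eta>1_def by linarith
  qed (simp add: \<eta>1_def)
  have "\<alpha> * \<eta>1 \<le> \<alpha> * (pi / 4 * (1 + 1 / \<alpha>))" unfolding \<eta>1_def using \<alpha> by (intro mult_left_mono min.cobounded2) auto
  also have "\<dots> = pi / 4 * (\<alpha> + 1)" using \<alpha> by (simp add: field_simps)
  also have "\<dots> < pi / 2" using \<alpha> by simp
  finally have e2: "\<alpha> * \<eta>1 < pi / 2" .
  define c1 where "c1 = cos (\<alpha> * \<eta>1)"
  define c2 where "c2 = t * (- cos \<eta>1)"
  have ae: "0 < \<alpha> * \<eta>1" using \<alpha> e1 pi_gt_zero by (intro mult_pos_pos) linarith+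
  have c1: "c1 > 0" unfolding c1_def using ae e2 by (intro cos_gt_zero_pi) auto
  have "cos \<eta>1 < cos (pi / 2)" using e1 pi_gt_zero by (intro cos_monotone_0_pi) linarith+
  then have c2: "c2 > 0" unfolding c2_def using t by (intro mult_pos_pos) auto
  let ?B = "\<lambda>x. exp (x - c1 * exp (\<alpha> * x)) + exp (x + exp (\<alpha> * x) - c2 * exp x)"
  have bound: "norm (stable_integrand \<alpha> t (Complex x \<eta>)) \<le> ?B x" if \<eta>: "pi / 2 \<le> \<eta>" "\<eta> \<le> pi" for x \<eta>
  proof (cases "\<eta> \<le> \<eta>1")
    case True
    have "cos \<eta> \<le> cos (pi / 2)" using \<eta> pi_gt_zero by (intro cos_monotone_0_pi_le) linarith+
    then have A: "t * exp x * cos \<eta> \<le> 0" using t by (intro mult_nonneg_nonpos) auto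
    have "\<alpha> * \<eta> \<le> \<alpha> * \<eta>1" "0 \<le> \<alpha> * \<eta>" using \<alpha> \<eta> True pi_gt_zero by (auto intro: mult_left_mono)
    then have "c1 \<le> cos (\<alpha> * \<eta>)" unfolding c1_def using e2 pi_gt_zero by (intro cos_monotone_0_pi_le) linarith+
    then have B: "c1 * exp (\<alpha> * x) \<le> exp (\<alpha> * x) * cos (\<alpha> * \<eta>)" by simp
    then have "norm (stable_integrand \<alpha> t (Complex x \<eta>)) \<le> exp (x - c1 * exp (\<alpha> * x))"
      unfolding norm_stable_integrand exp_le_cancel_iff using A B by linarith
    then show ?thesis by (simp add: add_increasing2)
  next
    case False
    have "cos \<eta> \<le> cos \<eta>1" using \<eta> False e1 pi_gt_zero by (intro cos_monotone_0_pi_le) linarith+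
    then have "t * exp x * cos \<eta> \<le> t * exp x * cos \<eta>1" using t by (intro mult_left_mono) auto
    then have A: "t * exp x * cos \<eta> \<le> - (c2 * exp x)" by (simp add: c2_def mult_ac)
    have "exp (\<alpha> * x) * - cos (\<alpha> * \<eta>) \<le> exp (\<alpha> * x) * 1" by (intro mult_left_mono) (auto simp: minus_le_iff)
    then have "norm (stable_integrand \<alpha> t (Complex x \<eta>)) \<le> exp (x + exp (\<alpha> * x) - c2 * exp x)"
      unfolding norm_stable_integrand using A by simp
    then show ?thesis by (simp add: add_increasing)
  qed
  have lim: "((\<lambda>x. exp (1 / 2 * x) * ?B x) \<longlongrightarrow> 0) at_top" "((\<lambda>x. exp (- (1 / 2) * x) * ?B x) \<longlongrightarrow> 0) at_bot"
    by (use \<alpha> c1 c2 in real_asymp)+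
  have hol: "stable_integrand \<alpha> t holomorphic_on UNIV"
    unfolding stable_integrand_def by (intro holomorphic_intros)
  have half: "pi / 2 \<le> pi" using pi_gt_zero by linarith
  have shift: "(LINT x|lborel. stable_integrand \<alpha> t (Complex x (pi / 2))) = (LINT x|lborel. stable_integrand \<alpha> t (Complex x pi))"
    by (rule strip_shift_decay(1)[where S=UNIV and N=0 and B="?B" and \<epsilon>="1/2"]) (use hol half lim bound in auto)
  have int: "integrable lborel (\<lambda>x. stable_integrand \<alpha> t (Complex x pi))"
    by (rule strip_shift_decay(2)[where a="pi/2" and b=pi and S=UNIV and N=0 and B="?B" and \<epsilon>="1/2"]) (use hol half lim bound in auto)
  have "stable_inversion \<alpha> t = (LINT x|lborel. Im (stable_integrand \<alpha> t (Complex x pi))) / pi"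
    unfolding stable_inversion_def shift using int by simp
  also have "(LINT x|lborel. Im (stable_integrand \<alpha> t (Complex x pi)))
      = (LINT x|lborel. exp x *\<^sub>R (exp (- (t * exp x)) * (pi * stable_kernel \<alpha> (exp x))))"
    unfolding Im_stable_integrand_pi by simp
  also have "\<dots> = (LINT y:{0<..}|lborel. exp (- (t * y)) * (pi * stable_kernel \<alpha> y))"
    by (subst set_integral_exp_subst(2)) auto
  also have "\<dots> = (LINT y:{0<..}|lborel. pi * (exp (- (t * y)) * stable_kernel \<alpha> y))"
    by (simp add: mult_ac)
  also have "\<dots> = pi * (LINT y:{0<..}|lborel. exp (- (t * y)) * stable_kernel \<alpha> y)"
    by simp
  finally show "stable_inversion \<alpha> t = (LINT y:{0<..}|lborel. exp (- (t * y)) * stable_kernel \<alpha> y)"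
    by simp
qed

lemma poisson_line_integral:
  assumes "s > 0"
  shows "has_bochner_integral lborel (\<lambda>x. 2 * s * exp x / (s\<^sup>2 + exp x ^ 2)) pi"
proof -
  let ?f = "\<lambda>x. 2 * s * exp x / (s\<^sup>2 + exp x ^ 2)" and ?F = "\<lambda>x. 2 * arctan (exp x / s)"
  have ne: "s\<^sup>2 + exp x ^ 2 \<noteq> 0" for x using assms by (smt (verit) zero_less_power exp_gt_zero)
  have F: "DERIV ?F x :> ?f x" for x
  proof -
    have "DERIV ?F x :> 2 * (exp x / s * inverse (1 + (exp x / s)\<^sup>2))"
      using assms by (auto intro!: derivative_eq_intros)
    also have "2 * (exp x / s * inverse (1 + (exp x / s)\<^sup>2)) = ?f x"
      using assms ne[of x] by (simp add: field_simps power2_eq_square)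
    finally show ?thesis .
  qed
  have lim: "(?F \<longlongrightarrow> 0) at_bot" "(?F \<longlongrightarrow> pi) at_top"
    by (use assms in real_asymp)+
  have A: "((?F \<circ> real_of_ereal) \<longlongrightarrow> 0) (at_right (- \<infinity>))" "((?F \<circ> real_of_ereal) \<longlongrightarrow> pi) (at_left \<infinity>)"
    using lim by (simp_all add: ereal_tendsto_simps)
  have c: "isCont ?f x" for x using ne by (intro continuous_intros) auto
  have nn: "0 \<le> ?f x" for x using assms by simp
  note FTC = interval_integral_FTC_nonneg[of "-\<infinity>" \<infinity> ?F ?f 0 pi, OF _ F c _ A]
  have "set_integrable lborel UNIV ?f" "(LBINT x=-\<infinity>..\<infinity>. ?f x) = pi"
    using FTC nn by (auto simp: einterval_iff)
  then show ?thesis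
    by (auto simp: has_bochner_integral_iff set_integrable_def interval_lebesgue_integral_def set_lebesgue_integral_def)
qed

text \<open>
  In the coordinate \<open>z = exp w\<close> the left-hand side is the integral of \<open>exp (- z powr \<alpha>) / (s - z)\<close> along
  the upper imaginary half axis. Subtracting \<open>exp (- s powr \<alpha>) * 2 * s / (s + z)\<close> from the numerator
  cancels the pole at \<open>z = s\<close>, so the difference can be shifted down to the positive real axis, where
  it is real. The imaginary part thus comes from the subtracted term alone, which is a Poisson integral.
\<close>

lemma stable_residue:
  fixes s \<alpha> :: real
  assumes \<alpha>: "0 < \<alpha>" "\<alpha> < 1" and s: "s > 0"
  shows "Im (LINT x|lborel. exp (- exp (of_real \<alpha> * Complex x (pi / 2)) + Complex x (pi / 2)) / (of_real s - exp (Complex x (pi / 2))))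
     = pi * exp (- (s powr \<alpha>))"
proof -
  define E where "E = exp (- (s powr \<alpha>))"
  define w0 where "w0 = complex_of_real (ln s)"
  define S where "S = {w. Im w < pi} \<inter> {w. - pi < Im w}"
  \<comment> \<open>\<open>A\<close> is the numerator of the difference over the common denominator \<open>s + exp w\<close>. It vanishes at \<open>w0 = ln s\<close>,
    and dividing it and \<open>exp w - s\<close> by \<open>w - w0\<close> exhibits \<open>D\<close> as holomorphic there.\<close>
  define A where "A w = exp (- exp (of_real \<alpha> * w)) * (of_real s + exp w) - of_real (2 * s * E)" for w :: complex
  define a where "a w = (if w = w0 then deriv A w0 else (A w - A w0) / (w - w0))" for w
  define b where "b w = (if w = w0 then deriv exp w0 else (exp w - exp w0) / (w - w0))" for w
  define D where "D w = - (a w / b w) * exp w / (of_real s + exp w)" for w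
  have ew0: "exp w0 = of_real s" unfolding w0_def using s by (simp add: exp_of_real)
  have A0: "A w0 = 0"
  proof -
    have "exp (of_real \<alpha> * w0) = of_real (s powr \<alpha>)"
      unfolding w0_def using s by (simp add: powr_def flip: exp_of_real)
    then have "exp (- exp (of_real \<alpha> * w0)) = of_real E"
      by (simp add: E_def flip: exp_of_real)
    then show ?thesis by (simp add: A_def ew0)
  qed
  have holA: "A holomorphic_on UNIV" unfolding A_def by (intro holomorphic_intros)
  have hola: "a holomorphic_on UNIV" unfolding a_def by (rule pole_lemma[OF holA]) simp
  have holb: "b holomorphic_on UNIV" unfolding b_def by (rule pole_lemma) (auto intro: holomorphic_intros)
  have S: "open S" "convex S"
    unfolding S_def by (auto intro!: open_Int convex_Int open_halfspace_Im_lt open_halfspace_Im_gt convex_halfspace_Im_lt convex_halfspace_Im_gt)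
  have eqs: "w = w0" if "w \<in> S" "exp w = of_real s" for w
  proof -
    from that(2) ew0 have "exp w = exp w0" by simp
    then obtain n :: int where n: "w = w0 + of_int (2 * n) * of_real pi * \<i>" unfolding exp_eq by auto
    then have "Im w = 2 * real_of_int n * pi" by (simp add: w0_def)
    with that(1) have "2 * real_of_int n * pi < 1 * pi" "(-1) * pi < 2 * real_of_int n * pi" by (auto simp: S_def)
    then have "2 * real_of_int n < 1" "- 1 < 2 * real_of_int n" by (simp_all only: mult_less_cancel_right_pos[OF pi_gt_zero])
    then have "n = 0" by linarith
    then show ?thesis using n by simp
  qed
  have ne_m: "of_real s + exp w \<noteq> 0" if "w \<in> S" for w
  proof
    assume "of_real s + exp w = 0"
    then have "exp w = of_real (-s)" by (simp add: add_eq_0_iff)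
    moreover have "exp (w0 + of_real pi * \<i>) = of_real (-s)" by (simp add: exp_add ew0)
    ultimately have "exp w = exp (w0 + of_real pi * \<i>)" by simp
    then obtain n :: int where n: "w = w0 + of_real pi * \<i> + of_int (2 * n) * of_real pi * \<i>" unfolding exp_eq by auto
    then have "Im w = (2 * real_of_int n + 1) * pi" by (simp add: w0_def algebra_simps)
    with that have "(2 * real_of_int n + 1) * pi < 1 * pi" "(-1) * pi < (2 * real_of_int n + 1) * pi" by (auto simp: S_def)
    then have "2 * real_of_int n + 1 < 1" "- 1 < 2 * real_of_int n + 1" by (simp_all only: mult_less_cancel_right_pos[OF pi_gt_zero])
    then have "n < 0" "- 1 < n" by linarith+
    then show False by linarith
  qed
  have b0: "b w \<noteq> 0" if w: "w \<in> S" for w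
  proof (cases "w = w0")
    case True
    then show ?thesis using s by (simp add: b_def ew0 DERIV_imp_deriv[OF DERIV_exp])
  next
    case False
    then have "exp w \<noteq> of_real s" using eqs[OF w] by blast
    then show ?thesis using False by (simp add: b_def ew0)
  qed
  have holD: "D holomorphic_on S"
    unfolding D_def using ne_m b0
    by (intro holomorphic_intros holomorphic_on_subset[OF hola] holomorphic_on_subset[OF holb]) auto
  have D: "D w = (exp (- exp (of_real \<alpha> * w)) - of_real (2 * s * E) / (of_real s + exp w)) * exp w / (of_real s - exp w)"
    if "w \<in> S" "w \<noteq> w0" for w
  proof -
    have 1: "of_real s - exp w \<noteq> 0" using eqs[OF that(1)] that(2) by auto
    have "a w / b w = A w / - (of_real s - exp w)"
      using that(2) by (simp add: a_def b_def A0 ew0)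
    moreover have "- (p / - u) * q / v = p / v * q / u" for p q u v :: complex
      by (simp add: divide_inverse mult_ac)
    ultimately have "D w = A w / (of_real s + exp w) * exp w / (of_real s - exp w)"
      unfolding D_def by (simp only:)
    moreover have "A w / (of_real s + exp w) = exp (- exp (of_real \<alpha> * w)) - of_real (2 * s * E) / (of_real s + exp w)"
      unfolding A_def diff_divide_distrib using ne_m[OF that(1)] by simp
    ultimately show ?thesis by simp
  qed
  let ?c = "cos (\<alpha> * (pi / 2))"
  have c: "?c > 0" by (rule stable_cos_pos[OF \<alpha>])
  have strip: "Complex x \<eta> \<in> S" if "0 \<le> \<eta>" "\<eta> \<le> pi / 2" for x \<eta>
    using that pi_gt_zero unfolding S_def by (simp, linarith)
  let ?B = "\<lambda>x. (exp (- ?c * exp (\<alpha> * x)) + 4 * s * E / (s + exp x)) * exp x / \<bar>s - exp x\<bar>"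
  have E: "E > 0" by (simp add: E_def)
  have bound: "norm (D (Complex x \<eta>)) \<le> ?B x" if x: "\<bar>ln s\<bar> + 1 \<le> \<bar>x\<bar>" and \<eta>: "0 \<le> \<eta>" "\<eta> \<le> pi / 2" for x \<eta>
  proof -
    let ?w = "Complex x \<eta>"
    have xs: "exp x \<noteq> s" using x by auto
    have ne: "?w \<noteq> w0" using x by (auto simp: w0_def complex_eq_iff)
    have "\<alpha> * \<eta> \<le> \<alpha> * (pi / 2)" using \<alpha> \<eta> by (intro mult_left_mono) auto
    moreover have "\<alpha> * (pi / 2) \<le> 1 * pi" using \<alpha> pi_gt_zero by (intro mult_mono) auto
    ultimately have "?c \<le> cos (\<alpha> * \<eta>)" using \<alpha> \<eta> by (intro cos_monotone_0_pi_le) auto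
    then have 1: "norm (exp (- exp (of_real \<alpha> * ?w))) \<le> exp (- ?c * exp (\<alpha> * x))"
      by (simp add: complex_of_real_mult_Complex Re_exp)
    have R: "Re (exp ?w) \<ge> 0" using \<eta> by (simp add: Re_exp cos_ge_zero)
    have "(s + exp x) / 2 \<le> norm (of_real s + exp ?w)"
    proof -
      have "s \<le> norm (of_real s + exp ?w)" using complex_Re_le_cmod[of "of_real s + exp ?w"] R by simp
      moreover have "exp x \<le> norm (of_real s + exp ?w)"
      proof -
        have "(Re (exp ?w))\<^sup>2 \<le> (s + Re (exp ?w))\<^sup>2" using R s by (intro power_mono) auto
        then have "norm (exp ?w) \<le> norm (of_real s + exp ?w)" unfolding cmod_def by simp
        then show ?thesis by simp
      qed
      ultimately show ?thesis by simp
    qed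
    then have "norm (of_real (2 * s * E) / (of_real s + exp ?w)) \<le> 2 * s * E / ((s + exp x) / 2)"
      unfolding norm_divide norm_of_real using s E by (intro frac_le) (auto simp: add_pos_pos)
    also have "\<dots> = 4 * s * E / (s + exp x)" by simp
    finally have 2: "norm (of_real (2 * s * E) / (of_real s + exp ?w)) \<le> 4 * s * E / (s + exp x)" .
    have 3: "\<bar>s - exp x\<bar> \<le> norm (of_real s - exp ?w)"
      using norm_triangle_ineq3[of "complex_of_real s" "exp ?w"] s by simp
    have "norm (D ?w) = norm (exp (- exp (of_real \<alpha> * ?w)) - of_real (2 * s * E) / (of_real s + exp ?w)) * exp x / norm (of_real s - exp ?w)"
      unfolding D[OF strip[OF \<eta>] ne] by (simp add: norm_mult norm_divide)
    also have "\<dots> \<le> ?B x"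
      using 3 xs order_trans[OF norm_triangle_ineq4 add_mono[OF 1 2]]
      by (intro frac_le mult_right_mono) (auto intro!: add_nonneg_nonneg divide_nonneg_pos add_pos_pos simp: s E less_imp_le)
    finally show ?thesis .
  qed
  have lim: "((\<lambda>x. exp (1 / 2 * x) * ?B x) \<longlongrightarrow> 0) at_top" "((\<lambda>x. exp (- (1 / 2) * x) * ?B x) \<longlongrightarrow> 0) at_bot"
    by (use \<alpha> c s E in real_asymp)+
  have half: "0 \<le> pi / 2" by simp
  note sh = strip_shift_decay[where a=0 and b="pi/2" and G=D and B="?B" and \<epsilon>="1/2" and S=S and N="\<bar>ln s\<bar> + 1", OF half S holD strip bound _ lim, simplified]
  have "Im (LINT x|lborel. D (Complex x 0)) = (LINT x|lborel. Im (D (Complex x 0)))"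
    using sh(2)[of 0] by simp
  also have "\<dots> = 0"
  proof (rule integral_eq_zero_AE)
    show "AE x in lborel. Im (D (Complex x 0)) = 0"
      using AE_lborel_singleton[of "ln s"]
    proof eventually_elim
      case (elim x)
      have Sx: "Complex x 0 \<in> S" by (rule strip) auto
      have ne: "Complex x 0 \<noteq> w0" using elim by (simp add: w0_def complex_eq_iff)
      have "Complex x 0 = of_real x" "exp (complex_of_real \<alpha> * of_real x) = of_real (exp (\<alpha> * x))"
        by (simp_all add: complex_eq_iff flip: exp_of_real)
      then have "D (Complex x 0) = of_real ((exp (- exp (\<alpha> * x)) - 2 * s * E / (s + exp x)) * exp x / (s - exp x))"
        using D[OF Sx ne] by (simp flip: exp_of_real)
      then show ?case by simp
    qed
  qed
  finally have ImD: "Im (LINT x|lborel. D (Complex x (pi / 2))) = 0" using sh(1) by simp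
  have eh: "exp (Complex x (pi / 2)) = \<i> * of_real (exp x)" for x
    by (simp add: complex_eq_iff Re_exp Im_exp)
  have dec: "exp (- exp (of_real \<alpha> * Complex x (pi / 2)) + Complex x (pi / 2)) / (of_real s - exp (Complex x (pi / 2)))
     = D (Complex x (pi / 2)) + \<i> * of_real (E * (2 * s * exp x / (s\<^sup>2 + exp x ^ 2)))" for x
  proof -
    let ?w = "Complex x (pi / 2)"
    have w: "?w \<in> S" by (rule strip) auto
    have n: "?w \<noteq> w0" by (simp add: w0_def complex_eq_iff)
    have 1: "of_real s - exp ?w \<noteq> 0" using eqs[OF w] n by auto
    have p: "s\<^sup>2 + exp x ^ 2 \<noteq> 0" using s by (smt (verit) zero_less_power exp_gt_zero)
    have "(of_real s + exp ?w) * (of_real s - exp ?w) = of_real (s\<^sup>2 + exp x ^ 2)"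
      unfolding eh by (simp add: complex_eq_iff power2_eq_square algebra_simps)
    moreover have "c / v * e / u = c * e / (v * u)" for c v e u :: complex by simp
    ultimately have "of_real (2 * s * E) / (of_real s + exp ?w) * exp ?w / (of_real s - exp ?w) = of_real (2 * s * E) * exp ?w / of_real (s\<^sup>2 + exp x ^ 2)"
      by (simp only:)
    also have "\<dots> = \<i> * of_real (E * (2 * s * exp x / (s\<^sup>2 + exp x ^ 2)))"
      unfolding eh by simp
    finally have k: "of_real (2 * s * E) / (of_real s + exp ?w) * exp ?w / (of_real s - exp ?w) = \<i> * of_real (E * (2 * s * exp x / (s\<^sup>2 + exp x ^ 2)))" .
    show ?thesis
      unfolding k[symmetric] D[OF w n] exp_add by (simp add: diff_divide_distrib left_diff_distrib)
  qed
  define q where "q x = 2 * s * exp x / (s\<^sup>2 + exp x ^ 2)" for x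
  have P: "integrable lborel q" "(LINT x|lborel. q x) = pi"
    using poisson_line_integral[OF s] by (auto simp: has_bochner_integral_iff q_def[abs_def])
  have iP: "integrable lborel (\<lambda>x. \<i> * complex_of_real (E * q x))"
    using P by (intro integrable_mult_right integrable_of_real)
  have "(LINT x|lborel. \<i> * complex_of_real (E * q x)) = \<i> * complex_of_real (E * pi)"
    by (subst integral_mult_right_zero, subst integral_of_real) (use P in auto)
  then show ?thesis
    unfolding dec q_def[symmetric] using iP sh(2)[of "pi/2"] ImD by (simp add: E_def)
qed

lemma laplace_exponential:
  fixes c :: complex
  assumes "Re c > 0"
  shows "(LINT t:{0<..}|lborel. exp (- of_real t * c)) = 1 / c"
proof -
  have c0: "c \<noteq> 0" using assms by auto
  have "(LINT t:{0<..}|lborel. exp (- of_real t * c)) = (LINT t:{0<..}|lborel. of_real (t powr (1 - 1)) * exp (- of_real (t powr 1) * c))"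
    by (rule set_lebesgue_integral_cong) auto
  also have "\<dots> = 1 / c"
    by (subst gamma_power_integral(2)) (use assms c0 in \<open>auto simp: exp_minus inverse_eq_divide\<close>)
  finally show ?thesis .
qed

lemma stable_line_measurable:
  "(\<lambda>(t, x). stable_integrand \<alpha> t (Complex x \<eta>)) \<in> borel_measurable (lborel \<Otimes>\<^sub>M lborel)"
  unfolding stable_integrand_def Complex_eq by measurable

lemma stable_inversion_measurable[measurable]: "stable_inversion \<alpha> \<in> borel_measurable borel"
proof -
  have "(\<lambda>t. LINT x|lborel. stable_integrand \<alpha> t (Complex x (pi / 2))) \<in> borel_measurable lborel"
    using stable_line_measurable by (rule lborel.borel_measurable_lebesgue_integral)
  then show ?thesis unfolding stable_inversion_def[abs_def] by measurable
qed

lemma norm_stable_integrand_half_pi: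
  "norm (stable_integrand \<alpha> t (Complex x (pi / 2))) = exp (x - cos (\<alpha> * (pi / 2)) * exp (\<alpha> * x))"
  unfolding norm_stable_integrand by (simp add: mult_ac)

lemma stable_inversion_bounded:
  fixes \<alpha> :: real
  assumes "0 < \<alpha>" "\<alpha> < 1"
  shows "\<exists>M>0. \<forall>t. \<bar>stable_inversion \<alpha> t\<bar> \<le> M"
proof -
  define J where "J = (LINT x|lborel. exp (x - cos (\<alpha> * (pi / 2)) * exp (\<alpha> * x)))"
  have "\<bar>stable_inversion \<alpha> t\<bar> \<le> J / pi" for t
  proof -
    have "\<bar>Im (LINT x|lborel. stable_integrand \<alpha> t (Complex x (pi / 2)))\<bar> \<le> norm (LINT x|lborel. stable_integrand \<alpha> t (Complex x (pi / 2)))"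
      by (rule abs_Im_le_cmod)
    also have "\<dots> \<le> (LINT x|lborel. norm (stable_integrand \<alpha> t (Complex x (pi / 2))))"
      by (rule integral_norm_bound)
    also have "\<dots> = J" unfolding norm_stable_integrand_half_pi J_def ..
    finally show ?thesis by (simp add: stable_inversion_def divide_right_mono)
  qed
  moreover have "J / pi \<le> max (J / pi) 1" "max (J / pi) 1 > 0" by auto
  ultimately show ?thesis by (meson order_trans)
qed

text \<open>
  Fubini carries out the \<open>t\<close>-integral first and leaves the integral of \<open>stable_residue\<close>. On the line at
  height \<open>\<pi> / 2\<close> the modulus of the integrand does not depend on \<open>t\<close> and is integrable, for every
  \<open>\<alpha> < 1\<close>; on the line at height \<open>\<pi>\<close> absolute convergence would fail near \<open>t = 0\<close> when
  \<open>\<alpha> > 1 / 2\<close>.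
\<close>

lemma stable_inversion_laplace:
  fixes \<alpha> s :: real
  assumes \<alpha>: "0 < \<alpha>" "\<alpha> < 1" and s: "s > 0"
  shows "set_integrable lborel {0<..} (\<lambda>t. exp (- (s * t)) * stable_inversion \<alpha> t)"
    and "(LINT t:{0<..}|lborel. exp (- (s * t)) * stable_inversion \<alpha> t) = exp (- (s powr \<alpha>))"
proof -
  obtain M where M: "\<And>t. \<bar>stable_inversion \<alpha> t\<bar> \<le> M" using stable_inversion_bounded[OF \<alpha>] by blast
  have i1: "set_integrable lborel {0<..} (\<lambda>t. exp (- (t * s)))" by (rule integrable_I0i_exp_mscale[OF s])
  show "set_integrable lborel {0<..} (\<lambda>t. exp (- (s * t)) * stable_inversion \<alpha> t)"
    unfolding set_integrable_def
  proof (rule Bochner_Integration.integrable_bound[OF integrable_mult_right[OF i1[unfolded set_integrable_def], of M]])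
    show "AE t in lborel. norm (indicator {0<..} t *\<^sub>R (exp (- (s * t)) * stable_inversion \<alpha> t)) \<le> norm (M * (indicator {0<..} t *\<^sub>R exp (- (t * s))))"
      using M order_trans[OF M abs_ge_self] by (auto simp: indicator_def abs_mult mult_ac intro!: mult_left_mono)
  qed measurable
  let ?G = "\<lambda>t x. stable_integrand \<alpha> t (Complex x (pi / 2))"
  let ?g = "\<lambda>x. exp (x - cos (\<alpha> * (pi / 2)) * exp (\<alpha> * x))"
  let ?f = "\<lambda>t x. indicat_real {0<..} t *\<^sub>R (of_real (exp (- (s * t))) * ?G t x)"
  have ig: "integrable lborel ?g" by (rule stable_line_majorant_integrable[OF \<alpha>(1) stable_cos_pos[OF \<alpha>]])
  have intG: "integrable lborel (?G t)" for t
  proof (rule Bochner_Integration.integrable_bound[OF ig])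
    show "?G t \<in> borel_measurable lborel" unfolding stable_integrand_def Complex_eq by measurable
  qed (simp add: norm_stable_integrand_half_pi)
  have mG: "(\<lambda>(t, x). ?f t x) \<in> borel_measurable (lborel \<Otimes>\<^sub>M lborel)"
    using stable_line_measurable[of \<alpha> "pi/2"] by measurable
  have fin: "(\<integral>\<^sup>+t. \<integral>\<^sup>+x. ennreal (norm (?f t x)) \<partial>lborel \<partial>lborel) < \<infinity>"
  proof -
    have "(\<integral>\<^sup>+t. \<integral>\<^sup>+x. ennreal (norm (?f t x)) \<partial>lborel \<partial>lborel)
       = (\<integral>\<^sup>+t. \<integral>\<^sup>+x. ennreal (indicat_real {0<..} t *\<^sub>R exp (- (t * s))) * ennreal (?g x) \<partial>lborel \<partial>lborel)"
      by (intro nn_integral_cong, subst ennreal_mult[symmetric])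
         (auto simp: norm_mult norm_stable_integrand_half_pi mult_ac)
    also have "\<dots> = (\<integral>\<^sup>+t. ennreal (indicat_real {0<..} t *\<^sub>R exp (- (t * s))) * (\<integral>\<^sup>+x. ennreal (?g x) \<partial>lborel) \<partial>lborel)"
      by (intro nn_integral_cong nn_integral_cmult) measurable
    also have "\<dots> = (\<integral>\<^sup>+t. ennreal (indicat_real {0<..} t *\<^sub>R exp (- (t * s))) \<partial>lborel) * (\<integral>\<^sup>+x. ennreal (?g x) \<partial>lborel)"
      by (intro nn_integral_multc) measurable
    also have "\<dots> < \<infinity>"
      using nn_integral_eq_integral[OF ig] nn_integral_eq_integral[OF i1[unfolded set_integrable_def]]
      by (simp add: ennreal_mult_less_top)
    finally show ?thesis .
  qed
  note swap = fubini_lborel[OF mG fin]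
  have inner: "(LINT t|lborel. ?f t x) = exp (- exp (of_real \<alpha> * Complex x (pi / 2)) + Complex x (pi / 2)) / (of_real s - exp (Complex x (pi / 2)))" for x
  proof -
    let ?w = "Complex x (pi / 2)"
    let ?H = "exp (- exp (of_real \<alpha> * ?w) + ?w)"
    have re: "Re (of_real s - exp ?w) > 0" using s by (simp add: Re_exp)
    have "(LINT t|lborel. ?f t x) = (LINT t:{0<..}|lborel. exp (- of_real t * (of_real s - exp ?w)) * ?H)"
      unfolding set_lebesgue_integral_def
    proof (intro Bochner_Integration.integral_cong refl arg_cong2[where f="scaleR"])
      fix t :: real
      have "complex_of_real (exp (- (s * t))) = exp (- (of_real s * of_real t))" by (simp flip: exp_of_real)
      then show "of_real (exp (- (s * t))) * ?G t x = exp (- of_real t * (of_real s - exp ?w)) * ?H"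
        by (simp add: stable_integrand_def algebra_simps flip: exp_add)
    qed
    also have "\<dots> = 1 / (of_real s - exp ?w) * ?H"
      using laplace_exponential[OF re] by simp
    finally show ?thesis by simp
  qed
  have "(LINT t:{0<..}|lborel. exp (- (s * t)) * stable_inversion \<alpha> t)
      = (LINT t|lborel. Im (LINT x|lborel. ?f t x)) / pi"
    unfolding set_lebesgue_integral_def
    by (simp add: stable_inversion_def)
  also have "(LINT t|lborel. Im (LINT x|lborel. ?f t x)) = Im (LINT t|lborel. LINT x|lborel. ?f t x)"
    by (rule integral_Im[OF swap(2)])
  also have "\<dots> = pi * exp (- (s powr \<alpha>))"
    unfolding swap(1) inner by (rule stable_residue[OF \<alpha> s])
  finally show "(LINT t:{0<..}|lborel. exp (- (s * t)) * stable_inversion \<alpha> t) = exp (- (s powr \<alpha>))"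
    by simp
qed

lemma stable_density_eq_laplace_kernel:
  assumes \<alpha>: "0 < \<alpha>" "\<alpha> < 1" and f: "f \<in> borel_measurable borel"
    and int: "\<And>s. s > 0 \<Longrightarrow> set_integrable lborel {0<..} (\<lambda>t. exp (- (s * t)) * f t)"
    and lap: "\<And>s. s > 0 \<Longrightarrow> (LINT t:{0<..}|lborel. exp (- (s * t)) * f t) = exp (- (s powr \<alpha>))"
  shows "AE t in lborel. t > 0 \<longrightarrow> f t = stable_inversion \<alpha> t"
proof (rule laplace_transform_unique)
  show "set_integrable lborel {0<..} (\<lambda>t. exp (- t) * f t)"
    using int[of 1] by simp
  show "set_integrable lborel {0<..} (\<lambda>t. exp (- t) * stable_inversion \<alpha> t)"
    using stable_inversion_laplace(1)[OF \<alpha>, of 1] by simp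
  show "(LINT t:{0<..}|lborel. exp (- real n * t) * f t) = (LINT t:{0<..}|lborel. exp (- real n * t) * stable_inversion \<alpha> t)"
    if "1 \<le> n" for n :: nat
    using lap[of n] stable_inversion_laplace(2)[OF \<alpha>, of n] that by simp
qed

lemma stable_cos_abs_less_1:
  fixes \<alpha> :: real
  assumes "0 < \<alpha>" "\<alpha> < 1"
  shows "\<bar>cos (pi * \<alpha>)\<bar> < 1" and "sin (pi * \<alpha>) > 0"
proof -
  show s: "sin (pi * \<alpha>) > 0" using assms by (intro sin_gt_zero) auto
  have "(cos (pi * \<alpha>))\<^sup>2 < 1\<^sup>2" using sin_cos_squared_add[of "pi * \<alpha>"] s by (simp add: power2_eq_square) (smt (verit) mult_pos_pos)
  then show "\<bar>cos (pi * \<alpha>)\<bar> < 1" using abs_square_less_1 by fastforce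
qed

text \<open>
  The first bound is for integrals against \<open>exp (- m * y powr \<alpha>)\<close> with \<open>m \<ge> 1\<close>, which absorb the
  exponential because \<open>\<bar>cos (\<pi> * \<alpha>)\<bar> < 1\<close>. The second records the zero at \<open>y = 0\<close>, which
  governs the decay of the density at infinity.
\<close>

lemma stable_kernel_abs_le:
  "\<bar>stable_kernel \<alpha> y\<bar> \<le> exp (\<bar>cos (pi * \<alpha>)\<bar> * y powr \<alpha>)"
  "\<bar>stable_kernel \<alpha> y\<bar> \<le> y powr \<alpha> * exp (\<bar>cos (pi * \<alpha>)\<bar> * y powr \<alpha>)"
proof -
  let ?e = "exp (- (y powr \<alpha> * cos (pi * \<alpha>)))" and ?E = "exp (\<bar>cos (pi * \<alpha>)\<bar> * y powr \<alpha>)"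
  let ?s = "\<bar>sin (y powr \<alpha> * sin (pi * \<alpha>))\<bar>"
  have k: "\<bar>stable_kernel \<alpha> y\<bar> = ?e * ?s / pi" by (simp add: stable_kernel_def abs_mult)
  have pi1: "p / pi \<le> p" if "p \<ge> 0" for p :: real
    using that pi_ge_two by (simp add: divide_le_eq mult_le_cancel_left1)
  have "y powr \<alpha> * - cos (pi * \<alpha>) \<le> y powr \<alpha> * \<bar>cos (pi * \<alpha>)\<bar>" by (intro mult_left_mono) auto
  then have e: "?e \<le> ?E" by (simp add: mult.commute)
  have "?e * ?s / pi \<le> ?e * ?s" by (rule pi1) simp
  also have "\<dots> \<le> ?E * 1" using e by (intro mult_mono) auto
  finally show "\<bar>stable_kernel \<alpha> y\<bar> \<le> ?E" using k by simp
  have "?s \<le> \<bar>y powr \<alpha> * sin (pi * \<alpha>)\<bar>" by (rule abs_sin_x_le_abs_x)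
  also have "\<dots> \<le> y powr \<alpha> * 1" unfolding abs_mult by (intro mult_mono) auto
  finally have s: "?s \<le> y powr \<alpha>" by simp
  have "?e * ?s / pi \<le> ?e * ?s" by (rule pi1) simp
  also have "\<dots> \<le> ?E * y powr \<alpha>" using e s by (intro mult_mono) auto
  finally show "\<bar>stable_kernel \<alpha> y\<bar> \<le> y powr \<alpha> * ?E" using k by (simp add: mult.commute)
qed

text \<open>
  The exponential and the cosine factor of the kernel merge into one Gamma integral with complex rate
  \<open>m + exp (- \<i> * \<pi> * \<alpha>)\<close>.
\<close>

lemma stable_kernel_gamma_integral:
  fixes \<alpha> d m :: real
  assumes \<alpha>: "0 < \<alpha>" and d: "d > 0" and m: "m + cos (pi * \<alpha>) > 0"
  shows "(LINT y:{0<..}|lborel. y powr (d - 1) * exp (- (y powr \<alpha> * m)) * stable_kernel \<alpha> y)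
     = Gamma (d / \<alpha>) / (pi * \<alpha>) * ((m + cos (pi * \<alpha>))\<^sup>2 + (sin (pi * \<alpha>))\<^sup>2) powr (- d / (2 * \<alpha>))
        * sin (d / \<alpha> * arctan (sin (pi * \<alpha>) / (m + cos (pi * \<alpha>))))"
proof -
  have e: "exp (- (q * m)) * exp (- (q * c)) = exp (- (q * (m + c)))" for q c :: real
    by (simp add: algebra_simps flip: exp_add)
  have "(LINT y:{0<..}|lborel. y powr (d - 1) * exp (- (y powr \<alpha> * m)) * stable_kernel \<alpha> y)
      = (LINT y:{0<..}|lborel. (1 / pi) * (y powr (d - 1) * (exp (- (y powr \<alpha> * (m + cos (pi * \<alpha>)))) * sin (y powr \<alpha> * sin (pi * \<alpha>)))))"
    by (simp add: stable_kernel_def mult_ac flip: e)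
  also have "\<dots> = (1 / pi) * (LINT y:{0<..}|lborel. y powr (d - 1) * (exp (- (y powr \<alpha> * (m + cos (pi * \<alpha>)))) * sin (y powr \<alpha> * sin (pi * \<alpha>))))"
    by (rule set_integral_mult_right)
  finally show ?thesis unfolding powr_gamma_sin_integral(2)[OF \<alpha> d m] by simp
qed

lemma stable_kernel_arctan_integral:
  fixes \<alpha> m :: real
  assumes \<alpha>: "0 < \<alpha>" and m: "m + cos (pi * \<alpha>) > 0"
  shows "set_integrable lborel {0<..} (\<lambda>y. y powr (- 1) * exp (- (y powr \<alpha> * m)) * stable_kernel \<alpha> y)"
    and "(LINT y:{0<..}|lborel. y powr (- 1) * exp (- (y powr \<alpha> * m)) * stable_kernel \<alpha> y)
     = arctan (sin (pi * \<alpha>) / (m + cos (pi * \<alpha>))) / (pi * \<alpha>)"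
proof -
  let ?F = "\<lambda>y. y powr (- 1) * (exp (- (y powr \<alpha> * (m + cos (pi * \<alpha>)))) * sin (y powr \<alpha> * sin (pi * \<alpha>)))"
  have e: "exp (- (q * m)) * exp (- (q * c)) = exp (- (q * (m + c)))" for q c :: real
    by (simp add: algebra_simps flip: exp_add)
  have eq: "y powr (- 1) * exp (- (y powr \<alpha> * m)) * stable_kernel \<alpha> y = (1 / pi) * ?F y" for y
    unfolding e[symmetric] stable_kernel_def by (simp only: divide_inverse mult_ac mult_1_left)
  note F = powr_inverse_sin_integral[OF \<alpha> m, of "sin (pi * \<alpha>)"]
  show "set_integrable lborel {0<..} (\<lambda>y. y powr (- 1) * exp (- (y powr \<alpha> * m)) * stable_kernel \<alpha> y)"
    unfolding eq by (intro set_integrable_mult_right impI F(1))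
  show "(LINT y:{0<..}|lborel. y powr (- 1) * exp (- (y powr \<alpha> * m)) * stable_kernel \<alpha> y)
     = arctan (sin (pi * \<alpha>) / (m + cos (pi * \<alpha>))) / (pi * \<alpha>)"
    unfolding eq set_integral_mult_right F(2) by simp
qed

text \<open>
  De Moivre's formula for a complex number in the right half plane.
\<close>

lemma Im_Complex_power_eq_sin_arctan:
  fixes A B :: real and k :: nat
  assumes A: "A > 0"
  shows "Im (Complex A B ^ k) = (A\<^sup>2 + B\<^sup>2) powr (real k / 2) * sin (real k * arctan (B / A))"
proof -
  let ?z = "Complex A B"
  have r: "A\<^sup>2 + B\<^sup>2 > 0" using A by (simp add: add_pos_nonneg)
  have "Arg ?z = arctan (B / A)" using arg_conv_arctan[of ?z] A by simp
  then have "?z = rcis (norm ?z) (arctan (B / A))" using rcis_cmod_Arg[of ?z] by simp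
  then have "?z ^ k = rcis (norm ?z ^ k) (real k * arctan (B / A))"
    by (metis DeMoivre2)
  moreover have "norm ?z ^ k = (A\<^sup>2 + B\<^sup>2) powr (real k / 2)"

  proof -
    have "norm ?z ^ k = ((A\<^sup>2 + B\<^sup>2) powr (1 / 2)) powr real k"
      using r by (simp add: cmod_def powr_half_sqrt powr_realpow)
    then show ?thesis unfolding powr_powr by simp
  qed
  ultimately show ?thesis by simp
qed

lemma Im_Complex_power_binomial:
  fixes A B :: real
  shows "Im (Complex A B ^ k) = (\<Sum>j=0..k. real (k choose j) * sin (pi / 2 * real (k - j)) * (A ^ j * B ^ (k - j)))"
proof -
  have "Complex A B = of_real A + \<i> * of_real B" by (simp add: complex_eq_iff)
  then have "Complex A B ^ k = (\<Sum>j\<le>k. of_nat (k choose j) * of_real A ^ j * (\<i> * of_real B) ^ (k - j))"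
    by (simp add: binomial_ring)
  also have "\<dots> = (\<Sum>j\<le>k. of_real (real (k choose j) * A ^ j * B ^ (k - j)) * \<i> ^ (k - j))"
    by (intro sum.cong) (simp_all add: power_mult_distrib mult_ac)
  finally have pow: "Complex A B ^ k = (\<Sum>j\<le>k. of_real (real (k choose j) * A ^ j * B ^ (k - j)) * \<i> ^ (k - j))" .
  have Im_mult: "Im (of_real r * z) = r * Im z" for r z by simp
  have "Im (Complex A B ^ k) = (\<Sum>j\<le>k. real (k choose j) * A ^ j * B ^ (k - j) * Im (\<i> ^ (k - j)))"
    unfolding pow by (simp only: Im_sum Im_mult)
  moreover have im: "Im (\<i> ^ m) = sin (pi / 2 * real m)" for m
  proof -
    have "\<i> ^ m = cis (real m * (pi / 2))" using Complex.DeMoivre[of "pi / 2" m] by (simp only: cis_pi_half)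
    then show ?thesis by (simp add: mult.commute)
  qed
  ultimately show ?thesis by (simp only: im atMost_atLeast0 mult_ac)
qed

section \<open>Pairing a stable density with a Laplace transform\<close>

locale positive_stable =
  fixes \<alpha> :: real and f :: "real \<Rightarrow> real"
  assumes alpha: "0 < \<alpha>" "\<alpha> < 1" and density: "stable_density \<alpha> f"
begin

lemma f_measurable[measurable]: "f \<in> borel_measurable borel"
  and f_nonneg[simp]: "0 \<le> f t"
  and f_zero: "t \<le> 0 \<Longrightarrow> f t = 0"
  using density by (auto simp: stable_density_def)

lemma prob: "prob_space (density lborel (\<lambda>t. ennreal (f t)))"
  using density by (simp add: stable_density_def positive_stable_law_def)

lemma laplace:
  assumes s: "s \<ge> 0"
  shows "integrable lborel (\<lambda>t. f t * exp (- (t * s)))"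
    and "(LINT t|lborel. f t * exp (- (t * s))) = exp (- (s powr \<alpha>))"
    and "(\<integral>\<^sup>+t. ennreal (f t) * ennreal (exp (- (t * s))) \<partial>lborel) = ennreal (exp (- (s powr \<alpha>)))"
proof -
  interpret prob_space "density lborel (\<lambda>t. ennreal (f t))" by (rule prob)
  have pos: "AE t in density lborel (\<lambda>t. ennreal (f t)). 0 < t"
    using density by (simp add: stable_density_def positive_stable_law_def)
  have "integrable (density lborel (\<lambda>t. ennreal (f t))) (\<lambda>t. exp (- s * t))"
    by (rule integrable_const_bound[where B=1]) (use pos s in \<open>auto elim!: eventually_mono\<close>)
  then show i: "integrable lborel (\<lambda>t. f t * exp (- (t * s)))"
    by (subst (asm) integrable_density) (auto simp: mult.commute)
  have "(LINT t|density lborel (\<lambda>t. ennreal (f t)). exp (- s * t)) = exp (- (s powr \<alpha>))"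
    using density s by (simp add: stable_density_def positive_stable_law_def)
  then show l: "(LINT t|lborel. f t * exp (- (t * s))) = exp (- (s powr \<alpha>))"
    by (subst (asm) integral_density) (auto simp: mult.commute)
  have "(\<integral>\<^sup>+t. ennreal (f t) * ennreal (exp (- (t * s))) \<partial>lborel) = (\<integral>\<^sup>+t. ennreal (f t * exp (- (t * s))) \<partial>lborel)"
    by (simp add: ennreal_mult)
  also have "\<dots> = ennreal (exp (- (s powr \<alpha>)))"
    unfolding l[symmetric] by (rule nn_integral_eq_integral[OF i]) simp
  finally show "(\<integral>\<^sup>+t. ennreal (f t) * ennreal (exp (- (t * s))) \<partial>lborel) = ennreal (exp (- (s powr \<alpha>)))" .
qed

lemma f_indicator: "indicator {0<..} t * (f t * x) = f t * x" for x :: real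
  using f_zero[of t] by (auto simp: indicator_def)

lemma inversion: "AE t in lborel. t > 0 \<longrightarrow> f t = stable_inversion \<alpha> t"
proof (rule stable_density_eq_laplace_kernel[OF alpha f_measurable])
  fix s :: real assume s: "s > 0"
  have eq: "indicat_real {0<..} t *\<^sub>R (exp (- (s * t)) * f t) = f t * exp (- (t * s))" for t
    using f_indicator[of t "exp (- (t * s))"] by (simp add: mult_ac)
  show "set_integrable lborel {0<..} (\<lambda>t. exp (- (s * t)) * f t)"
    unfolding set_integrable_def eq using laplace(1)[of s] s by simp
  show "(LINT t:{0<..}|lborel. exp (- (s * t)) * f t) = exp (- (s powr \<alpha>))"
    unfolding set_lebesgue_integral_def eq using laplace(2)[of s] s by simp
qed

lemma inversion_kernel: "AE t in lborel. t > 0 \<longrightarrow> f t = (LINT y:{0<..}|lborel. exp (- (t * y)) * stable_kernel \<alpha> y)"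
  using inversion by eventually_elim (use stable_inversion_eq_laplace_kernel[OF alpha] in auto)

text \<open>
  Fubini, after \<open>f\<close> has been replaced by its representation in terms of the kernel. The transform \<open>W\<close>
  takes extended values; by \<open>fin\<close> the value \<open>\<infinity>\<close> occurs, up to a null set, only at zeros of the kernel.
\<close>

lemma pairing:
  fixes w :: "real \<Rightarrow> real" and W :: "real \<Rightarrow> ennreal"
  assumes [measurable]: "w \<in> borel_measurable borel" and w: "\<And>t. t > 0 \<Longrightarrow> 0 \<le> w t"
    and W: "\<And>y. y > 0 \<Longrightarrow> (\<integral>\<^sup>+t. indicator {0<..} t * ennreal (w t * exp (- (t * y))) \<partial>lborel) = W y"
    and fin: "(\<integral>\<^sup>+y. indicator {0<..} y * (W y * ennreal \<bar>stable_kernel \<alpha> y\<bar>) \<partial>lborel) < \<infinity>"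
  shows "(LINT t:{0<..}|lborel. w t * f t) = (LINT y:{0<..}|lborel. enn2real (W y) * stable_kernel \<alpha> y)"
proof -
  let ?F = "\<lambda>y t. indicat_real {0<..} y *\<^sub>R (indicat_real {0<..} t *\<^sub>R (w t * exp (- (t * y)) * stable_kernel \<alpha> y))"
  have F: "(\<lambda>(y, t). ?F y t) \<in> borel_measurable (lborel \<Otimes>\<^sub>M lborel)" by measurable
  have "(\<integral>\<^sup>+y. \<integral>\<^sup>+t. ennreal (norm (?F y t)) \<partial>lborel \<partial>lborel)
      = (\<integral>\<^sup>+y. indicator {0<..} y * (W y * ennreal \<bar>stable_kernel \<alpha> y\<bar>) \<partial>lborel)"
  proof (rule nn_integral_cong)
    fix y :: real
    show "(\<integral>\<^sup>+t. ennreal (norm (?F y t)) \<partial>lborel) = indicator {0<..} y * (W y * ennreal \<bar>stable_kernel \<alpha> y\<bar>)"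
    proof (cases "y > 0")
      case True
      have "(\<integral>\<^sup>+t. ennreal (norm (?F y t)) \<partial>lborel)
          = (\<integral>\<^sup>+t. (indicator {0<..} t * ennreal (w t * exp (- (t * y)))) * ennreal \<bar>stable_kernel \<alpha> y\<bar> \<partial>lborel)"
        using True w by (intro nn_integral_cong) (auto simp: indicator_def abs_mult simp flip: ennreal_mult)
      also have "\<dots> = W y * ennreal \<bar>stable_kernel \<alpha> y\<bar>"
        by (subst nn_integral_multc) (auto simp: W[OF True])
      finally show ?thesis using True by simp
    qed simp
  qed
  then have fin': "(\<integral>\<^sup>+y. \<integral>\<^sup>+t. ennreal (norm (?F y t)) \<partial>lborel \<partial>lborel) < \<infinity>" using fin by simp
  note fub = fubini_lborel[OF F fin']
  have 1: "(LINT t|lborel. ?F y t) = indicat_real {0<..} y *\<^sub>R (enn2real (W y) * stable_kernel \<alpha> y)" for y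
  proof (cases "y > 0")
    case True
    have "enn2real (W y) = (LINT t|lborel. indicat_real {0<..} t *\<^sub>R (w t * exp (- (t * y))))"
    proof (subst integral_eq_nn_integral)
      have "(\<integral>\<^sup>+t. ennreal (indicat_real {0<..} t *\<^sub>R (w t * exp (- (t * y)))) \<partial>lborel)
        = (\<integral>\<^sup>+t. indicator {0<..} t * ennreal (w t * exp (- (t * y))) \<partial>lborel)"
        by (intro nn_integral_cong) (auto simp: indicator_def)
      then show "enn2real (W y) = enn2real (\<integral>\<^sup>+t. ennreal (indicat_real {0<..} t *\<^sub>R (w t * exp (- (t * y)))) \<partial>lborel)"
        using W[OF True] by simp
    qed (use w in \<open>auto simp: indicator_def\<close>)
    moreover have "(LINT t|lborel. ?F y t) = (LINT t|lborel. indicat_real {0<..} t *\<^sub>R (w t * exp (- (t * y))) * stable_kernel \<alpha> y)"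
      using True by (intro Bochner_Integration.integral_cong) auto
    ultimately show ?thesis using True by simp
  qed simp
  have "(LINT t:{0<..}|lborel. w t * f t) = (LINT t|lborel. LINT y|lborel. ?F y t)"
    unfolding set_lebesgue_integral_def
  proof (rule integral_cong_AE)
    show "AE t in lborel. indicat_real {0<..} t *\<^sub>R (w t * f t) = (LINT y|lborel. ?F y t)"
      using inversion_kernel
    proof eventually_elim
      case (elim t)
      show ?case
      proof (cases "t > 0")
        case True
        then have "f t = (LINT y|lborel. indicat_real {0<..} y *\<^sub>R (exp (- (t * y)) * stable_kernel \<alpha> y))"
          using elim by (simp add: set_lebesgue_integral_def)
        then have "w t * f t = (LINT y|lborel. w t * (indicat_real {0<..} y *\<^sub>R (exp (- (t * y)) * stable_kernel \<alpha> y)))"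
          by simp
        also have "\<dots> = (LINT y|lborel. ?F y t)"
          using True by (intro Bochner_Integration.integral_cong) auto
        finally show ?thesis using True by simp
      qed simp
    qed
    show "(\<lambda>t. LINT y|lborel. ?F y t) \<in> borel_measurable lborel"
      using fub(3) by (rule borel_measurable_integrable)
  qed measurable
  also have "\<dots> = (LINT y|lborel. LINT t|lborel. ?F y t)" by (rule fub(1)[symmetric])
  finally show ?thesis unfolding 1 set_lebesgue_integral_def .
qed

section \<open>The ratio of two independent stable variables\<close>

lemma one_less_powr_neg_alpha:
  assumes "0 < x" "x < 1"
  shows "1 < x powr (- \<alpha>)"
proof -
  have "x powr \<alpha> < 1 powr \<alpha>" using assms alpha by (intro powr_less_mono2) auto
  then show ?thesis using assms by (simp add: powr_minus field_simps)
qed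

lemma x_powr_plus_cos_pos:
  assumes x: "0 < x" "x < 1"
  shows "x powr (- \<alpha>) + cos (pi * \<alpha>) > 0"
  using one_less_powr_neg_alpha[OF x] stable_cos_abs_less_1(1)[OF alpha] by linarith

text \<open>
  Differentiation of the Laplace transform under the integral sign. The difference quotients are
  dominated by \<open>f t / v\<close>, since \<open>t * exp (- t * v) \<le> 1 / v\<close>.
\<close>

lemma laplace_derivative:
  assumes v: "v > 0"
  shows "(\<integral>\<^sup>+t. ennreal (t * f t * exp (- (t * v))) \<partial>lborel) = ennreal (\<alpha> * v powr (\<alpha> - 1) * exp (- (v powr \<alpha>)))"
proof -
  define h where "h n = 1 / real (Suc n)" for n
  have h: "h n > 0" for n by (simp add: h_def)
  have h0: "h \<longlonglongrightarrow> 0" unfolding h_def by (rule LIMSEQ_Suc[OF lim_inverse_n'])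
  have hr: "filterlim h (at 0) sequentially"
    unfolding filterlim_at using h h0 by (auto intro!: always_eventually simp: less_imp_neq[OF h, symmetric])
  let ?Q = "\<lambda>n t. f t * ((exp (- (t * v)) - exp (- (t * (v + h n)))) / h n)"
  have te: "t * exp (- (t * v)) \<le> 1 / v" for t
  proof -
    have "t * v \<le> exp (t * v)" using exp_ge_add_one_self[of "t * v"] by linarith
    then show ?thesis using v by (simp add: exp_minus field_simps)
  qed
  have "integrable lborel f" using laplace(1)[of 0] by simp
  then have iw: "integrable lborel (\<lambda>t. f t * (1 / v))" by simp
  have bound: "norm (?Q n t) \<le> f t * (1 / v)" for n t
  proof (cases "t > 0")
    case True
    have e: "exp (- (t * v)) - exp (- (t * (v + h n))) = exp (- (t * v)) * (1 - exp (- (t * h n)))"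
      by (simp add: algebra_simps flip: exp_add)
    have "1 - exp (- (t * h n)) \<le> t * h n" using exp_ge_add_one_self[of "- (t * h n)"] by linarith
    moreover have "1 - exp (- (t * h n)) \<ge> 0" using True h[of n] by simp
    ultimately have "\<bar>exp (- (t * v)) - exp (- (t * (v + h n)))\<bar> \<le> exp (- (t * v)) * (t * h n)"
      unfolding e abs_mult by (intro mult_mono) auto
    then have "\<bar>(exp (- (t * v)) - exp (- (t * (v + h n)))) / h n\<bar> \<le> t * exp (- (t * v))"
      using h[of n] by (simp add: field_simps)
    also note te
    finally have "f t * \<bar>(exp (- (t * v)) - exp (- (t * (v + h n)))) / h n\<bar> \<le> f t * (1 / v)"
      by (rule mult_left_mono) simp
    then show ?thesis using f_nonneg[of t] by (simp only: real_norm_def abs_mult abs_of_nonneg)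
  qed (simp add: f_zero)
  have lim: "(\<lambda>n. ?Q n t) \<longlonglongrightarrow> f t * (t * exp (- (t * v)))" for t
  proof -
    have "DERIV (\<lambda>u. - exp (- (t * u))) v :> t * exp (- (t * v))"
      by (auto intro!: derivative_eq_intros)
    then have "((\<lambda>d. (- exp (- (t * (v + d))) - - exp (- (t * v))) / d) \<longlongrightarrow> t * exp (- (t * v))) (at 0)"
      by (simp add: DERIV_def)
    from filterlim_compose[OF this hr] show ?thesis
      by (intro tendsto_mult_left) (simp add: algebra_simps)
  qed
  have iD: "integrable lborel (\<lambda>t. f t * (t * exp (- (t * v))))"
    by (rule integrable_dominated_convergence[where s="?Q" and w="\<lambda>t. f t * (1 / v)"]) (use iw lim bound in auto)
  have lD: "(\<lambda>n. LINT t|lborel. ?Q n t) \<longlonglongrightarrow> (LINT t|lborel. f t * (t * exp (- (t * v))))"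
    by (rule integral_dominated_convergence[where w="\<lambda>t. f t * (1 / v)"]) (use iw lim bound in auto)
  have eqn: "(LINT t|lborel. ?Q n t) = (exp (- (v powr \<alpha>)) - exp (- ((v + h n) powr \<alpha>))) / h n" for n
  proof -
    have "(LINT t|lborel. ?Q n t) = (LINT t|lborel. (f t * exp (- (t * v)) - f t * exp (- (t * (v + h n)))) / h n)"
      by (simp add: right_diff_distrib)
    also have "\<dots> = (exp (- (v powr \<alpha>)) - exp (- ((v + h n) powr \<alpha>))) / h n"
      using laplace(1,2)[of v] laplace(1,2)[of "v + h n"] v h[of n] by simp
    finally show ?thesis .
  qed
  have "(\<lambda>n. (exp (- (v powr \<alpha>)) - exp (- ((v + h n) powr \<alpha>))) / h n) \<longlonglongrightarrow> \<alpha> * v powr (\<alpha> - 1) * exp (- (v powr \<alpha>))"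
  proof -
    have "DERIV (\<lambda>u. - exp (- (u powr \<alpha>))) v :> \<alpha> * v powr (\<alpha> - 1) * exp (- (v powr \<alpha>))"
      using v by (auto intro!: derivative_eq_intros)
    then have "((\<lambda>d. (- exp (- ((v + d) powr \<alpha>)) - - exp (- (v powr \<alpha>))) / d) \<longlongrightarrow> \<alpha> * v powr (\<alpha> - 1) * exp (- (v powr \<alpha>))) (at 0)"
      by (simp add: DERIV_def)
    from filterlim_compose[OF this hr] show ?thesis by simp
  qed
  then have eq: "(LINT t|lborel. f t * (t * exp (- (t * v)))) = \<alpha> * v powr (\<alpha> - 1) * exp (- (v powr \<alpha>))"
    using lD unfolding eqn by (rule LIMSEQ_unique[rotated])
  have nn: "0 \<le> f t * (t * exp (- (t * v)))" for t using f_zero[of t] by (cases "t > 0") auto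
  have "(\<integral>\<^sup>+t. ennreal (t * f t * exp (- (t * v))) \<partial>lborel) = (\<integral>\<^sup>+t. ennreal (f t * (t * exp (- (t * v)))) \<partial>lborel)"
    by (simp add: mult_ac)
  also have "\<dots> = ennreal (LINT t|lborel. f t * (t * exp (- (t * v))))"
    by (rule nn_integral_eq_integral[OF iD]) (simp add: nn)
  finally show ?thesis unfolding eq .
qed

text \<open>
  This number is the density at 1 of the ratio of two independent stable variables.
\<close>

lemma integral_t_f_squared:
  "(LINT t:{0<..}|lborel. t powr 1 * f t * f t) = sin (pi * \<alpha>) / (2 * pi * (1 + cos (pi * \<alpha>)))"
proof -
  let ?c = "cos (pi * \<alpha>)" and ?s = "sin (pi * \<alpha>)"
  let ?R = "((1 + ?c)\<^sup>2 + ?s\<^sup>2)"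
  have c: "\<bar>?c\<bar> < 1" by (rule stable_cos_abs_less_1[OF alpha])
  define W where "W y = ennreal (\<alpha> * y powr (\<alpha> - 1) * exp (- (y powr \<alpha>)))" for y
  have "(LINT t:{0<..}|lborel. t powr 1 * f t * f t) = (LINT t:{0<..}|lborel. (t * f t) * f t)"
    by (rule set_lebesgue_integral_cong) auto
  also have "\<dots> = (LINT y:{0<..}|lborel. enn2real (W y) * stable_kernel \<alpha> y)"
  proof (rule pairing)
    fix y :: real assume y: "y > 0"
    have "(\<integral>\<^sup>+t. indicator {0<..} t * ennreal (t * f t * exp (- (t * y))) \<partial>lborel) = (\<integral>\<^sup>+t. ennreal (t * f t * exp (- (t * y))) \<partial>lborel)"
      by (intro nn_integral_cong) (auto simp: indicator_def f_zero)
    then show "(\<integral>\<^sup>+t. indicator {0<..} t * ennreal (t * f t * exp (- (t * y))) \<partial>lborel) = W y"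
      unfolding W_def laplace_derivative[OF y] .
  next
    have "(\<integral>\<^sup>+y. indicator {0<..} y * (W y * ennreal \<bar>stable_kernel \<alpha> y\<bar>) \<partial>lborel)
        \<le> (\<integral>\<^sup>+y. ennreal \<alpha> * (indicator {0<..} y * ennreal (y powr (\<alpha> - 1) * exp (- (y powr \<alpha> * (1 - \<bar>?c\<bar>))))) \<partial>lborel)"
    proof (rule nn_integral_mono)
      fix y :: real
      have "exp (- (y powr \<alpha>)) * \<bar>stable_kernel \<alpha> y\<bar> \<le> exp (- (y powr \<alpha>)) * exp (\<bar>?c\<bar> * y powr \<alpha>)"
        by (intro mult_left_mono stable_kernel_abs_le(1)) auto
      also have "\<dots> = exp (- (y powr \<alpha> * (1 - \<bar>?c\<bar>)))" by (simp add: algebra_simps flip: exp_add)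
      finally have "\<alpha> * y powr (\<alpha> - 1) * (exp (- (y powr \<alpha>)) * \<bar>stable_kernel \<alpha> y\<bar>) \<le> \<alpha> * y powr (\<alpha> - 1) * exp (- (y powr \<alpha> * (1 - \<bar>?c\<bar>)))"
        using alpha by (intro mult_left_mono) auto
      then show "indicator {0<..} y * (W y * ennreal \<bar>stable_kernel \<alpha> y\<bar>) \<le> ennreal \<alpha> * (indicator {0<..} y * ennreal (y powr (\<alpha> - 1) * exp (- (y powr \<alpha> * (1 - \<bar>?c\<bar>)))))"
        using alpha by (auto simp: W_def indicator_def mult_ac simp flip: ennreal_mult intro!: ennreal_leI)
    qed
    also have "\<dots> < \<infinity>"
      using powr_gamma_nn_integral(2)[OF alpha(1) alpha(1), of "1 - \<bar>?c\<bar>"] c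
      by (subst nn_integral_cmult) (auto simp: ennreal_mult_less_top)
    finally show "(\<integral>\<^sup>+y. indicator {0<..} y * (W y * ennreal \<bar>stable_kernel \<alpha> y\<bar>) \<partial>lborel) < \<infinity>" .
  qed auto
  also have "\<dots> = (LINT y:{0<..}|lborel. \<alpha> * (y powr (\<alpha> - 1) * exp (- (y powr \<alpha> * 1)) * stable_kernel \<alpha> y))"
    using alpha by (simp add: W_def mult_ac)
  also have "\<dots> = \<alpha> * (LINT y:{0<..}|lborel. y powr (\<alpha> - 1) * exp (- (y powr \<alpha> * 1)) * stable_kernel \<alpha> y)"
    by (rule set_integral_mult_right)
  also have "(LINT y:{0<..}|lborel. y powr (\<alpha> - 1) * exp (- (y powr \<alpha> * 1)) * stable_kernel \<alpha> y)
     = Gamma (\<alpha> / \<alpha>) / (pi * \<alpha>) * ?R powr (- \<alpha> / (2 * \<alpha>)) * sin (\<alpha> / \<alpha> * arctan (?s / (1 + ?c)))"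
    by (rule stable_kernel_gamma_integral) (use alpha c in auto)
  also have "\<alpha> * \<dots> = ?R powr (- 1 / 2) * sin (arctan (?s / (1 + ?c))) / pi"
    using alpha by simp
  also have "\<dots> = ?s / ?R / pi"
  proof -
    have r: "(1 + ?c)\<^sup>2 + ?s\<^sup>2 > 0" using c by (intro add_pos_nonneg) auto
    have "?s = ?R powr (1 / 2) * sin (arctan (?s / (1 + ?c)))"
      using Im_Complex_power_eq_sin_arctan[of "1 + ?c" ?s 1] c by simp
    then have "?s / ?R = ?R powr (1 / 2) / ?R powr 1 * sin (arctan (?s / (1 + ?c)))"
      using r by simp
    also have "?R powr (1 / 2) / ?R powr 1 = ?R powr (1 / 2 - 1)"
      by (rule powr_diff[symmetric])
    also have "(1 / 2 - 1 :: real) = - 1 / 2" by simp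
    finally show ?thesis by simp
  qed
  also have "(1 + ?c)\<^sup>2 + ?s\<^sup>2 = 2 * (1 + ?c)"
    using sin_cos_squared_add[of "pi * \<alpha>"] by (simp add: power2_eq_square algebra_simps)
  finally show ?thesis by (simp add: mult_ac)
qed

text \<open>
  The pairing is applied to \<open>w t = P (S \<le> x * t)\<close>, whose Laplace transform is
  \<open>exp (- (v / x) powr \<alpha>) / v\<close>. The condition \<open>x < 1\<close> makes \<open>x powr (- \<alpha>) + c\<close> positive for
  all \<open>\<alpha>\<close>, which the convergence of the resulting integral requires.
\<close>

lemma ratio_cdf_eq_arctan:
  assumes x: "0 < x" "x < 1"
  shows "ratio_cdf f x = arctan (sin (pi * \<alpha>) / (x powr (- \<alpha>) + cos (pi * \<alpha>))) / (pi * \<alpha>)"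
proof -
  let ?W = "\<lambda>v. ennreal (v powr (- 1) * exp (- (v powr \<alpha> * x powr (- \<alpha>))))"
  let ?C = "\<lambda>v t s. ennreal (f s) * (indicator {0<..} t * ((if s \<le> x * t then 1 else 0) * ennreal (exp (- (t * v)))))"
  let ?c = "cos (pi * \<alpha>)" and ?s = "sin (pi * \<alpha>)"
  define M where "M = density lborel (\<lambda>t. ennreal (f t))"
  interpret M: prob_space M unfolding M_def by (rule prob)
  interpret MM: pair_prob_space M M ..
  have sM[measurable_cong]: "sets M = sets borel" by (simp add: M_def)
  have spM: "space M = UNIV" by (simp add: M_def)
  define w where "w t = measure M {..x * t}" for t
  have ew: "ennreal (w t) = (\<integral>\<^sup>+s. ennreal (f s) * (if s \<le> x * t then 1 else 0) \<partial>lborel)" for t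
    unfolding w_def M.emeasure_eq_measure[symmetric] by (simp add: M_def emeasure_density) (auto intro!: nn_integral_cong)
  have [measurable]: "w \<in> borel_measurable borel"
  proof -
    have "mono w" unfolding w_def by (intro monoI M.finite_measure_mono) (use x in \<open>auto simp: sM\<close>)
    then show ?thesis by (rule borel_measurable_mono)
  qed
  have mc: "x powr (- \<alpha>) + ?c > 0" by (rule x_powr_plus_cos_pos[OF x])
  have w0: "0 \<le> w t" for t by (simp add: w_def)
  have "{p \<in> space (M \<Otimes>\<^sub>M M). fst p / snd p \<le> x} \<in> sets (M \<Otimes>\<^sub>M M)" by measurable
  then have set[measurable]: "{p. fst p / snd p \<le> x} \<in> sets (M \<Otimes>\<^sub>M M)"
    by (simp add: space_pair_measure spM)
  have "ratio_cdf f x = enn2real (emeasure (M \<Otimes>\<^sub>M M) {p. fst p / snd p \<le> x})"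
    unfolding ratio_cdf_def Let_def cdf_def M_def[symmetric]
    by (subst measure_distr) (auto simp: measure_def space_pair_measure spM vimage_def case_prod_beta intro!: arg_cong[where f="\<lambda>A. enn2real (emeasure _ A)"])
  also have "emeasure (M \<Otimes>\<^sub>M M) {p. fst p / snd p \<le> x} = (\<integral>\<^sup>+t. emeasure M {s. s / t \<le> x} \<partial>M)"
    by (subst MM.emeasure_pair_measure_alt2[OF set]) (auto simp: vimage_def)
  also have "\<dots> = (\<integral>\<^sup>+t. ennreal (f t) * emeasure M {s. s / t \<le> x} \<partial>lborel)"
  proof -
    have "(\<lambda>t. emeasure M {s. s / t \<le> x}) \<in> borel_measurable borel"
      using MM.measurable_emeasure_Pair2[OF set] by (simp add: vimage_def cong: measurable_cong_sets)
    then show ?thesis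
      using nn_integral_density[of "\<lambda>t. ennreal (f t)" lborel "\<lambda>t. emeasure M {s. s / t \<le> x}"]
      by (simp add: M_def[symmetric])
  qed
  also have "\<dots> = (\<integral>\<^sup>+t. ennreal (indicat_real {0<..} t *\<^sub>R (w t * f t)) \<partial>lborel)"
  proof (rule nn_integral_cong)
    fix t :: real
    show "ennreal (f t) * emeasure M {s. s / t \<le> x} = ennreal (indicat_real {0<..} t *\<^sub>R (w t * f t))"
    proof (cases "t > 0")
      case True
      then have "{s. s / t \<le> x} = {..x * t}" by (auto simp: field_simps)
      then show ?thesis using True by (simp add: w_def M.emeasure_eq_measure ennreal_mult mult.commute)
    qed (simp add: f_zero)
  qed
  also have "enn2real \<dots> = (LINT t:{0<..}|lborel. w t * f t)"
    unfolding set_lebesgue_integral_def by (rule integral_eq_nn_integral[symmetric]) (auto simp: w0)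
  also have "\<dots> = (LINT v:{0<..}|lborel. enn2real (?W v) * stable_kernel \<alpha> v)"
  proof (rule pairing)
    fix v :: real assume v: "v > 0"
    have expo: "(\<integral>\<^sup>+t. indicator {0<..} t * ((if s \<le> x * t then 1 else 0) * ennreal (exp (- (t * v)))) \<partial>lborel) = ennreal (1 / v) * ennreal (exp (- (s * (v / x))))"
      if s: "s > 0" for s
    proof -
      have "(\<integral>\<^sup>+t. indicator {0<..} t * ((if s \<le> x * t then 1 else 0) * ennreal (exp (- (t * v)))) \<partial>lborel)
         = (\<integral>\<^sup>+m. indicator {0<..} (s / x + m) * ((if s \<le> x * (s / x + m) then 1 else 0) * ennreal (exp (- ((s / x + m) * v)))) \<partial>lborel)"
        by (subst nn_integral_real_affine[where c=1 and t="s / x"]) auto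
      also have "\<dots> = (\<integral>\<^sup>+m. (indicator {0<..} m * ennreal (m powr (1 - 1) * exp (- (m powr 1 * v)))) * ennreal (exp (- (s * (v / x)))) \<partial>lborel)"
      proof (rule nn_integral_cong_AE)
        show "AE m in lborel. indicator {0<..} (s / x + m) * ((if s \<le> x * (s / x + m) then 1 else 0) * ennreal (exp (- ((s / x + m) * v))))
          = (indicator {0<..} m * ennreal (m powr (1 - 1) * exp (- (m powr 1 * v)))) * ennreal (exp (- (s * (v / x))))"
          using AE_lborel_singleton[of 0]
        proof eventually_elim
          case (elim m)
          have p: "s / x > 0" using s x by simp
          have q: "x * (s / x + m) = s + x * m" using x by (simp add: field_simps)
          have e: "exp (- ((s / x + m) * v)) = exp (- (m * v)) * exp (- (s * (v / x)))"
            by (simp add: algebra_simps flip: exp_add)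
          show ?case
          proof (cases "m > 0")
            case True
            then have "s / x + m > 0" "s \<le> s + x * m" using p x by (auto intro: add_pos_pos)
            then show ?thesis using True unfolding q e by (simp add: ennreal_mult)
          next
            case False
            then have "x * m < 0" using elim x by (simp add: mult_pos_neg)
            then show ?thesis using False unfolding q by simp
          qed
        qed
      qed
      also have "\<dots> = ennreal (1 / v) * ennreal (exp (- (s * (v / x))))"
        by (subst nn_integral_multc, measurable, subst powr_gamma_nn_integral(2)) (use v in \<open>auto simp: powr_minus inverse_eq_divide\<close>)
      finally show ?thesis .
    qed
    have "(\<integral>\<^sup>+t. indicator {0<..} t * ennreal (w t * exp (- (t * v))) \<partial>lborel)
        = (\<integral>\<^sup>+t. \<integral>\<^sup>+s. ?C v t s \<partial>lborel \<partial>lborel)"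
    proof (rule nn_integral_cong)
      fix t :: real
      have "indicator {0<..} t * ennreal (w t * exp (- (t * v))) = (\<integral>\<^sup>+s. ennreal (f s) * (if s \<le> x * t then 1 else 0) \<partial>lborel) * (indicator {0<..} t * ennreal (exp (- (t * v))))"
        unfolding ew[symmetric] by (simp add: ennreal_mult w_def mult_ac)
      also have "\<dots> = (\<integral>\<^sup>+s. (ennreal (f s) * (if s \<le> x * t then 1 else 0)) * (indicator {0<..} t * ennreal (exp (- (t * v)))) \<partial>lborel)"
        by (rule nn_integral_multc[symmetric]) measurable
      finally show "indicator {0<..} t * ennreal (w t * exp (- (t * v))) = (\<integral>\<^sup>+s. ?C v t s \<partial>lborel)"
        by (simp add: mult_ac)
    qed
    also have "\<dots> = (\<integral>\<^sup>+s. \<integral>\<^sup>+t. ?C v t s \<partial>lborel \<partial>lborel)"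
      by (rule lborel_pair.Fubini') measurable
    also have "\<dots> = (\<integral>\<^sup>+s. ennreal (1 / v) * (ennreal (f s) * ennreal (exp (- (s * (v / x))))) \<partial>lborel)"
    proof (rule nn_integral_cong)
      fix s :: real
      show "(\<integral>\<^sup>+t. ?C v t s \<partial>lborel) = ennreal (1 / v) * (ennreal (f s) * ennreal (exp (- (s * (v / x)))))"
      proof (cases "s > 0")
        case True
        show ?thesis
          by (subst nn_integral_cmult, measurable, subst expo[OF True]) (simp add: mult_ac)
      qed (simp add: f_zero)
    qed
    also have "\<dots> = ennreal (1 / v) * ennreal (exp (- ((v / x) powr \<alpha>)))"
      by (subst nn_integral_cmult, measurable, subst laplace(3)) (use v x in auto)
    also have "\<dots> = ?W v"
      using v x by (simp add: powr_divide powr_minus_divide flip: ennreal_mult)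
    finally show "(\<integral>\<^sup>+t. indicator {0<..} t * ennreal (w t * exp (- (t * v))) \<partial>lborel) = ?W v" .
  next
    have "(\<integral>\<^sup>+v. indicator {0<..} v * (?W v * ennreal \<bar>stable_kernel \<alpha> v\<bar>) \<partial>lborel)
       = (\<integral>\<^sup>+v. ennreal (norm (indicat_real {0<..} v *\<^sub>R (v powr (- 1) * exp (- (v powr \<alpha> * x powr (- \<alpha>))) * stable_kernel \<alpha> v))) \<partial>lborel)"
      by (intro nn_integral_cong) (auto simp: indicator_def abs_mult simp flip: ennreal_mult)
    also have "\<dots> < \<infinity>"
      using stable_kernel_arctan_integral(1)[OF alpha(1) mc] unfolding set_integrable_def integrable_iff_bounded by blast
    finally show "(\<integral>\<^sup>+v. indicator {0<..} v * (?W v * ennreal \<bar>stable_kernel \<alpha> v\<bar>) \<partial>lborel) < \<infinity>" .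
  qed (auto simp: w0)
  also have "\<dots> = (LINT v:{0<..}|lborel. v powr (- 1) * exp (- (v powr \<alpha> * x powr (- \<alpha>))) * stable_kernel \<alpha> v)"
    by simp
  also have "\<dots> = arctan (?s / (x powr (- \<alpha>) + ?c)) / (pi * \<alpha>)"
    by (rule stable_kernel_arctan_integral(2)[OF alpha(1) mc])
  finally show ?thesis .
qed

section \<open>Normalisation of the mixing density\<close>

lemma f_integrable: "integrable lborel f" and nn_integral_f: "(\<integral>\<^sup>+t. ennreal (f t) \<partial>lborel) = 1"
  using laplace(1)[of 0] laplace(3)[of 0] by simp_all

lemma f_bounded: "\<exists>K>0. AE t in lborel. f t \<le> K"
proof -
  obtain K where K: "K > 0" "\<And>t. \<bar>stable_inversion \<alpha> t\<bar> \<le> K" using stable_inversion_bounded[OF alpha] by blast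
  have "AE t in lborel. f t \<le> K"
    using inversion
  proof eventually_elim
    case (elim t)
    then show ?case using K(1) K(2)[of t] f_zero[of t] by (cases "t > 0") auto
  qed
  with K(1) show ?thesis by blast
qed

text \<open>
  In \<open>f t = \<integral> exp (- t * y) * \<kappa> y dy\<close> large \<open>t\<close> select small \<open>y\<close>, where \<open>\<kappa> y\<close> is of order
  \<open>y powr \<alpha>\<close>.
\<close>

lemma f_tail: "\<exists>C>0. AE t in lborel. t > 2 \<longrightarrow> f t \<le> C * t powr (- 1 - \<alpha>)"
proof -
  define C where "C = exp 1 * Gamma (1 + \<alpha>) * 2 powr (1 + \<alpha>)"
  have G: "Gamma (1 + \<alpha>) > 0" using alpha by (intro Gamma_real_pos) auto
  have C: "C > 0" unfolding C_def using G by simp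
  have ya: "y powr \<alpha> \<le> 1 + y" if "y > 0" for y
  proof (cases "y \<le> 1")
    case True
    then have "y powr \<alpha> \<le> 1 powr \<alpha>" using that alpha by (intro powr_mono2) auto
    then show ?thesis using that by simp
  next
    case False
    then have "y powr \<alpha> \<le> y powr 1" using alpha by (intro powr_mono) auto
    then show ?thesis using that by simp
  qed
  have le: "norm (LINT y:{0<..}|lborel. exp (- (t * y)) * stable_kernel \<alpha> y) \<le> C * t powr (- 1 - \<alpha>)" if t: "t > 2" for t
  proof -
    let ?g = "\<lambda>y. y powr ((1 + \<alpha>) - 1) * exp (- (y powr 1 * (t - 1)))"
    have t1: "t - 1 > 0" and a1: "1 + \<alpha> > 0" using t alpha by auto
    have ig: "integrable lborel (\<lambda>y. exp 1 * (indicat_real {0<..} y *\<^sub>R ?g y))"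
      using powr_gamma_nn_integral(1)[OF zero_less_one a1 t1] unfolding set_integrable_def by (rule integrable_mult_right)
    have b: "norm (indicat_real {0<..} y *\<^sub>R (exp (- (t * y)) * stable_kernel \<alpha> y)) \<le> exp 1 * (indicat_real {0<..} y *\<^sub>R ?g y)" for y
    proof (cases "y > 0")
      case True
      have "\<bar>stable_kernel \<alpha> y\<bar> \<le> y powr \<alpha> * exp (\<bar>cos (pi * \<alpha>)\<bar> * y powr \<alpha>)" by (rule stable_kernel_abs_le(2))
      also have "\<bar>cos (pi * \<alpha>)\<bar> * y powr \<alpha> \<le> 1 * (1 + y)" using ya[OF True] by (intro mult_mono) auto
      finally have "\<bar>stable_kernel \<alpha> y\<bar> \<le> y powr \<alpha> * exp (1 + y)" by (simp add: mult_left_mono)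
      then have "exp (- (t * y)) * \<bar>stable_kernel \<alpha> y\<bar> \<le> exp (- (t * y)) * (y powr \<alpha> * exp (1 + y))" by (rule mult_left_mono) simp
      also have "\<dots> = exp 1 * (y powr \<alpha> * exp (- (y * (t - 1))))"
        by (simp add: algebra_simps flip: exp_add)
      finally show ?thesis using True by (simp add: abs_mult)
    qed simp
    have "norm (LINT y:{0<..}|lborel. exp (- (t * y)) * stable_kernel \<alpha> y) \<le> (LINT y|lborel. norm (indicat_real {0<..} y *\<^sub>R (exp (- (t * y)) * stable_kernel \<alpha> y)))"
      unfolding set_lebesgue_integral_def by (rule integral_norm_bound)
    also have "\<dots> \<le> (LINT y|lborel. exp 1 * (indicat_real {0<..} y *\<^sub>R ?g y))"
      by (rule integral_mono'[OF ig]) (use b in auto)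
    also have "\<dots> = exp 1 * (Gamma (1 + \<alpha>) * (t - 1) powr (- (1 + \<alpha>)))"
    proof -
      have "(LINT y|lborel. indicat_real {0<..} y *\<^sub>R ?g y) = enn2real (\<integral>\<^sup>+y. ennreal (indicat_real {0<..} y *\<^sub>R ?g y) \<partial>lborel)"
        by (rule integral_eq_nn_integral) auto
      also have "(\<integral>\<^sup>+y. ennreal (indicat_real {0<..} y *\<^sub>R ?g y) \<partial>lborel) = (\<integral>\<^sup>+y. indicator {0<..} y * ennreal (?g y) \<partial>lborel)"
        by (intro nn_integral_cong) (auto simp: indicator_def)
      also have "\<dots> = ennreal (Gamma ((1 + \<alpha>) / 1) / 1 * (t - 1) powr (- (1 + \<alpha>) / 1))"
        by (rule powr_gamma_nn_integral(2)[OF zero_less_one a1 t1])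
      finally show ?thesis using G by simp
    qed
    also have "(t - 1) powr (- (1 + \<alpha>)) \<le> (t / 2) powr (- (1 + \<alpha>))"
      using t alpha by (intro powr_mono2') auto
    also have "(t / 2) powr (- (1 + \<alpha>)) = 2 powr (1 + \<alpha>) * t powr (- 1 - \<alpha>)"
      using t by (simp add: powr_divide powr_minus powr_add powr_diff field_simps)
    finally show ?thesis using G by (simp add: C_def mult_ac mult_left_mono)
  qed
  have "AE t in lborel. t > 2 \<longrightarrow> f t \<le> C * t powr (- 1 - \<alpha>)"
    using inversion_kernel
  proof eventually_elim
    case (elim t)
    then show ?case using le[of t] by auto
  qed
  with C show ?thesis by blast
qed

text \<open>
  Integrating the Laplace transform against \<open>s powr (p - 1)\<close> yields \<open>Gamma p\<close> times the moment of
  order \<open>- p\<close>.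
\<close>

lemma negative_moment_finite:
  assumes p: "p > 0"
  shows "integrable lborel (\<lambda>t. t powr (- p) * f t)"
proof (rule integrableI_nonneg)
  have G: "Gamma p > 0" using p by (rule Gamma_real_pos)
  let ?C = "\<lambda>t s. ennreal (f t) * (indicator {0<..} s * ennreal (s powr (p - 1) * exp (- (t * s))))"
  have g: "ennreal (f t) * (\<integral>\<^sup>+s. indicator {0<..} s * ennreal (s powr (p - 1) * exp (- (t * s))) \<partial>lborel) = ennreal (Gamma p) * ennreal (t powr (- p) * f t)" for t
  proof (cases "t > 0")
    case True
    have "(\<integral>\<^sup>+s. indicator {0<..} s * ennreal (s powr (p - 1) * exp (- (t * s))) \<partial>lborel) = (\<integral>\<^sup>+s. indicator {0<..} s * ennreal (s powr (p - 1) * exp (- (s powr 1 * t))) \<partial>lborel)"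
      by (intro nn_integral_cong) (auto simp: indicator_def mult.commute)
    also have "\<dots> = ennreal (Gamma p * t powr (- p))"
      by (subst powr_gamma_nn_integral(2)) (use p True in auto)
    finally show ?thesis using G by (simp add: mult_ac flip: ennreal_mult)
  qed (simp add: f_zero)
  have "ennreal (Gamma p) * (\<integral>\<^sup>+t. ennreal (t powr (- p) * f t) \<partial>lborel)
      = (\<integral>\<^sup>+t. ennreal (Gamma p) * ennreal (t powr (- p) * f t) \<partial>lborel)"
    by (rule nn_integral_cmult[symmetric]) measurable
  also have "\<dots> = (\<integral>\<^sup>+t. \<integral>\<^sup>+s. ?C t s \<partial>lborel \<partial>lborel)"
    unfolding g[symmetric] by (intro nn_integral_cong nn_integral_cmult[symmetric]) measurable
  also have "\<dots> = (\<integral>\<^sup>+s. \<integral>\<^sup>+t. ?C t s \<partial>lborel \<partial>lborel)"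
    by (rule lborel_pair.Fubini') measurable
  also have "\<dots> = (\<integral>\<^sup>+s. indicator {0<..} s * ennreal (s powr (p - 1) * exp (- (s powr \<alpha> * 1))) \<partial>lborel)"
  proof (rule nn_integral_cong)
    fix s :: real
    show "(\<integral>\<^sup>+t. ?C t s \<partial>lborel) = indicator {0<..} s * ennreal (s powr (p - 1) * exp (- (s powr \<alpha> * 1)))"
    proof (cases "s > 0")
      case True
      have "(\<integral>\<^sup>+t. ?C t s \<partial>lborel)
         = (\<integral>\<^sup>+t. ennreal (s powr (p - 1)) * (ennreal (f t) * ennreal (exp (- (t * s)))) \<partial>lborel)"
        using True by (intro nn_integral_cong) (simp add: ennreal_mult mult_ac)
      also have "\<dots> = ennreal (s powr (p - 1)) * ennreal (exp (- (s powr \<alpha>)))"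
        by (subst nn_integral_cmult, measurable, subst laplace(3)) (use True in auto)
      finally show ?thesis using True by (simp add: ennreal_mult)
    qed simp
  qed
  also have "\<dots> < \<infinity>" by (subst powr_gamma_nn_integral(2)) (use alpha p in auto)
  finally show "(\<integral>\<^sup>+t. ennreal (t powr (- p) * f t) \<partial>lborel) < \<infinity>"
    using G by (auto simp: ennreal_mult_less_top)
qed auto

text \<open>
  Near 0 the boundedness of \<open>f\<close> reduces the claim to a negative moment; at infinity the tail bound
  gives \<open>t powr (1 - \<theta>) * f t \<le> C * t powr (- \<theta> - \<alpha>)\<close>, which is bounded because \<open>\<theta> > - \<alpha>\<close>.
\<close>

lemma normalizing_integrable:
  assumes \<theta>: "\<theta> > - \<alpha>"
  shows "set_integrable lborel {0<..} (\<lambda>t. t powr (1 - \<theta>) * f t * f t)"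
  unfolding set_integrable_def
proof -
  obtain K where K: "K > 0" "AE t in lborel. f t \<le> K" using f_bounded by blast
  obtain C where C: "C > 0" "AE t in lborel. t > 2 \<longrightarrow> f t \<le> C * t powr (- 1 - \<alpha>)" using f_tail by blast
  \<comment> \<open>A positive order with \<open>p \<ge> \<theta>\<close>, so that \<open>t powr (p + 1 - \<theta>)\<close> is bounded on \<open>0 < t \<le> 2\<close>.\<close>
  define p where "p = max \<theta> 1"
  have p: "p > 0" "p \<ge> \<theta>" by (auto simp: p_def)
  let ?m = "\<lambda>t. 2 powr (p + 1 - \<theta>) * K * (t powr (- p) * f t) + C * f t"
  have int: "integrable lborel (\<lambda>t. ?m t)"
    by (intro Bochner_Integration.integrable_add integrable_mult_right negative_moment_finite p f_integrable)
  show "integrable lborel (\<lambda>t. indicat_real {0<..} t *\<^sub>R (t powr (1 - \<theta>) * f t * f t))"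
  proof (rule Bochner_Integration.integrable_bound[OF int])
    show "AE t in lborel. norm (indicat_real {0<..} t *\<^sub>R (t powr (1 - \<theta>) * f t * f t)) \<le> norm (?m t)"
      using K(2) C(2)
    proof eventually_elim
      case (elim t)
      have nn: "0 \<le> 2 powr (p + 1 - \<theta>) * K * (t powr (- p) * f t)" "0 \<le> C * f t" using K(1) C(1) by auto
      have "t powr (1 - \<theta>) * f t * f t \<le> ?m t" if t: "t > 0"
      proof (cases "t > 2")
        case True
        have "t powr (1 - \<theta>) * f t \<le> t powr (1 - \<theta>) * (C * t powr (- 1 - \<alpha>))"
          using elim True by (intro mult_left_mono) auto
        also have "\<dots> = C * t powr (- \<theta> - \<alpha>)" by (simp add: mult_ac flip: powr_add)
        also have "t powr (- \<theta> - \<alpha>) \<le> t powr 0" using True \<theta> by (intro powr_mono) auto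
        finally have "t powr (1 - \<theta>) * f t \<le> C" using C(1) t by (simp add: mult_left_mono)
        then have "t powr (1 - \<theta>) * f t * f t \<le> C * f t" by (rule mult_right_mono) simp
        then show ?thesis using nn by linarith
      next
        case False
        have "t powr (1 - \<theta>) = t powr (- p) * t powr (p + 1 - \<theta>)" by (simp flip: powr_add)
        also have "\<dots> \<le> t powr (- p) * 2 powr (p + 1 - \<theta>)"
          using False t p by (intro mult_left_mono powr_mono2) auto
        finally have "t powr (1 - \<theta>) * f t * f t \<le> (t powr (- p) * 2 powr (p + 1 - \<theta>)) * f t * K"
          using elim(1) by (intro mult_mono mult_right_mono) auto
        then show ?thesis using nn by (simp add: mult_ac)
      qed
      then show ?case using nn by (auto simp: indicator_def)
    qed
  qed measurable
qed

lemma normalizing_integral_pos: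
  assumes \<theta>: "\<theta> > - \<alpha>"
  shows "(LINT t:{0<..}|lborel. t powr (1 - \<theta>) * f t * f t) > 0"
proof (rule ccontr)
  let ?g = "\<lambda>t. indicat_real {0<..} t *\<^sub>R (t powr (1 - \<theta>) * f t * f t)"
  assume "\<not> ?thesis"
  moreover have "(LINT t|lborel. ?g t) \<ge> 0" by (intro Bochner_Integration.integral_nonneg) auto
  ultimately have "(LINT t|lborel. ?g t) = 0" unfolding set_lebesgue_integral_def by linarith
  then have "AE t in lborel. ?g t = 0"
    using normalizing_integrable[OF \<theta>] unfolding set_integrable_def
    by (subst (asm) integral_nonneg_eq_0_iff_AE) auto
  then have "AE t in lborel. ennreal (f t) = 0"
  proof eventually_elim
    case (elim t)
    then show ?case using f_zero[of t] by (cases "t > 0") auto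
  qed
  then have "(\<integral>\<^sup>+t. ennreal (f t) \<partial>lborel) = 0" by (subst nn_integral_0_iff_AE) auto
  then show False using nn_integral_f by simp
qed

lemma prob_space_mixing_density:
  assumes \<theta>: "\<theta> > - \<alpha>"
  shows "prob_space (density lborel (\<lambda>t. ennreal (mixing_density f \<theta> t)))"
proof (rule prob_spaceI)
  let ?J = "LINT t:{0<..}|lborel. t powr (1 - \<theta>) * f t * f t"
  have eq: "mixing_density f \<theta> t = norm_const f \<theta> * (indicat_real {0<..} t *\<^sub>R (t powr (1 - \<theta>) * f t * f t))" for t
    by (simp add: mixing_density_def)
  have J: "?J > 0" by (rule normalizing_integral_pos[OF \<theta>])
  have [measurable]: "mixing_density f \<theta> \<in> borel_measurable borel"
    unfolding eq[abs_def] by measurable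
  have "emeasure (density lborel (\<lambda>t. ennreal (mixing_density f \<theta> t))) (space (density lborel (\<lambda>t. ennreal (mixing_density f \<theta> t))))
     = (\<integral>\<^sup>+t. ennreal (mixing_density f \<theta> t) \<partial>lborel)"
    by (simp add: emeasure_density)
  also have "\<dots> = ennreal (LINT t|lborel. mixing_density f \<theta> t)"
    unfolding eq
  proof (rule nn_integral_eq_integral)
    show "integrable lborel (\<lambda>t. norm_const f \<theta> * (indicat_real {0<..} t *\<^sub>R (t powr (1 - \<theta>) * f t * f t)))"
      using normalizing_integrable[OF \<theta>] unfolding set_integrable_def by (rule integrable_mult_right)
  qed (use J in \<open>auto simp: norm_const_def\<close>)
  also have "(LINT t|lborel. mixing_density f \<theta> t) = 1"
    unfolding eq integral_mult_right_zero using J by (simp add: norm_const_def set_lebesgue_integral_def)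
  finally show "emeasure (density lborel (\<lambda>t. ennreal (mixing_density f \<theta> t))) (space (density lborel (\<lambda>t. ennreal (mixing_density f \<theta> t)))) = 1"
    by simp
qed

section \<open>Integrals of the stable density against beta weights\<close>

text \<open>
  The inner integral in the definition of the weights. For \<open>b < 1\<close> it may be infinite at exceptional
  \<open>t\<close>, hence the extended values; it is finite for almost all \<open>t > 0\<close>.
\<close>

definition beta_average :: "real \<Rightarrow> real \<Rightarrow> ennreal" where
  "beta_average b t = (\<integral>\<^sup>+u. indicator {0<..<1} u * ennreal (f (t * u) * (1 - u) powr (b - 1)) \<partial>lborel)"

lemma beta_average_measurable[measurable]: "beta_average b \<in> borel_measurable borel"
  unfolding beta_average_def by measurable

lemma enn2real_beta_average:
  "(LINT u:{0<..<1}|lborel. f (t * u) * (1 - u) powr (b - 1)) = enn2real (beta_average b t)"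
proof -
  have "(LINT u:{0<..<1}|lborel. f (t * u) * (1 - u) powr (b - 1)) = enn2real (\<integral>\<^sup>+u. ennreal (indicat_real {0<..<1} u *\<^sub>R (f (t * u) * (1 - u) powr (b - 1))) \<partial>lborel)"
    unfolding set_lebesgue_integral_def by (rule integral_eq_nn_integral) auto
  also have "(\<integral>\<^sup>+u. ennreal (indicat_real {0<..<1} u *\<^sub>R (f (t * u) * (1 - u) powr (b - 1))) \<partial>lborel) = beta_average b t"
    unfolding beta_average_def by (intro nn_integral_cong) (auto simp: indicator_def)
  finally show ?thesis .
qed

text \<open>
  After \<open>r = t * u\<close> the function \<open>t powr b * beta_average b t\<close> is the convolution of \<open>f\<close> with
  \<open>m powr (b - 1)\<close>, so its Laplace transform is a product.
\<close>

lemma beta_average_laplace: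
  assumes a: "a > 0" and b: "b > 0"
  shows "(\<integral>\<^sup>+t. indicator {0<..} t * (ennreal (t powr b * exp (- (t * a))) * beta_average b t) \<partial>lborel)
    = ennreal (Gamma b * a powr (- b) * exp (- (a powr \<alpha>)))"
proof -
  let ?C = "\<lambda>r t. ennreal (f r) * (indicator {0<..} (t - r) * ennreal ((t - r) powr (b - 1) * exp (- (t * a))))"
  have conv: "indicator {0<..} t * (ennreal (t powr b * exp (- (t * a))) * beta_average b t)
     = (\<integral>\<^sup>+r. ?C r t \<partial>lborel)" for t
  proof (cases "t > 0")
    case t: True
    have "(\<integral>\<^sup>+r. ?C r t \<partial>lborel)
      = ennreal \<bar>t\<bar> * (\<integral>\<^sup>+u. ennreal (f (0 + t * u)) * (indicator {0<..} (t - (0 + t * u)) * ennreal ((t - (0 + t * u)) powr (b - 1) * exp (- (t * a)))) \<partial>lborel)"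
      by (rule nn_integral_real_affine) (use t in auto)
    also have "\<dots> = (\<integral>\<^sup>+u. ennreal t * (ennreal (f (t * u)) * (indicator {0<..} (t - t * u) * ennreal ((t - t * u) powr (b - 1) * exp (- (t * a))))) \<partial>lborel)"
      using t by (subst nn_integral_cmult[symmetric]) auto
    also have "\<dots> = (\<integral>\<^sup>+u. ennreal (t powr b * exp (- (t * a))) * (indicator {0<..<1} u * ennreal (f (t * u) * (1 - u) powr (b - 1))) \<partial>lborel)"
    proof (rule nn_integral_cong)
      fix u :: real
      consider "u \<le> 0" | "u \<ge> 1" | "0 < u" "u < 1" by linarith
      then show "ennreal t * (ennreal (f (t * u)) * (indicator {0<..} (t - t * u) * ennreal ((t - t * u) powr (b - 1) * exp (- (t * a)))))
        = ennreal (t powr b * exp (- (t * a))) * (indicator {0<..<1} u * ennreal (f (t * u) * (1 - u) powr (b - 1)))"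
      proof cases
        case 1
        then have "f (t * u) = 0" using t by (intro f_zero) (simp add: mult_nonneg_nonpos)
        then show ?thesis by simp
      next
        case 2
        then have "\<not> t - t * u > 0" using t by simp
        then show ?thesis using 2 by simp
      next
        case 3
        have e: "t - t * u = t * (1 - u)" by (simp add: algebra_simps)
        have "t * (t * (1 - u)) powr (b - 1) = t powr b * (1 - u) powr (b - 1)"
          using t 3 by (simp add: powr_mult powr_diff)
        moreover have "t * (1 - u) > 0" using t 3 by simp
        ultimately show ?thesis
          using t 3 unfolding e by (simp add: mult_ac flip: ennreal_mult)
      qed
    qed
    also have "\<dots> = ennreal (t powr b * exp (- (t * a))) * beta_average b t"
      unfolding beta_average_def by (rule nn_integral_cmult) measurable
    finally show ?thesis using t by simp
  next
    case False
    then have z: "?C r t = 0" for r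
      using f_zero[of r] by (cases "r > 0") auto
    show ?thesis unfolding z using False by simp
  qed
  have inner: "(\<integral>\<^sup>+t. ?C r t \<partial>lborel)
     = ennreal (Gamma b * a powr (- b)) * (ennreal (f r) * ennreal (exp (- (r * a))))" for r
  proof -
    have "(\<integral>\<^sup>+t. indicator {0<..} (t - r) * ennreal ((t - r) powr (b - 1) * exp (- (t * a))) \<partial>lborel)
      = (\<integral>\<^sup>+m. indicator {0<..} (r + 1 * m - r) * ennreal ((r + 1 * m - r) powr (b - 1) * exp (- ((r + 1 * m) * a))) \<partial>lborel)"
      by (subst nn_integral_real_affine[where c=1 and t=r]) auto
    also have "\<dots> = (\<integral>\<^sup>+m. (indicator {0<..} m * ennreal (m powr (b - 1) * exp (- (m powr 1 * a)))) * ennreal (exp (- (r * a))) \<partial>lborel)"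
    proof (rule nn_integral_cong)
      fix m :: real
      have e: "exp (- ((r + 1 * m) * a)) = exp (- (m * a)) * exp (- (r * a))" by (simp add: algebra_simps flip: exp_add)
      show "indicator {0<..} (r + 1 * m - r) * ennreal ((r + 1 * m - r) powr (b - 1) * exp (- ((r + 1 * m) * a)))
        = (indicator {0<..} m * ennreal (m powr (b - 1) * exp (- (m powr 1 * a)))) * ennreal (exp (- (r * a)))"
        unfolding e by (auto simp: indicator_def ennreal_mult mult_ac)
    qed
    also have "\<dots> = ennreal (Gamma b * a powr (- b)) * ennreal (exp (- (r * a)))"
      by (subst nn_integral_multc, measurable, subst powr_gamma_nn_integral(2)) (use a b in auto)
    finally show ?thesis
      by (subst nn_integral_cmult) (auto simp: mult_ac)
  qed
  have "(\<integral>\<^sup>+t. indicator {0<..} t * (ennreal (t powr b * exp (- (t * a))) * beta_average b t) \<partial>lborel)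
    = (\<integral>\<^sup>+r. \<integral>\<^sup>+t. ?C r t \<partial>lborel \<partial>lborel)"
    unfolding conv by (rule lborel_pair.Fubini') measurable
  also have "\<dots> = ennreal (Gamma b * a powr (- b)) * ennreal (exp (- (a powr \<alpha>)))"
    unfolding inner by (subst nn_integral_cmult, measurable, subst laplace(3)) (use a in auto)
  finally show ?thesis using b by (simp add: ennreal_mult' Gamma_real_pos less_imp_le)
qed

text \<open>
  The power of \<open>t\<close> in front differs by \<open>t powr (- (b + d - 1))\<close> from the one that makes
  \<open>beta_average_laplace\<close> applicable. This factor is resolved into exponentials by
  \<open>laplace_powr_beta_integral\<close>, which amounts to averaging the Laplace transform over the arguments \<open>y / x\<close>.
\<close>

lemma beta_average_laplace_shifted:
  fixes b d :: real
  assumes y: "y > 0" and b: "b > 0" and \<nu>: "b + d - 1 > 0"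
  shows "(\<integral>\<^sup>+t. indicator {0<..} t * (ennreal (t powr (1 - d) * exp (- (t * y))) * beta_average b t) \<partial>lborel)
    = ennreal (Gamma b / Gamma (b + d - 1)) *
      (\<integral>\<^sup>+x. indicator {0<..<1} x * ennreal ((1 - x) powr (b + d - 1 - 1) * (x powr (- d) * y powr (d - 1) * exp (- (y powr \<alpha> * x powr (- \<alpha>))))) \<partial>lborel)"
proof -
  define \<nu> where "\<nu> = b + d - 1"
  have n: "\<nu> > 0" using \<nu> by (simp add: \<nu>_def)
  have G: "Gamma \<nu> > 0" using n by (rule Gamma_real_pos)
  have Gb: "Gamma b > 0" using b by (rule Gamma_real_pos)
  define cy where "cy = y powr \<nu> / Gamma \<nu>"
  have cy: "cy \<ge> 0" using G by (simp add: cy_def)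
  let ?h = "\<lambda>x. (1 - x) powr (\<nu> - 1) * x powr (- \<nu> - 1)"
  let ?T = "\<lambda>x t. indicator {0<..<1} x * ennreal (?h x) * (indicator {0<..} t * (ennreal (t powr b * exp (- (t * (y / x)))) * beta_average b t))"
  let ?Z = "\<lambda>x. (1 - x) powr (\<nu> - 1) * (x powr (- d) * y powr (d - 1) * exp (- (y powr \<alpha> * x powr (- \<alpha>))))"
  have e: "ennreal (t powr (1 - d) * exp (- (t * y))) = ennreal (cy * t powr b) *
      (\<integral>\<^sup>+x. indicator {0<..<1} x * ennreal (?h x * exp (- (t * y / x))) \<partial>lborel)" if t: "t > 0" for t
  proof -
    have "(\<integral>\<^sup>+x. indicator {0<..<1} x * ennreal (?h x * exp (- (t * y / x))) \<partial>lborel) = ennreal (Gamma \<nu> * (t * y) powr (- \<nu>) * exp (- (t * y)))"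
      by (rule laplace_powr_beta_integral) (use t y n in auto)
    moreover have "cy * t powr b * (Gamma \<nu> * (t * y) powr (- \<nu>) * exp (- (t * y))) = t powr (1 - d) * exp (- (t * y))"
    proof -
      have "t powr (1 - d) = t powr b * t powr (- \<nu>)" by (simp add: \<nu>_def flip: powr_add)
      moreover have "y powr \<nu> * y powr (- \<nu>) = 1" using y by (simp flip: powr_add)
      moreover have "(t * y) powr (- \<nu>) = t powr (- \<nu>) * y powr (- \<nu>)" using t y by (simp add: powr_mult)
      ultimately show ?thesis using G by (simp add: cy_def field_simps)
    qed
    ultimately show ?thesis using G cy by (simp flip: ennreal_mult)
  qed
  have "(\<integral>\<^sup>+t. indicator {0<..} t * (ennreal (t powr (1 - d) * exp (- (t * y))) * beta_average b t) \<partial>lborel)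
     = (\<integral>\<^sup>+t. \<integral>\<^sup>+x. ennreal (cy) * (?T x t) \<partial>lborel \<partial>lborel)"
  proof (rule nn_integral_cong)
    fix t :: real
    show "indicator {0<..} t * (ennreal (t powr (1 - d) * exp (- (t * y))) * beta_average b t)
      = (\<integral>\<^sup>+x. ennreal (cy) * (?T x t) \<partial>lborel)"
    proof (cases "t > 0")
      case True
      have "indicator {0<..} t * (ennreal (t powr (1 - d) * exp (- (t * y))) * beta_average b t)
         = (ennreal (cy * t powr b) * beta_average b t) * (\<integral>\<^sup>+x. indicator {0<..<1} x * ennreal (?h x * exp (- (t * y / x))) \<partial>lborel)"
        unfolding e[OF True] using True by (simp only: mult_ac indicator_simps greaterThan_iff mult_1_left)
      also have "\<dots> = (\<integral>\<^sup>+x. (ennreal (cy * t powr b) * beta_average b t) * (indicator {0<..<1} x * ennreal (?h x * exp (- (t * y / x)))) \<partial>lborel)"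
        by (rule nn_integral_cmult[symmetric]) measurable
      also have "\<dots> = (\<integral>\<^sup>+x. ennreal (cy) * (?T x t) \<partial>lborel)"
        using True cy by (intro nn_integral_cong) (simp add: ennreal_mult mult_ac)
      finally show ?thesis .
    qed simp
  qed
  also have "\<dots> = (\<integral>\<^sup>+x. \<integral>\<^sup>+t. ennreal (cy) * (?T x t) \<partial>lborel \<partial>lborel)"
    by (rule lborel_pair.Fubini') measurable
  also have "\<dots> = (\<integral>\<^sup>+x. ennreal (Gamma b / Gamma \<nu>) * (indicator {0<..<1} x * ennreal (?Z x)) \<partial>lborel)"
  proof (rule nn_integral_cong)
    fix x :: real
    show "(\<integral>\<^sup>+t. ennreal (cy) * (?T x t) \<partial>lborel)
      = ennreal (Gamma b / Gamma \<nu>) * (indicator {0<..<1} x * ennreal (?Z x))"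
    proof (cases "0 < x \<and> x < 1")
      case True
      then have yx: "y / x > 0" using y by simp
      have "(\<integral>\<^sup>+t. ennreal (cy) * (?T x t) \<partial>lborel)
         = (\<integral>\<^sup>+t. ennreal (cy * ?h x) * (indicator {0<..} t * (ennreal (t powr b * exp (- (t * (y / x)))) * beta_average b t)) \<partial>lborel)"
        using True cy by (intro nn_integral_cong) (simp add: ennreal_mult mult_ac)
      also have "\<dots> = ennreal (cy * ?h x) * ennreal (Gamma b * (y / x) powr (- b) * exp (- ((y / x) powr \<alpha>)))"
        by (subst nn_integral_cmult, measurable, subst beta_average_laplace[OF yx b]) simp
      also have "\<dots> = ennreal (cy * ?h x * (Gamma b * (y / x) powr (- b) * exp (- ((y / x) powr \<alpha>))))"
        using cy Gb by (simp add: ennreal_mult)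
      also have "cy * ?h x * (Gamma b * (y / x) powr (- b) * exp (- ((y / x) powr \<alpha>)))
        = Gamma b / Gamma \<nu> * (?Z x)"
      proof -
        have 1: "(y / x) powr \<alpha> = y powr \<alpha> * x powr (- \<alpha>)" using y True by (simp add: powr_divide powr_minus_divide)
        have 2: "(y / x) powr (- b) = y powr (- b) * x powr b" using y True by (simp add: powr_divide powr_minus_divide)
        have 3: "y powr (d - 1) = y powr \<nu> * y powr (- b)" by (simp add: \<nu>_def flip: powr_add)
        have 4: "x powr (- d) = x powr (- \<nu> - 1) * x powr b" by (simp add: \<nu>_def flip: powr_add)
        show ?thesis unfolding 1 2 3 4 cy_def by (simp add: mult_ac)
      qed
      also have "ennreal (Gamma b / Gamma \<nu> * (?Z x))
        = ennreal (Gamma b / Gamma \<nu>) * ennreal (?Z x)"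
        by (rule ennreal_mult) (use G Gb in auto)
      finally show ?thesis using True by simp
    qed auto
  qed
  also have "\<dots> = ennreal (Gamma b / Gamma \<nu>) * (\<integral>\<^sup>+x. indicator {0<..<1} x * ennreal (?Z x) \<partial>lborel)"
    by (rule nn_integral_cmult) measurable
  finally show ?thesis unfolding \<nu>_def .
qed

text \<open>
  The quadratic in the denominator of \<open>Delta\<close> is \<open>x powr (2 * \<alpha>)\<close> times the squared modulus of
  \<open>x powr (- \<alpha>) + c - \<i> * s\<close>, the complex rate of the Gamma integral that the pairing produces.
\<close>

lemma Delta_ratio_cdf:
  assumes x: "0 < x" "x < 1"
  shows "Delta \<alpha> d (ratio_cdf f) x = 1 / pi * (x powr (- d) *
     (((x powr (- \<alpha>) + cos (pi * \<alpha>))\<^sup>2 + (sin (pi * \<alpha>))\<^sup>2) powr (- d / (2 * \<alpha>)) *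
      sin (d / \<alpha> * arctan (sin (pi * \<alpha>) / (x powr (- \<alpha>) + cos (pi * \<alpha>))))))"
proof -
  let ?c = "cos (pi * \<alpha>)" and ?s = "sin (pi * \<alpha>)"
  let ?S = "(x powr (- \<alpha>) + ?c)\<^sup>2 + ?s\<^sup>2"
  have S: "?S > 0" using x_powr_plus_cos_pos[OF x] by (intro add_pos_nonneg) auto
  have inv: "x powr \<alpha> * x powr (- \<alpha>) = 1" using x by (simp flip: powr_add)
  have cs: "?c\<^sup>2 + ?s\<^sup>2 = 1" by (rule sin_cos_squared_add2)
  have sq: "x powr (2 * \<alpha>) = (x powr \<alpha>)\<^sup>2" by (simp add: power2_eq_square flip: powr_add)
  have alg: "p\<^sup>2 * ((q + c)\<^sup>2 + r\<^sup>2) = (p * q)\<^sup>2 + 2 * p * (p * q) * c + p\<^sup>2 * (c\<^sup>2 + r\<^sup>2)" for p q c r :: real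
    by (simp add: power2_eq_square algebra_simps)
  have "x powr (2 * \<alpha>) * ?S = (x powr \<alpha> * x powr (- \<alpha>))\<^sup>2 + 2 * x powr \<alpha> * (x powr \<alpha> * x powr (- \<alpha>)) * ?c + (x powr \<alpha>)\<^sup>2 * (?c\<^sup>2 + ?s\<^sup>2)"
    unfolding sq by (rule alg)
  also have "\<dots> = x powr (2 * \<alpha>) + 2 * x powr \<alpha> * cos (\<alpha> * pi) + 1"
    unfolding inv sq cs by (simp add: mult.commute)
  finally have R: "x powr (2 * \<alpha>) + 2 * x powr \<alpha> * cos (\<alpha> * pi) + 1 = x powr (2 * \<alpha>) * ?S" ..
  have "1 / (x powr (2 * \<alpha>) * ?S) powr (d / (2 * \<alpha>)) = (x powr (2 * \<alpha>) * ?S) powr (- d / (2 * \<alpha>))"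
    by (simp add: powr_minus_divide)
  also have "\<dots> = x powr (- d) * ?S powr (- d / (2 * \<alpha>))"
    using alpha S by (simp add: powr_mult powr_powr)
  finally have P: "1 / (x powr (2 * \<alpha>) * ?S) powr (d / (2 * \<alpha>)) = x powr (- d) * ?S powr (- d / (2 * \<alpha>))" .
  have "pi * d * ratio_cdf f x = d / \<alpha> * arctan (?s / (x powr (- \<alpha>) + ?c))"
    unfolding ratio_cdf_eq_arctan[OF x] by simp
  then have "Delta \<alpha> d (ratio_cdf f) x = 1 / pi * (sin (d / \<alpha> * arctan (?s / (x powr (- \<alpha>) + ?c))) * (1 / (x powr (2 * \<alpha>) * ?S) powr (d / (2 * \<alpha>))))"
    unfolding Delta_def R by simp
  then show ?thesis unfolding P by (simp only: mult_ac)
qed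

text \<open>
  Since \<open>x < 1\<close>, the growth of the kernel is at most \<open>exp (\<bar>c\<bar> * (y / x) powr \<alpha>)\<close>, and the integral
  is then a function of \<open>y / x\<close> only. The uniformity of the bound in \<open>x\<close> allows Fubini against the beta
  weight.
\<close>

lemma scaled_kernel_nn_integral_le:
  assumes x: "0 < x" "x < 1" and d: "d > 0"
  shows "(\<integral>\<^sup>+y. indicator {0<..} y * (ennreal (x powr (- d) * y powr (d - 1) * exp (- (y powr \<alpha> * x powr (- \<alpha>)))) * ennreal \<bar>stable_kernel \<alpha> y\<bar>) \<partial>lborel)
    \<le> ennreal (Gamma (d / \<alpha>) / \<alpha> * (1 - \<bar>cos (pi * \<alpha>)\<bar>) powr (- d / \<alpha>))"
proof -
  let ?c = "\<bar>cos (pi * \<alpha>)\<bar>" and ?X = "x powr (- \<alpha>)"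
  have c: "?c < 1" by (rule stable_cos_abs_less_1(1)[OF alpha])
  have X: "1 < ?X" by (rule one_less_powr_neg_alpha[OF x])
  have "(\<integral>\<^sup>+y. indicator {0<..} y * (ennreal (x powr (- d) * y powr (d - 1) * exp (- (y powr \<alpha> * ?X))) * ennreal \<bar>stable_kernel \<alpha> y\<bar>) \<partial>lborel)
     \<le> (\<integral>\<^sup>+y. ennreal (x powr (- d)) * (indicator {0<..} y * ennreal (y powr (d - 1) * exp (- (y powr \<alpha> * ((1 - ?c) * ?X))))) \<partial>lborel)"
  proof (rule nn_integral_mono)
    fix y :: real
    have "?c * y powr \<alpha> \<le> ?c * (y powr \<alpha> * ?X)"
      using X by (intro mult_left_mono) (auto simp: mult_le_cancel_left1)
    then have "\<bar>stable_kernel \<alpha> y\<bar> \<le> exp (?c * (y powr \<alpha> * ?X))"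
      by (intro order_trans[OF stable_kernel_abs_le(1)]) simp
    then have "exp (- (y powr \<alpha> * ?X)) * \<bar>stable_kernel \<alpha> y\<bar> \<le> exp (- (y powr \<alpha> * ?X)) * exp (?c * (y powr \<alpha> * ?X))"
      by (rule mult_left_mono) simp
    also have "\<dots> = exp (- (y powr \<alpha> * ((1 - ?c) * ?X)))" by (simp add: algebra_simps flip: exp_add)
    finally have "x powr (- d) * y powr (d - 1) * (exp (- (y powr \<alpha> * ?X)) * \<bar>stable_kernel \<alpha> y\<bar>) \<le> x powr (- d) * y powr (d - 1) * exp (- (y powr \<alpha> * ((1 - ?c) * ?X)))"
      by (rule mult_left_mono) simp
    then have "ennreal (x powr (- d) * y powr (d - 1) * exp (- (y powr \<alpha> * ?X)) * \<bar>stable_kernel \<alpha> y\<bar>) \<le> ennreal (x powr (- d) * (y powr (d - 1) * exp (- (y powr \<alpha> * ((1 - ?c) * ?X)))))"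
      by (intro ennreal_leI) (simp only: mult.assoc)
    then have "ennreal (x powr (- d) * y powr (d - 1) * exp (- (y powr \<alpha> * ?X))) * ennreal \<bar>stable_kernel \<alpha> y\<bar> \<le> ennreal (x powr (- d)) * ennreal (y powr (d - 1) * exp (- (y powr \<alpha> * ((1 - ?c) * ?X))))"
      by (simp only: ennreal_mult'[symmetric] ennreal_mult''[symmetric] abs_ge_zero exp_ge_zero powr_ge_zero)
    then show "indicator {0<..} y * (ennreal (x powr (- d) * y powr (d - 1) * exp (- (y powr \<alpha> * ?X))) * ennreal \<bar>stable_kernel \<alpha> y\<bar>)
      \<le> ennreal (x powr (- d)) * (indicator {0<..} y * ennreal (y powr (d - 1) * exp (- (y powr \<alpha> * ((1 - ?c) * ?X)))))"
      by (cases "y > 0") auto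
  qed
  also have "\<dots> = ennreal (x powr (- d)) * ennreal (Gamma (d / \<alpha>) / \<alpha> * ((1 - ?c) * ?X) powr (- d / \<alpha>))"
  proof -
    have "(1 - ?c) * ?X > 0" using c X by (intro mult_pos_pos) linarith+
    from powr_gamma_nn_integral(2)[OF alpha(1) d this] show ?thesis
      by (subst nn_integral_cmult) simp_all
  qed
  also have "\<dots> = ennreal (x powr (- d) * (Gamma (d / \<alpha>) / \<alpha> * ((1 - ?c) * ?X) powr (- d / \<alpha>)))"
  proof -
    have "Gamma (d / \<alpha>) > 0" using alpha d by (intro Gamma_real_pos) simp
    then have "0 \<le> Gamma (d / \<alpha>) / \<alpha> * ((1 - ?c) * ?X) powr (- d / \<alpha>)"
      using alpha by (intro mult_nonneg_nonneg divide_nonneg_pos) auto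
    then show ?thesis by (intro ennreal_mult[symmetric]) auto
  qed
  also have "x powr (- d) * (Gamma (d / \<alpha>) / \<alpha> * ((1 - ?c) * ?X) powr (- d / \<alpha>)) = Gamma (d / \<alpha>) / \<alpha> * (1 - ?c) powr (- d / \<alpha>)"
  proof -
    have "((1 - ?c) * ?X) powr (- d / \<alpha>) = (1 - ?c) powr (- d / \<alpha>) * x powr d"
      using c x alpha by (simp add: powr_mult powr_powr)
    moreover have "x powr (- d) * x powr d = 1" using x by (simp flip: powr_add)
    ultimately show ?thesis by (simp add: mult_ac)
  qed
  finally show ?thesis .
qed

text \<open>
  The pairing expresses the left-hand side as a double integral over \<open>y\<close> and \<open>x\<close>; exchanging the order
  leaves, for each \<open>x\<close>, the integral of \<open>stable_kernel_gamma_integral\<close>.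
\<close>

lemma beta_average_pairing:
  fixes b d :: real
  assumes b: "b > 0" and d: "d > 0" and \<nu>: "b + d - 1 > 0"
  shows "(LINT t:{0<..}|lborel. (t powr (1 - d) * enn2real (beta_average b t)) * f t)
    = Gamma b / Gamma (b + d - 1) * (Gamma (d / \<alpha>) / \<alpha>) *
      (LINT x:{0<..<1}|lborel. (1 - x) powr (b + d - 1 - 1) * Delta \<alpha> d (ratio_cdf f) x)"
proof -
  define \<nu> where "\<nu> = b + d - 1"
  have n: "\<nu> > 0" using \<nu> by (simp add: \<nu>_def)
  have G: "Gamma \<nu> > 0" "Gamma b > 0" using n b by (auto intro: Gamma_real_pos)
  define k where "k x y = x powr (- d) * y powr (d - 1) * exp (- (y powr \<alpha> * x powr (- \<alpha>)))" for x y
  have k0: "0 \<le> k x y" for x y by (simp add: k_def)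
  have mk[measurable]: "(\<lambda>(x, y). k x y) \<in> borel_measurable (lborel \<Otimes>\<^sub>M lborel)"
    unfolding k_def by measurable
  have mk2[measurable]: "(\<lambda>x. k x y) \<in> borel_measurable borel" for y unfolding k_def by measurable
  let ?P = "\<lambda>x y. indicator {0<..<1} x * ennreal ((1 - x) powr (\<nu> - 1)) * (indicator {0<..} y * (ennreal (k x y) * ennreal \<bar>stable_kernel \<alpha> y\<bar>))"
  let ?S = "\<lambda>x y. indicat_real {0<..<1} x *\<^sub>R (indicat_real {0<..} y *\<^sub>R ((1 - x) powr (\<nu> - 1) * k x y * stable_kernel \<alpha> y))"
  let ?D = "\<lambda>x. indicat_real {0<..<1} x *\<^sub>R ((1 - x) powr (\<nu> - 1) * Delta \<alpha> d (ratio_cdf f) x)"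
  define N where "N y = (\<integral>\<^sup>+x. indicator {0<..<1} x * ennreal ((1 - x) powr (\<nu> - 1) * k x y) \<partial>lborel)" for y
  define W where "W y = ennreal (Gamma b / Gamma \<nu>) * N y" for y
  have fin_ae: "AE t in lborel. t > 0 \<longrightarrow> beta_average b t \<noteq> \<infinity>"
  proof -
    have "(\<integral>\<^sup>+t. indicator {0<..} t * (ennreal (t powr b * exp (- (t * 1))) * beta_average b t) \<partial>lborel) \<noteq> \<infinity>"
      using beta_average_laplace[OF zero_less_one b] by simp
    then have "AE t in lborel. indicator {0<..} t * (ennreal (t powr b * exp (- (t * 1))) * beta_average b t) \<noteq> \<infinity>"
      by (rule nn_integral_PInf_AE[rotated]) measurable
    then show ?thesis
      by eventually_elim (auto simp: ennreal_mult_eq_top_iff)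
  qed
  have W_eq: "(\<integral>\<^sup>+t. indicator {0<..} t * ennreal (t powr (1 - d) * enn2real (beta_average b t) * exp (- (t * y))) \<partial>lborel) = W y"
    if y: "y > 0" for y
  proof -
    have "(\<integral>\<^sup>+t. indicator {0<..} t * ennreal (t powr (1 - d) * enn2real (beta_average b t) * exp (- (t * y))) \<partial>lborel)
       = (\<integral>\<^sup>+t. indicator {0<..} t * (ennreal (t powr (1 - d) * exp (- (t * y))) * beta_average b t) \<partial>lborel)"
    proof (rule nn_integral_cong_AE)
      show "AE t in lborel. indicator {0<..} t * ennreal (t powr (1 - d) * enn2real (beta_average b t) * exp (- (t * y)))
         = indicator {0<..} t * (ennreal (t powr (1 - d) * exp (- (t * y))) * beta_average b t)"
        using fin_ae
      proof eventually_elim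
        case (elim t)
        show ?case
        proof (cases "t > 0")
          case True
          then have "ennreal (enn2real (beta_average b t)) = beta_average b t" using elim by (simp add: less_top)
          then show ?thesis using True by (simp add: ennreal_mult mult_ac)
        qed simp
      qed
    qed
    then show ?thesis
      unfolding beta_average_laplace_shifted[OF y b \<nu>] W_def N_def k_def \<nu>_def .
  qed
  define J where "J = ennreal (Gamma (d / \<alpha>) / \<alpha> * (1 - \<bar>cos (pi * \<alpha>)\<bar>) powr (- d / \<alpha>))"
  have fin: "(\<integral>\<^sup>+x. \<integral>\<^sup>+y. ?P x y \<partial>lborel \<partial>lborel) < \<infinity>"
  proof -
    have "(\<integral>\<^sup>+x. \<integral>\<^sup>+y. ?P x y \<partial>lborel \<partial>lborel)
      \<le> (\<integral>\<^sup>+x. indicator {0<..<1} x * ennreal ((1 - x) powr (\<nu> - 1)) * J \<partial>lborel)"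
    proof (rule nn_integral_mono)
      fix x :: real
      show "(\<integral>\<^sup>+y. ?P x y \<partial>lborel)
        \<le> indicator {0<..<1} x * ennreal ((1 - x) powr (\<nu> - 1)) * J"
      proof (cases "0 < x \<and> x < 1")
        case True
        have "(\<integral>\<^sup>+y. ?P x y \<partial>lborel)
          = indicator {0<..<1} x * ennreal ((1 - x) powr (\<nu> - 1)) * (\<integral>\<^sup>+y. indicator {0<..} y * (ennreal (k x y) * ennreal \<bar>stable_kernel \<alpha> y\<bar>) \<partial>lborel)"
          unfolding k_def by (rule nn_integral_cmult) measurable
        also have "\<dots> \<le> indicator {0<..<1} x * ennreal ((1 - x) powr (\<nu> - 1)) * J"
          unfolding k_def J_def using True d by (intro mult_left_mono scaled_kernel_nn_integral_le) auto
        finally show ?thesis .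
      qed auto
    qed
    also have "\<dots> = (\<integral>\<^sup>+x. indicator {0<..<1} x * ennreal ((1 - x) powr (\<nu> - 1)) \<partial>lborel) * J"
      by (rule nn_integral_multc) measurable
    also have "\<dots> < \<infinity>" using powr_beta_finite[OF n] by (simp add: J_def ennreal_mult_less_top)
    finally show ?thesis .
  qed
  have "(LINT t:{0<..}|lborel. (t powr (1 - d) * enn2real (beta_average b t)) * f t)
     = (LINT y:{0<..}|lborel. enn2real (W y) * stable_kernel \<alpha> y)"
  proof (rule pairing[OF _ _ W_eq])
    have "(\<integral>\<^sup>+y. indicator {0<..} y * (W y * ennreal \<bar>stable_kernel \<alpha> y\<bar>) \<partial>lborel)
      = (\<integral>\<^sup>+y. ennreal (Gamma b / Gamma \<nu>) * (\<integral>\<^sup>+x. ?P x y \<partial>lborel) \<partial>lborel)"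
    proof (rule nn_integral_cong)
      fix y :: real
      have "N y * (indicator {0<..} y * ennreal \<bar>stable_kernel \<alpha> y\<bar>)
        = (\<integral>\<^sup>+x. indicator {0<..<1} x * ennreal ((1 - x) powr (\<nu> - 1) * k x y) * (indicator {0<..} y * ennreal \<bar>stable_kernel \<alpha> y\<bar>) \<partial>lborel)"
        unfolding N_def by (rule nn_integral_multc[symmetric]) measurable
      also have "\<dots> = (\<integral>\<^sup>+x. ?P x y \<partial>lborel)"
        by (intro nn_integral_cong) (simp add: ennreal_mult k0 mult_ac)
      finally have q: "N y * (indicator {0<..} y * ennreal \<bar>stable_kernel \<alpha> y\<bar>) = (\<integral>\<^sup>+x. ?P x y \<partial>lborel)" .
      show "indicator {0<..} y * (W y * ennreal \<bar>stable_kernel \<alpha> y\<bar>)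
        = ennreal (Gamma b / Gamma \<nu>) * (\<integral>\<^sup>+x. ?P x y \<partial>lborel)"
        unfolding W_def q[symmetric] by (simp only: mult_ac)
    qed
    also have "\<dots> = ennreal (Gamma b / Gamma \<nu>) * (\<integral>\<^sup>+y. \<integral>\<^sup>+x. ?P x y \<partial>lborel \<partial>lborel)"
      unfolding k_def by (rule nn_integral_cmult) measurable
    also have "\<dots> = ennreal (Gamma b / Gamma \<nu>) * (\<integral>\<^sup>+x. \<integral>\<^sup>+y. ?P x y \<partial>lborel \<partial>lborel)"
      unfolding k_def by (rule arg_cong[where f="\<lambda>z. _ * z"], rule lborel_pair.Fubini') measurable
    also have "\<dots> < \<infinity>" using fin by (simp add: ennreal_mult_less_top)
    finally show "(\<integral>\<^sup>+y. indicator {0<..} y * (W y * ennreal \<bar>stable_kernel \<alpha> y\<bar>) \<partial>lborel) < \<infinity>" .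
  qed auto
  also have "\<dots> = (LINT y|lborel. LINT x|lborel. Gamma b / Gamma \<nu> * (?S x y))"
    unfolding set_lebesgue_integral_def
  proof (rule Bochner_Integration.integral_cong[OF refl])
    fix y :: real
    have "enn2real (N y) = (LINT x|lborel. indicat_real {0<..<1} x *\<^sub>R ((1 - x) powr (\<nu> - 1) * k x y))"
    proof (subst integral_eq_nn_integral)
      show "enn2real (N y) = enn2real (\<integral>\<^sup>+x. ennreal (indicat_real {0<..<1} x *\<^sub>R ((1 - x) powr (\<nu> - 1) * k x y)) \<partial>lborel)"
        unfolding N_def by (intro arg_cong[where f=enn2real] nn_integral_cong) (auto simp: indicator_def)
    qed (auto simp: k0)
    then have "enn2real (W y) = Gamma b / Gamma \<nu> * (LINT x|lborel. indicat_real {0<..<1} x *\<^sub>R ((1 - x) powr (\<nu> - 1) * k x y))"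
      using G by (simp add: W_def enn2real_mult)
    then have "indicat_real {0<..} y *\<^sub>R (enn2real (W y) * stable_kernel \<alpha> y)
       = (Gamma b / Gamma \<nu> * (indicat_real {0<..} y * stable_kernel \<alpha> y)) * (LINT x|lborel. indicat_real {0<..<1} x *\<^sub>R ((1 - x) powr (\<nu> - 1) * k x y))"
      by simp
    also have "\<dots> = (LINT x|lborel. (Gamma b / Gamma \<nu> * (indicat_real {0<..} y * stable_kernel \<alpha> y)) * (indicat_real {0<..<1} x *\<^sub>R ((1 - x) powr (\<nu> - 1) * k x y)))"
      by (rule integral_mult_right_zero[symmetric])
    also have "\<dots> = (LINT x|lborel. Gamma b / Gamma \<nu> * (?S x y))"
      by (rule Bochner_Integration.integral_cong[OF refl]) (simp only: real_scaleR_def mult_ac)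
    finally show "indicat_real {0<..} y *\<^sub>R (enn2real (W y) * stable_kernel \<alpha> y) = (LINT x|lborel. Gamma b / Gamma \<nu> * (?S x y))" .
  qed
  also have "\<dots> = Gamma b / Gamma \<nu> * (LINT y|lborel. LINT x|lborel. ?S x y)"
    by simp
  also have "(LINT y|lborel. LINT x|lborel. ?S x y)
     = (LINT x|lborel. LINT y|lborel. ?S x y)"
  proof (rule fubini_lborel(1)[symmetric])
    show "(\<lambda>(x, y). ?S x y) \<in> borel_measurable (lborel \<Otimes>\<^sub>M lborel)"
      unfolding k_def by measurable
    have "ennreal (norm (?S x y))
      = ?P x y" for x y
      by (auto simp: indicator_def abs_mult k0 mult_ac simp flip: ennreal_mult)
    then show "(\<integral>\<^sup>+x. \<integral>\<^sup>+y. ennreal (norm (?S x y)) \<partial>lborel \<partial>lborel) < \<infinity>"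
      using fin by simp
  qed
  also have "\<dots> = (LINT x|lborel. Gamma (d / \<alpha>) / \<alpha> * (?D x))"
  proof (rule Bochner_Integration.integral_cong[OF refl])
    fix x :: real
    show "(LINT y|lborel. ?S x y)
      = Gamma (d / \<alpha>) / \<alpha> * (?D x)"
    proof (cases "0 < x \<and> x < 1")
      case True
      then have x: "0 < x" "x < 1" by auto
      have "(LINT y|lborel. ?S x y)
        = (LINT y|lborel. ((1 - x) powr (\<nu> - 1) * x powr (- d)) * (indicat_real {0<..} y *\<^sub>R (y powr (d - 1) * exp (- (y powr \<alpha> * x powr (- \<alpha>))) * stable_kernel \<alpha> y)))"
        using x by (intro Bochner_Integration.integral_cong[OF refl]) (simp add: k_def mult_ac)
      also have "\<dots> = ((1 - x) powr (\<nu> - 1) * x powr (- d)) * (LINT y:{0<..}|lborel. y powr (d - 1) * exp (- (y powr \<alpha> * x powr (- \<alpha>))) * stable_kernel \<alpha> y)"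
        unfolding set_lebesgue_integral_def by (rule integral_mult_right_zero)
      also have "\<dots> = Gamma (d / \<alpha>) / \<alpha> * ((1 - x) powr (\<nu> - 1) * Delta \<alpha> d (ratio_cdf f) x)"
        unfolding stable_kernel_gamma_integral[OF alpha(1) d x_powr_plus_cos_pos[OF x]] Delta_ratio_cdf[OF x]
        by (simp only: divide_inverse inverse_mult_distrib mult_ac mult_1_left)
      finally show ?thesis using x by simp
    qed auto
  qed
  also have "\<dots> = Gamma (d / \<alpha>) / \<alpha> * (LINT x:{0<..<1}|lborel. (1 - x) powr (\<nu> - 1) * Delta \<alpha> d (ratio_cdf f) x)"
    unfolding set_lebesgue_integral_def by (rule integral_mult_right_zero)
  finally show ?thesis unfolding \<nu>_def by (simp add: mult.assoc)
qed

section \<open>The partition weights\<close>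

text \<open>
  The factor \<open>f t\<close> in the denominator of \<open>G_stable\<close> cancels against one of those in the mixing density; where
  \<open>f t = 0\<close>, both sides of the cancellation are 0.
\<close>

lemma V_PK_eq_Delta_integral:
  assumes \<theta>: "\<theta> > - \<alpha>" and n: "n \<ge> 2" and k: "k \<in> {1..n}"
  shows "V_PK \<alpha> f (mixing_density f \<theta>) n k =
     norm_const f \<theta> * (\<alpha> ^ (k - 1) * Gamma (\<theta> / \<alpha> + real k) / Gamma (\<theta> + real n - 1)) *
     (LINT x:{0<..<1}|lborel. (1 - x) powr (real n + \<theta> - 2) * Delta \<alpha> (\<theta> + real k * \<alpha>) (ratio_cdf f) x)"
proof -
  define b where "b = real n - real k * \<alpha>"
  define d where "d = \<theta> + real k * \<alpha>"
  let ?T = "\<lambda>t. (norm_const f \<theta> * \<alpha> ^ k / Gamma b) * ((t powr (1 - d) * enn2real (beta_average b t)) * f t)"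
  have "real k * \<alpha> < real k * 1" using k alpha by (intro mult_strict_left_mono) auto
  moreover have "real k \<le> real n" using k by simp
  ultimately have b: "b > 0" by (simp add: b_def)
  have "1 * \<alpha> \<le> real k * \<alpha>" using k alpha by (intro mult_right_mono) auto
  then have d: "d > 0" using \<theta> by (simp add: d_def)
  have bd: "b + d - 1 = \<theta> + real n - 1" by (simp add: b_def d_def)
  have "real n \<ge> 2" using n by simp
  then have \<nu>: "b + d - 1 > 0" unfolding bd using \<theta> alpha by linarith
  have Gb: "Gamma b > 0" using b by (rule Gamma_real_pos)
  have "V_PK \<alpha> f (mixing_density f \<theta>) n k
      = (LINT t:{0<..}|lborel. ?T t)"
    unfolding V_PK_def
  proof (rule set_lebesgue_integral_cong)
    show "\<forall>t. t \<in> {0<..} \<longrightarrow> G_stable \<alpha> f n k t * mixing_density f \<theta> t = ?T t"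
    proof (intro allI impI)
      fix t :: real assume "t \<in> {0<..}"
      then have t: "t > 0" by simp
      have p: "t powr (1 - d) = t powr (- (real k * \<alpha>)) * t powr (1 - \<theta>)"
        by (simp add: d_def algebra_simps flip: powr_add)
      have I: "(LINT u:{0<..<1}|lborel. f (t * u) * (1 - u) powr (real n - real k * \<alpha> - 1)) = enn2real (beta_average b t)"
        using enn2real_beta_average[of t b] by (simp add: b_def)
      show "G_stable \<alpha> f n k t * mixing_density f \<theta> t = ?T t"
        unfolding G_stable_def I unfolding mixing_density_def p b_def[symmetric] using t
        by (cases "f t = 0") (simp_all add: field_simps)
    qed
  qed simp
  also have "\<dots> = (norm_const f \<theta> * \<alpha> ^ k / Gamma b) * (LINT t:{0<..}|lborel. (t powr (1 - d) * enn2real (beta_average b t)) * f t)"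
    by (rule set_integral_mult_right)
  also have "\<dots> = norm_const f \<theta> * (\<alpha> ^ k / \<alpha> * Gamma (d / \<alpha>) / Gamma (b + d - 1)) * (LINT x:{0<..<1}|lborel. (1 - x) powr (b + d - 1 - 1) * Delta \<alpha> d (ratio_cdf f) x)"
    unfolding beta_average_pairing[OF b d \<nu>] using Gb by (simp add: mult_ac)
  also have "\<alpha> ^ k / \<alpha> = \<alpha> ^ (k - 1)"
    using k alpha by (cases k) auto
  also have "d / \<alpha> = \<theta> / \<alpha> + real k" using alpha by (simp add: d_def add_divide_distrib)
  finally show ?thesis unfolding bd by (simp add: d_def add_ac)
qed

lemma norm_const_zero: "norm_const f 0 = 2 * pi * (1 + cos (\<alpha> * pi)) / sin (pi * \<alpha>)"
  using integral_t_f_squared unfolding norm_const_def by (simp add: mult_ac)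

text \<open>
  At \<open>\<theta> = 0\<close> the sine in \<open>Delta\<close> has an integer multiple of the angle of
  \<open>1 + x powr \<alpha> * exp (\<i> * \<pi> * \<alpha>)\<close> as its argument.
\<close>

lemma Delta_eq_Im_power:
  assumes x: "0 < x" "x < 1"
  shows "Delta \<alpha> (0 + real k * \<alpha>) (ratio_cdf f) x
    = Im (Complex (x powr \<alpha> * cos (\<alpha> * pi) + 1) (x powr \<alpha> * sin (pi * \<alpha>)) ^ k) / pi /
       (x powr (2 * \<alpha>) + 2 * x powr \<alpha> * cos (\<alpha> * pi) + 1) ^ k"
proof -
  let ?A = "x powr \<alpha> * cos (\<alpha> * pi) + 1" and ?B = "x powr \<alpha> * sin (pi * \<alpha>)"
  let ?R = "x powr (2 * \<alpha>) + 2 * x powr \<alpha> * cos (\<alpha> * pi) + 1"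
  have sq: "x powr (2 * \<alpha>) = (x powr \<alpha>)\<^sup>2" by (simp add: power2_eq_square flip: powr_add)
  have inv: "x powr \<alpha> * x powr (- \<alpha>) = 1" using x by (simp flip: powr_add)
  have A: "?A = x powr \<alpha> * (x powr (- \<alpha>) + cos (pi * \<alpha>))"
    using inv by (simp add: distrib_left mult.commute)
  have A0: "?A > 0" unfolding A using x x_powr_plus_cos_pos[OF x] by simp
  have alg: "(p * c + 1)\<^sup>2 + (p * r)\<^sup>2 = p\<^sup>2 * (c\<^sup>2 + r\<^sup>2) + 2 * p * c + 1" for p c r :: real
    by (simp add: power2_eq_square algebra_simps)
  have R: "?A\<^sup>2 + ?B\<^sup>2 = ?R"
    unfolding alg sq by (simp add: mult.commute)
  have R0: "?R > 0" unfolding R[symmetric] using A0 by (intro add_pos_nonneg) auto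
  have BA: "?B / ?A = sin (pi * \<alpha>) / (x powr (- \<alpha>) + cos (pi * \<alpha>))"
    unfolding A using x by simp
  have m1: "pi * (0 + real k * \<alpha>) * ratio_cdf f x = real k * arctan (?B / ?A)"
    unfolding ratio_cdf_eq_arctan[OF x] BA using alpha by simp
  have m2: "(0 + real k * \<alpha>) / (2 * \<alpha>) = real k / 2" using alpha by simp
  have D: "Delta \<alpha> (0 + real k * \<alpha>) (ratio_cdf f) x = 1 / pi * (sin (real k * arctan (?B / ?A)) / ?R powr (real k / 2))"
    unfolding Delta_def m1 m2 ..
  have "?R ^ k = ?R powr (real k / 2) * ?R powr (real k / 2)"
    using R0 by (simp add: powr_realpow flip: powr_add)
  then show ?thesis
    unfolding D Im_Complex_power_eq_sin_arctan[OF A0] R using R0 by simp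
qed

text \<open>
  The quadratic is the sum of the squares of \<open>x powr \<alpha> * cos (\<alpha> * \<pi>) + 1\<close> and
  \<open>x powr \<alpha> * sin (\<alpha> * \<pi>)\<close>.
\<close>

lemma kernel_denominator_pos:
  assumes x: "x \<ge> 0"
  shows "x powr (2 * \<alpha>) + 2 * x powr \<alpha> * cos (\<alpha> * pi) + 1 > 0"
proof (cases "x = 0")
  case False
  have s: "sin (\<alpha> * pi) > 0" using stable_cos_abs_less_1(2)[OF alpha] by (simp add: mult.commute)
  have sq: "x powr (2 * \<alpha>) = (x powr \<alpha>)\<^sup>2" by (simp add: power2_eq_square flip: powr_add)
  have "(p * c + 1)\<^sup>2 + (p * r)\<^sup>2 = p\<^sup>2 * (c\<^sup>2 + r\<^sup>2) + 2 * p * c + 1" for p c r :: real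
    by (simp add: power2_eq_square algebra_simps)
  then have "x powr (2 * \<alpha>) + 2 * x powr \<alpha> * cos (\<alpha> * pi) + 1 = (x powr \<alpha> * cos (\<alpha> * pi) + 1)\<^sup>2 + (x powr \<alpha> * sin (\<alpha> * pi))\<^sup>2"
    unfolding sq by simp
  moreover have "\<dots> > 0" using False x s by (intro add_nonneg_pos) auto
  ultimately show ?thesis by simp
qed simp

lemma vartheta_kernel_pos:
  assumes x: "0 < x" "x < 1"
  shows "vartheta_kernel \<alpha> k j x > 0"
proof -
  have s: "sin (pi * \<alpha>) > 0" by (rule stable_cos_abs_less_1(2)[OF alpha])
  have inv: "x powr \<alpha> * x powr (- \<alpha>) = 1" using x by (simp flip: powr_add)
  have A: "x powr \<alpha> * cos (\<alpha> * pi) + 1 = x powr \<alpha> * (x powr (- \<alpha>) + cos (pi * \<alpha>))"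
    using inv by (simp add: distrib_left mult.commute)
  have A0: "x powr \<alpha> * cos (\<alpha> * pi) + 1 > 0" unfolding A using x x_powr_plus_cos_pos[OF x] by simp
  have R0: "x powr (2 * \<alpha>) + 2 * x powr \<alpha> * cos (\<alpha> * pi) + 1 > 0"
    using x by (intro kernel_denominator_pos) simp
  show ?thesis unfolding vartheta_kernel_def
    using s A0 R0 x by (intro mult_pos_pos divide_pos_pos zero_less_power) auto
qed

lemma V_PK_zero_vartheta:
  assumes n: "n \<ge> 2" and k: "k \<in> {1..n}"
  shows "V_PK \<alpha> f (mixing_density f 0) n k =
     \<alpha> ^ (k - 1) * Gamma (real k) / Gamma (real n - 1) *
     (\<Sum>j=0..k. real (k choose j) * sin (pi / 2 * real (k - j)) * varphi_coeff \<alpha> n k j)"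
proof -
  let ?R = "\<lambda>x. x powr (2 * \<alpha>) + 2 * x powr \<alpha> * cos (\<alpha> * pi) + 1"
  let ?a = "\<lambda>j. real (k choose j) * sin (pi / 2 * real (k - j))"
  let ?L = "\<lambda>x. (1 - x) powr (real n + 0 - 2) * Delta \<alpha> (0 + real k * \<alpha>) (ratio_cdf f) x"
  let ?v = "\<lambda>j. (LINT x:{0<..<1}|lborel. (1 - x) ^ (n - 2) * vartheta_kernel \<alpha> k j x)"
  define h where "h j x = (1 - x) ^ (n - 2) * (sin (pi * \<alpha>) ^ (k - j) / pi * ((x powr \<alpha> * cos (\<alpha> * pi) + 1) ^ j * (x powr \<alpha>) ^ (k - j) / ?R x ^ k))" for j x
  have hv: "(1 - x) ^ (n - 2) * vartheta_kernel \<alpha> k j x = h j x" if "x \<in> {0<..<1}" for x j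
  proof -
    have "(x powr \<alpha>) ^ (k - j) = x powr (\<alpha> * real (k - j))"
      using that by (simp add: powr_powr flip: powr_realpow)
    then show ?thesis by (simp add: h_def vartheta_kernel_def)
  qed
  have ih: "set_integrable lborel {0<..<1} (h j)" for j
  proof (rule set_integrable_subset)
    show "set_integrable lborel {0..1} (h j)"
    proof (rule borel_integrable_atLeastAtMost')
      have R0: "\<forall>x\<in>{0..1}. ?R x ^ k \<noteq> 0"
        using kernel_denominator_pos by (metis atLeastAtMost_iff less_irrefl power_not_zero)
      have cp: "continuous_on {0..1} (\<lambda>x::real. x powr \<alpha>)" "continuous_on {0..1} (\<lambda>x::real. x powr (2 * \<alpha>))"
        using alpha by (auto intro!: continuous_on_powr' continuous_on_const continuous_on_id)
      \<comment> \<open>\<open>h\<close> has \<open>(x powr \<alpha>) ^ (k - j)\<close> in place of \<open>x powr (\<alpha> * real (k - j))\<close>, since \<open>0 powr 0 = 0\<close>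
        would make the latter discontinuous at 0 for \<open>j = k\<close>.\<close>
      show "continuous_on {0..1} (h j)"
        unfolding h_def
        by (intro continuous_on_mult continuous_on_divide continuous_on_power continuous_on_add
            continuous_on_diff continuous_on_const continuous_on_id cp R0) simp
    qed
  qed auto
  have Dh: "?L x = (\<Sum>j=0..k. ?a j * h j x)"
    if x: "x \<in> {0<..<1}" for x
  proof -
    have e: "(1 - x) powr (real n + 0 - 2) = (1 - x) ^ (n - 2)"
      using x n by (subst powr_realpow[symmetric]) (auto simp: of_nat_diff)
    have x': "0 < x" "x < 1" using x by auto
    show ?thesis
      unfolding e Delta_eq_Im_power[OF x'] Im_Complex_power_binomial sum_divide_distrib sum_distrib_left
      by (intro sum.cong refl) (simp add: h_def power_mult_distrib mult_ac)
  qed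
  have "(LINT x:{0<..<1}|lborel. ?L x)
      = (LINT x:{0<..<1}|lborel. (\<Sum>j=0..k. ?a j * h j x))"
    by (rule set_lebesgue_integral_cong) (use Dh in auto)
  also have "\<dots> = (\<Sum>j=0..k. LINT x:{0<..<1}|lborel. ?a j * h j x)"
    unfolding set_lebesgue_integral_def scaleR_sum_right
    by (rule Bochner_Integration.integral_sum, fold set_integrable_def) (intro set_integrable_mult_right impI ih)
  also have "\<dots> = (\<Sum>j=0..k. ?a j * ?v j)"
  proof (rule sum.cong[OF refl])
    fix j
    have "(LINT x:{0<..<1}|lborel. ?a j * h j x) = ?a j * (LINT x:{0<..<1}|lborel. h j x)"
      by (rule set_integral_mult_right)
    also have "(LINT x:{0<..<1}|lborel. h j x) = ?v j"
      by (rule set_lebesgue_integral_cong) (use hv in auto)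
    finally show "(LINT x:{0<..<1}|lborel. ?a j * h j x) = ?a j * ?v j" .
  qed
  finally have I: "(LINT x:{0<..<1}|lborel. ?L x)
     = (\<Sum>j=0..k. ?a j * ?v j)" .
  have "norm_const f 0 * (\<Sum>j=0..k. ?a j * ?v j)
     = (\<Sum>j=0..k. ?a j * varphi_coeff \<alpha> n k j)"
    unfolding varphi_coeff_def norm_const_zero sum_distrib_left by (simp add: mult_ac)
  moreover have "V_PK \<alpha> f (mixing_density f 0) n k = \<alpha> ^ (k - 1) * Gamma (0 / \<alpha> + real k) / Gamma (0 + real n - 1) *
      (norm_const f 0 * (\<Sum>j=0..k. ?a j * ?v j))"
    unfolding I[symmetric] by (subst V_PK_eq_Delta_integral) (use alpha n k in \<open>auto simp: mult_ac\<close>)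
  ultimately show ?thesis by simp
qed

lemma V_PK_zero_one:
  assumes n: "n \<ge> 2"
  shows "V_PK \<alpha> f (mixing_density f 0) n 1 =
     2 * (1 + cos (\<alpha> * pi)) / Gamma (real n - 1) *
     (LINT x:{0<..<1}|lborel. (1 - x) ^ (n - 2) * x powr \<alpha> /
        (x powr (2 * \<alpha>) + 2 * x powr \<alpha> * cos (\<alpha> * pi) + 1))"
proof -
  let ?R = "\<lambda>x. x powr (2 * \<alpha>) + 2 * x powr \<alpha> * cos (\<alpha> * pi) + 1"
  let ?s = "sin (pi * \<alpha>)"
  let ?L = "\<lambda>x. (1 - x) powr (real n + 0 - 2) * Delta \<alpha> (0 + real 1 * \<alpha>) (ratio_cdf f) x"
  let ?J = "(LINT x:{0<..<1}|lborel. (1 - x) ^ (n - 2) * x powr \<alpha> / ?R x)"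
  have s: "?s > 0" by (rule stable_cos_abs_less_1(2)[OF alpha])
  have "(LINT x:{0<..<1}|lborel. ?L x)
      = (LINT x:{0<..<1}|lborel. ?s / pi * ((1 - x) ^ (n - 2) * x powr \<alpha> / ?R x))"
  proof (rule set_lebesgue_integral_cong)
    show "\<forall>x. x \<in> {0<..<1} \<longrightarrow> ?L x = ?s / pi * ((1 - x) ^ (n - 2) * x powr \<alpha> / ?R x)"
    proof (intro allI impI)
      fix x :: real assume x: "x \<in> {0<..<1}"
      have e: "(1 - x) powr (real n + 0 - 2) = (1 - x) ^ (n - 2)"
        using x n by (subst powr_realpow[symmetric]) (auto simp: of_nat_diff)
      have x': "0 < x" "x < 1" using x by auto
      show "?L x = ?s / pi * ((1 - x) ^ (n - 2) * x powr \<alpha> / ?R x)"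
        unfolding e Delta_eq_Im_power[OF x'] by (simp add: mult_ac)
    qed
  qed simp
  also have "\<dots> = ?s / pi * ?J"
    by (rule set_integral_mult_right)
  finally have I: "(LINT x:{0<..<1}|lborel. ?L x)
      = ?s / pi * ?J" .
  have "V_PK \<alpha> f (mixing_density f 0) n 1 = norm_const f 0 * (\<alpha> ^ (1 - 1) * Gamma (0 / \<alpha> + real 1) / Gamma (0 + real n - 1)) *
      (?s / pi * ?J)"
    unfolding I[symmetric] by (rule V_PK_eq_Delta_integral) (use alpha n in auto)
  also have "\<dots> = 2 * (1 + cos (\<alpha> * pi)) / Gamma (real n - 1) * ?J"
    unfolding norm_const_zero using s by simp
  finally show ?thesis .
qed

end

theorem proposition5p1:
  fixes \<alpha> \<theta> :: real and f :: "real \<Rightarrow> real"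
  assumes "0 < \<alpha>" and "\<alpha> < 1" and "\<theta> > - \<alpha>"
    and "stable_density \<alpha> f"
  shows "prob_space (density lborel (\<lambda>t. ennreal (mixing_density f \<theta> t))) \<and>
    (\<forall>n\<ge>2. \<forall>k\<in>{1..n}.
       V_PK \<alpha> f (mixing_density f \<theta>) n k =
         norm_const f \<theta> * (\<alpha> ^ (k - 1) * Gamma (\<theta> / \<alpha> + real k) / Gamma (\<theta> + real n - 1)) *
         (LINT x:{0<..<1}|lborel.
            (1 - x) powr (real n + \<theta> - 2) * Delta \<alpha> (\<theta> + real k * \<alpha>) (ratio_cdf f) x)) \<and>
    (\<theta> = 0 \<longrightarrow>
       (\<forall>n\<ge>2. \<forall>k\<in>{1..n}.
          V_PK \<alpha> f (mixing_density f \<theta>) n k =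
            \<alpha> ^ (k - 1) * Gamma (real k) / Gamma (real n - 1) *
            (\<Sum>j=0..k. real (k choose j) * sin (pi / 2 * real (k - j)) * varphi_coeff \<alpha> n k j) \<and>
          (\<forall>j\<le>k. \<forall>x. 0 < x \<and> x < 1 \<longrightarrow> vartheta_kernel \<alpha> k j x > 0))) \<and>
    (\<theta> = 0 \<longrightarrow>
       (\<forall>n>1.
          V_PK \<alpha> f (mixing_density f \<theta>) n 1 =
            2 * (1 + cos (\<alpha> * pi)) / Gamma (real n - 1) *
            (LINT x:{0<..<1}|lborel.
               (1 - x) ^ (n - 2) * x powr \<alpha> /
               (x powr (2 * \<alpha>) + 2 * x powr \<alpha> * cos (\<alpha> * pi) + 1))))"
proof -
  interpret positive_stable \<alpha> f
    using assms by unfold_locales auto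
  show ?thesis
  proof (intro conjI allI impI ballI)
    show "prob_space (density lborel (\<lambda>t. ennreal (mixing_density f \<theta> t)))"
      by (rule prob_space_mixing_density[OF assms(3)])
  next
    fix n k :: nat assume n: "2 \<le> n" and k: "k \<in> {1..n}"
    show "V_PK \<alpha> f (mixing_density f \<theta>) n k =
         norm_const f \<theta> * (\<alpha> ^ (k - 1) * Gamma (\<theta> / \<alpha> + real k) / Gamma (\<theta> + real n - 1)) *
         (LINT x:{0<..<1}|lborel.
            (1 - x) powr (real n + \<theta> - 2) * Delta \<alpha> (\<theta> + real k * \<alpha>) (ratio_cdf f) x)"
      by (rule V_PK_eq_Delta_integral[OF assms(3) n k])
  next
    fix n k :: nat assume z: "\<theta> = 0" and n: "2 \<le> n" and k: "k \<in> {1..n}"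
    show "V_PK \<alpha> f (mixing_density f \<theta>) n k =
            \<alpha> ^ (k - 1) * Gamma (real k) / Gamma (real n - 1) *
            (\<Sum>j=0..k. real (k choose j) * sin (pi / 2 * real (k - j)) * varphi_coeff \<alpha> n k j)"
      unfolding z by (rule V_PK_zero_vartheta[OF n k])
  next
    fix k j :: nat and x :: real assume "0 < x \<and> x < 1"
    then show "vartheta_kernel \<alpha> k j x > 0" by (intro vartheta_kernel_pos) auto
  next
    fix n :: nat assume z: "\<theta> = 0" and n: "1 < n"
    then have n2: "n \<ge> 2" by simp
    show "V_PK \<alpha> f (mixing_density f \<theta>) n 1 =
            2 * (1 + cos (\<alpha> * pi)) / Gamma (real n - 1) *
            (LINT x:{0<..<1}|lborel.
               (1 - x) ^ (n - 2) * x powr \<alpha> /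
               (x powr (2 * \<alpha>) + 2 * x powr \<alpha> * cos (\<alpha> * pi) + 1))"
      unfolding z by (rule V_PK_zero_one[OF n2])
  qed
qed

end
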